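(* Let $T$ be an endomorphism of $(X,\mathcal{A},\mu)$. The dynamical system $(X,\mathcal{A},\mu,T)$ is remotely infinite if and only if for every $f\in L^{\Phi}(\mu)$, $$\left\|\widehat{T_{\mathcal{P}}^{n}}f\right\|_{*}\to0\quad\text{as } n\to+\infty,$$ or, equivalently, if and only if for every $f\in L^{1}_{0}(\mu)$ (or, equivalently, for every $f\in L^{1}(\mu)$), $$\left\|\widehat{T^{n}}f\right\|_{*}\to0\quad\text{as } n\to+\infty.$$
   Context: $(X,\mathcal{A},\mu)$ is a non-atomic infinite Borel measure space, i.e. measurably isomorphic to the real line with its Borel sets and Lebesgue measure. An endomorphism $T$ is a measurable map $T:X\to X$ with $\mu(T^{-1}A)=\mu(A)$ for all $A\in\mathcal{A}$. The system is remotely infinite if $\bigcap_{n\ge0}T^{-n}\mathcal{A}$ contains only sets of zero or infinite $\mu$-measure. $L^{1}_{0}(\mu)=\{f\in L^{1}(\mu):\int_X f\,d\mu=0\}$. Poisson space $(X^{*},\mathcal{A}^{*},\mu^{*})$: $X^{*}$ is the set of measures of the form $\sum_{i\in I}\delta_{x_i}$, $x_i\in X$, $I$ countable; $\mathcal{A}^{*}=\sigma\{N(A): A\in\mathcal{A}\}$ with $N(A)(\omega)=\omega(A)$; $\mu^{*}$ is the unique probability measure such that for pairwise disjoint $A_1,\dots,A_k\in\mathcal{A}$ of finite $\mu$-measure, $N(A_1),\dots,N(A_k)$ are independent and Poisson distributed with parameters $\mu(A_1),\dots,\mu(A_k)$. For $f\in L^1(\mu)$, $N(f)(\omega)=\int_X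 f\,d\omega$ and $\mu(f)=\int_X f\,d\mu$. Let $\Phi(x)=x^{2}$ for $0\le x\le1$ and $\Phi(x)=2x-1$ for $x>1$; $L^{\Phi}(\mu)=\{f\in L^{0}(\mu):\int_X\Phi(|f|)\,d\mu<\infty\}$, which contains $L^1(\mu)$. For $f\in L^{\Phi}(\mu)$, $I_1(f):=\lim_{\epsilon\to0}\big(N(f1_{|f|>\epsilon})-\mu(f1_{|f|>\epsilon})\big)$ (limit in $\mu^{*}$-measure), an integrable centered random variable, and the Poisson-Orlicz norm is $\|f\|_{*}:=\|I_1(f)\|_{L^{1}(\mu^{*})}$. Transfer operators: $\widehat{T}$ on $L^{1}(\mu)$ is characterized by $\int_X\widehat{T}f\cdot g\,d\mu=\int_X f\cdot g\circ T\,d\mu$ for $f\in L^{1}(\mu)$, $g\in L^{\infty}(\mu)$. The Poisson-transfer operator $\widehat{T}_{\mathcal{P}}$ on $L^{\Phi}(\mu)$ is characterized by $\int_X\widehat{T}_{\mathcal{P}}f\cdot g\,d\mu=\int_X f\cdot g\circ T\,d\mu$ for $f\in L^{\Phi}(\mu)$, $g\in L^{2}(\mu)\cap L^{\infty}(\mu)$. $\widehat{T^{n}}$ and $\widehat{T^{n}_{\mathcal{P}}}$ denote these operators for $T^{n}$ (equivalently the $n$-th iterates of $\widehat{T}$ and $\widehat{T}_{\mathcal{P}}$). *)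

theory Defs
  imports "HOL-Probability.Probability"
begin

section \<open>The base space and its endomorphisms\<close>

definition lebesgue_line_space :: "'a measure \<Rightarrow> bool" where
  "lebesgue_line_space M \<longleftrightarrow>
     (\<exists>(\<phi> :: 'a \<Rightarrow> real) \<psi>. \<phi> \<in> measurable M lborel \<and> \<psi> \<in> measurable lborel M \<and>
        (\<forall>x\<in>space M. \<psi> (\<phi> x) = x) \<and> (\<forall>y. \<phi> (\<psi> y) = y) \<and>
        distr M lborel \<phi> = lborel)"

definition endomorphism :: "'a measure \<Rightarrow> ('a \<Rightarrow> 'a) \<Rightarrow> bool" where
  "endomorphism M T \<longleftrightarrow>
     T \<in> measurable M M \<and> (\<forall>A\<in>sets M. emeasure M (T -` A \<inter> space M) = emeasure M A)"

definition remotely_infinite :: "'a measure \<Rightarrow> ('a \<Rightarrow> 'a) \<Rightarrow> bool" where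
  "remotely_infinite M T \<longleftrightarrow>
     (\<forall>A \<in> (\<Inter>n. sets (vimage_algebra (space M) (T ^^ n) M)).
        emeasure M A = 0 \<or> emeasure M A = \<infinity>)"


section \<open>Function spaces\<close>

text \<open>Functions, not classes modulo null sets, represent the elements of the spaces
  below; every notion applied to them later depends on the class only.\<close>

definition L1 :: "'a measure \<Rightarrow> ('a \<Rightarrow> real) set" where
  "L1 M = {f. integrable M f}"

definition L1_0 :: "'a measure \<Rightarrow> ('a \<Rightarrow> real) set" where
  "L1_0 M = {f \<in> L1 M. (\<integral>x. f x \<partial>M) = 0}"

definition L2 :: "'a measure \<Rightarrow> ('a \<Rightarrow> real) set" where
  "L2 M = {f \<in> borel_measurable M. integrable M (\<lambda>x. (f x)\<^sup>2)}"

definition L_infty :: "'a measure \<Rightarrow> ('a \<Rightarrow> real) set" where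
  "L_infty M = {f \<in> borel_measurable M. \<exists>C. AE x in M. \<bar>f x\<bar> \<le> C}"

text \<open>Only the values of \<open>\<Phi>\<close> at nonnegative arguments matter.\<close>

definition Phi :: "real \<Rightarrow> real" where
  "Phi x = (if x \<le> 1 then x\<^sup>2 else 2 * x - 1)"

definition L_Phi :: "'a measure \<Rightarrow> ('a \<Rightarrow> real) set" where
  "L_Phi M = {f \<in> borel_measurable M. (\<integral>\<^sup>+ x. ennreal (Phi \<bar>f x\<bar>) \<partial>M) < \<infinity>}"


section \<open>The Poisson space\<close>

text \<open>The measures \<open>\<Sum>i\<in>I. \<delta>\<^bsub>x i\<^esub>\<close> for countable \<open>I\<close>; it suffices to
  let \<open>I\<close> range over sets of natural numbers. Repeated points are allowed.\<close>

definition point_measures :: "'a measure \<Rightarrow> 'a measure set" where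
  "point_measures M =
     {\<omega>. sets \<omega> = sets M \<and>
          (\<exists>(I :: nat set) x. x ` I \<subseteq> space M \<and>
             (\<forall>A\<in>sets M. emeasure \<omega> A =
                (\<integral>\<^sup>+ i. emeasure (return M (x i)) A \<partial>count_space I)))}"

definition point_measure_algebra :: "'a measure \<Rightarrow> 'a measure measure" where
  "point_measure_algebra M =
     sigma (point_measures M)
       {(\<lambda>\<omega>. emeasure \<omega> A) -` B \<inter> point_measures M | A B. A \<in> sets M \<and> B \<in> sets borel}"

text \<open>The Poisson distribution is spelled out because \<open>poisson_pmf\<close> excludes the
  parameter 0, which occurs here for null sets.\<close>

definition poisson_measure :: "'a measure \<Rightarrow> 'a measure measure \<Rightarrow> bool" where
  "poisson_measure M P \<longleftrightarrow>
     prob_space P \<and> sets P = sets (point_measure_algebra M) \<and>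
     (\<forall>(k :: nat) A.
        (\<forall>i<k. A i \<in> sets M \<and> emeasure M (A i) < \<infinity>) \<and> disjoint_family_on A {..<k} \<longrightarrow>
        prob_space.indep_vars P (\<lambda>_. borel) (\<lambda>i \<omega>. emeasure \<omega> (A i)) {..<k} \<and>
        (\<forall>i<k. \<forall>j::nat.
           measure P {\<omega> \<in> space P. emeasure \<omega> (A i) = of_nat j} =
             measure M (A i) ^ j / fact j * exp (- measure M (A i))))"


section \<open>The Poisson-Orlicz norm\<close>

definition large_part :: "('a \<Rightarrow> real) \<Rightarrow> real \<Rightarrow> 'a \<Rightarrow> real" where
  "large_part f \<epsilon> x = f x * indicator {x. \<bar>f x\<bar> > \<epsilon>} x"

definition compensated_N :: "'a measure \<Rightarrow> ('a \<Rightarrow> real) \<Rightarrow> 'a measure \<Rightarrow> real" where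
  "compensated_N M f \<omega> = (\<integral>x. f x \<partial>\<omega>) - (\<integral>x. f x \<partial>M)"

text \<open>A limit in measure is determined only up to null sets; \<open>I1\<close> picks a representative.\<close>

definition I1 :: "'a measure \<Rightarrow> 'a measure measure \<Rightarrow> ('a \<Rightarrow> real) \<Rightarrow> 'a measure \<Rightarrow> real" where
  "I1 M P f = (SOME Y. Y \<in> borel_measurable P \<and>
     (\<forall>\<delta>>0. ((\<lambda>\<epsilon>. measure P {\<omega> \<in> space P.
                 \<bar>compensated_N M (large_part f \<epsilon>) \<omega> - Y \<omega>\<bar> > \<delta>}) \<longlongrightarrow> 0) (at_right 0)))"

definition poisson_orlicz_norm ::
    "'a measure \<Rightarrow> 'a measure measure \<Rightarrow> ('a \<Rightarrow> real) \<Rightarrow> ennreal" where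
  "poisson_orlicz_norm M P f = (\<integral>\<^sup>+ \<omega>. ennreal \<bar>I1 M P f \<omega>\<bar> \<partial>P)"


section \<open>Transfer operators\<close>

text \<open>Again the characterizing identities determine the image only up to null sets.\<close>

definition transfer :: "'a measure \<Rightarrow> ('a \<Rightarrow> 'a) \<Rightarrow> ('a \<Rightarrow> real) \<Rightarrow> 'a \<Rightarrow> real" where
  "transfer M T f = (SOME h. h \<in> L1 M \<and>
     (\<forall>g\<in>L_infty M. (\<integral>x. h x * g x \<partial>M) = (\<integral>x. f x * g (T x) \<partial>M)))"

definition poisson_transfer :: "'a measure \<Rightarrow> ('a \<Rightarrow> 'a) \<Rightarrow> ('a \<Rightarrow> real) \<Rightarrow> 'a \<Rightarrow> real" where
  "poisson_transfer M T f = (SOME h. h \<in> L_Phi M \<and>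
     (\<forall>g \<in> L2 M \<inter> L_infty M. (\<integral>x. h x * g x \<partial>M) = (\<integral>x. f x * g (T x) \<partial>M)))"

end

theory Submission
  imports Defs
begin

text \<open>The bound \<open>\<parallel>g + h\<parallel>\<^sub>* \<le> \<parallel>g\<parallel>\<^sub>2 + 2 \<parallel>h\<parallel>\<^sub>1\<close> holds because the compensated integral
  is an isometry of \<open>L\<^sup>2\<close> and has norm at most 2 on \<open>L\<^sup>1\<close>. As transfer operators contract both
  spaces and every \<open>f \<in> L\<^sup>\<Phi>\<close> is an \<open>L\<^sup>2\<close> function plus an \<open>L\<^sup>1\<close> function of arbitrarily small
  norm, it is enough that \<open>T\<close>-transfers of \<open>L\<^sup>2\<close> functions tend to 0 in \<open>L\<^sup>2\<close>. Composed with
  \<open>T\<^sup>n\<close> they are decreasing orthogonal projections of \<open>f\<close>, so they converge to a square integrable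
  function measurable for the tail \<open>\<sigma>\<close>-algebra, and remote infiniteness forces it to vanish.

  Conversely, let \<open>A\<close> be a tail set with \<open>0 < \<mu>(A) < \<infinity>\<close>, say \<open>A = T\<^sup>-\<^sup>n A\<^sub>n\<close>, and subtract from its
  indicator a multiple of the indicator of a huge set \<open>B\<close> to get \<open>f\<close> of integral 0. The part
  from \<open>A\<close> is transferred to the indicator of \<open>A\<^sub>n\<close>, whose norm depends on \<open>\<mu>(A)\<close> only, while
  the part from \<open>B\<close> is small in \<open>L\<^sup>2\<close>.\<close>

section \<open>Transfer on the base space\<close>

text \<open>A function in \<open>L_Phi\<close> need not be integrable, so its compensated integral
  exists only as a limit over truncations, and this limit as well as both transfer operators are
  picked by \<open>SOME\<close>. Everything about the operators is therefore drawn from their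
  pairings with \<open>L2 M \<inter> L_infty M\<close>, which determine an element of
  \<open>L_Phi\<close> almost everywhere. An abstract sequence \<open>u n\<close> with the right
  pairings then stands for either operator, and the three equivalences collapse: convergence is
  proved for every \<open>f\<close> in \<open>L_Phi\<close>, the largest space, and refuted by one
  function in \<open>L1_0\<close>, the smallest. The converse rests on a feature of infinite
  measure: a fixed mass spread evenly over a set of measure b has L2 norm of order b^(-1/2), so the
  integral can be corrected to 0 at an arbitrarily small cost. On a space of finite measure the cost
  of such a correction would be bounded from below.\<close>

lemma max_prod: "\<bar>max 0 a * max 0 b\<bar> \<le> \<bar>a * (b :: real)\<bar>"
  unfolding abs_mult by (intro mult_mono) auto

locale measure_preserving = sigma_finite_measure M for M :: "'a measure" +
  fixes T :: "'a \<Rightarrow> 'a"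
  assumes T_measurable [measurable]: "T \<in> measurable M M"
    and distr_T: "distr M M T = M"
begin

lemma nn_integral_T:
  assumes "g \<in> borel_measurable M"
  shows "(\<integral>\<^sup>+ x. g (T x) \<partial>M) = (\<integral>\<^sup>+ x. g x \<partial>M)"
  using nn_integral_distr[OF T_measurable, of g] assms by (simp add: distr_T)

lemma integrable_T:
  fixes g :: "'a \<Rightarrow> real"
  assumes "integrable M g"
  shows "integrable M (\<lambda>x. g (T x))"
  using integrable_distr[OF T_measurable, of g] assms by (simp add: distr_T)

lemma integral_T:
  fixes g :: "'a \<Rightarrow> real"
  assumes "g \<in> borel_measurable M"
  shows "(\<integral>x. g (T x) \<partial>M) = (\<integral>x. g x \<partial>M)"
  using integral_distr[OF T_measurable assms] by (simp add: distr_T)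

text \<open>The transfer of a nonnegative function, as the density of the image under
  \<open>T\<close> of the measure with density \<open>f\<close>. Working in \<open>ennreal\<close>
  lets the duality \<open>nn_integral_push\<close> hold for every measurable \<open>f\<close>,
  before any question of integrability; the density exists because \<open>T\<close> pulls null sets
  back to null sets.\<close>

definition push :: "('a \<Rightarrow> ennreal) \<Rightarrow> 'a \<Rightarrow> ennreal" where
  "push f = RN_deriv M (distr (density M f) M T)"

lemma push_measurable [measurable]: "push f \<in> borel_measurable M"
  unfolding push_def by simp

lemma nn_integral_push:
  assumes [measurable]: "f \<in> borel_measurable M" "g \<in> borel_measurable M"
  shows "(\<integral>\<^sup>+ x. push f x * g x \<partial>M) = (\<integral>\<^sup>+ x. f x * g (T x) \<partial>M)"
proof -
  let ?N = "distr (density M f) M T"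
  have "absolutely_continuous M ?N"
    unfolding absolutely_continuous_def
  proof
    fix A assume A: "A \<in> null_sets M"
    then have [measurable]: "A \<in> sets M" by auto
    have "emeasure M (T -` A \<inter> space M) = emeasure M A"
      using emeasure_distr[OF T_measurable, of A] by (simp add: distr_T)
    then have "T -` A \<inter> space M \<in> null_sets M"
      using A by (intro null_setsI) auto
    then have "T -` A \<inter> space M \<in> null_sets (density M f)"
      using absolutely_continuousI_density[of f M] unfolding absolutely_continuous_def by auto
    then show "A \<in> null_sets ?N" by (auto simp: null_sets_def emeasure_distr)
  qed
  then have "density M (push f) = ?N"
    unfolding push_def by (rule density_RN_deriv) simp
  then have "(\<integral>\<^sup>+ x. g x \<partial>density M (push f)) = (\<integral>\<^sup>+ x. g x \<partial>?N)" by simp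
  then show ?thesis by (simp add: nn_integral_density nn_integral_distr)
qed

lemma push_finite:
  assumes [measurable]: "f \<in> borel_measurable M" and "(\<integral>\<^sup>+ x. f x \<partial>M) < \<infinity>"
  shows "AE x in M. push f x < \<infinity>"
proof -
  have "(\<integral>\<^sup>+ x. push f x \<partial>M) \<noteq> \<infinity>"
    using nn_integral_push[of f "\<lambda>_. 1"] assms(2) by simp
  then have "AE x in M. push f x \<noteq> \<infinity>"
    using nn_integral_PInf_AE[OF push_measurable] by blast
  then show ?thesis by (simp add: top.not_eq_extremum)
qed

text \<open>Duality, 2xy \<le> x^2 + y^2 and invariance would give 2 I \<le> J + I for the two
  integrals I and J, but cancelling I needs it to be finite, which is not known in advance. Hence
  the truncations \<open>\<phi> k\<close>, bounded and vanishing off sets of finite measure, and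
  Fatou's lemma at the end.\<close>

lemma push_square:
  assumes [measurable]: "f \<in> borel_measurable M"
  shows "(\<integral>\<^sup>+ x. (push f x)\<^sup>2 \<partial>M) \<le> (\<integral>\<^sup>+ x. (f x)\<^sup>2 \<partial>M)"
proof -
  obtain S :: "nat \<Rightarrow> 'a set" where S: "range S \<subseteq> sets M" "(\<Union>i. S i) = space M"
      "\<And>i. emeasure M (S i) \<noteq> \<infinity>" "incseq S"
    using sigma_finite_incseq by blast
  have [measurable]: "\<And>i. S i \<in> sets M" using S by auto
  define \<phi> where "\<phi> k x = min (push f x) (of_nat k) * indicator (S k) x" for k :: nat and x
  have [measurable]: "\<phi> k \<in> borel_measurable M" for k unfolding \<phi>_def by measurable
  have bd: "(\<integral>\<^sup>+ x. (\<phi> k x)\<^sup>2 \<partial>M) \<le> (\<integral>\<^sup>+ x. (f x)\<^sup>2 \<partial>M)" for k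
  proof -
    let ?I = "(\<integral>\<^sup>+ x. (\<phi> k x)\<^sup>2 \<partial>M)"
    have "?I \<le> (\<integral>\<^sup>+ x. (of_nat k)\<^sup>2 * indicator (S k) x \<partial>M)"
      unfolding \<phi>_def by (intro nn_integral_mono) (auto split: split_indicator intro!: power_mono)
    also have "\<dots> < \<infinity>"
      using S(3)[of k] by (subst nn_integral_cmult)
        (auto simp: ennreal_mult_less_top top.not_eq_extremum ennreal_of_nat_eq_real_of_nat ennreal_power)
    finally have fin: "?I < \<infinity>" .
    have "2 * ?I \<le> 2 * (\<integral>\<^sup>+ x. push f x * \<phi> k x \<partial>M)"
      unfolding \<phi>_def power2_eq_square
      by (intro mult_left_mono nn_integral_mono) (auto split: split_indicator intro!: mult_right_mono)
    also have "\<dots> = (\<integral>\<^sup>+ x. 2 * f x * \<phi> k (T x) \<partial>M)"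
      by (subst nn_integral_push) (simp_all add: nn_integral_cmult mult.assoc)
    also have "\<dots> \<le> (\<integral>\<^sup>+ x. (f x)\<^sup>2 + (\<phi> k (T x))\<^sup>2 \<partial>M)"
      by (intro nn_integral_mono sum_of_squares_ge_ennreal)
    also have "\<dots> = (\<integral>\<^sup>+ x. (f x)\<^sup>2 \<partial>M) + ?I"
      using nn_integral_T[of "\<lambda>x. (\<phi> k x)\<^sup>2"] by (subst nn_integral_add) simp_all
    finally have "?I + ?I \<le> (\<integral>\<^sup>+ x. (f x)\<^sup>2 \<partial>M) + ?I" by (simp only: mult_2)
    then have "?I + ?I \<le> ?I + (\<integral>\<^sup>+ x. (f x)\<^sup>2 \<partial>M)" by (simp only: add.commute)
    then show ?thesis using fin unfolding ennreal_add_left_cancel_le by auto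
  qed
  have lim: "(\<lambda>k. (\<phi> k x)\<^sup>2) \<longlonglongrightarrow> (push f x)\<^sup>2" if x: "x \<in> space M" for x
  proof -
    obtain j where j: "x \<in> S j" using x S(2) by auto
    have eq: "\<forall>\<^sub>F k in sequentially. (min (push f x) (of_nat k))\<^sup>2 = (\<phi> k x)\<^sup>2"
      using eventually_ge_at_top[of j]
    proof eventually_elim
      case (elim k)
      then have "x \<in> S k" using j S(4) by (auto simp: incseq_def)
      then show ?case by (simp add: \<phi>_def)
    qed
    have "(\<lambda>k. (min (push f x) (of_nat k))\<^sup>2) \<longlonglongrightarrow> (push f x)\<^sup>2"
    proof (cases "push f x")
      case (real r)
      obtain n :: nat where "r \<le> n" using real_arch_simple by blast
      then have n: "push f x \<le> of_nat n"
        using real by (simp add: ennreal_of_nat_eq_real_of_nat)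
      have "\<forall>\<^sub>F k in sequentially. (push f x)\<^sup>2 = (min (push f x) (of_nat k))\<^sup>2"
        using eventually_ge_at_top[of n]
      proof eventually_elim
        case (elim k)
        then have "push f x \<le> of_nat k" using n order_trans of_nat_mono by blast
        then show ?case by (simp add: min_absorb1)
      qed
      then show ?thesis by (rule Lim_transform_eventually[OF tendsto_const])
    next
      case top
      have "(of_nat k :: ennreal) \<le> (min (push f x) (of_nat k))\<^sup>2" for k :: nat
      proof -
        have "real k \<le> (real k)\<^sup>2" by (cases k) (auto simp: power2_eq_square algebra_simps)
        then show ?thesis
          by (simp add: top ennreal_of_nat_eq_real_of_nat ennreal_power ennreal_leI)
      qed
      then have "(\<lambda>k. (min (push f x) (of_nat k))\<^sup>2) \<longlonglongrightarrow> \<top>"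
        by (intro tendsto_sandwich[OF _ _ of_nat_tendsto_top_ennreal tendsto_const]) auto
      then show ?thesis by (simp add: top power2_eq_square)
    qed
    then show ?thesis using eq by (rule Lim_transform_eventually)
  qed
  have "(\<integral>\<^sup>+ x. (push f x)\<^sup>2 \<partial>M) = (\<integral>\<^sup>+ x. liminf (\<lambda>k. (\<phi> k x)\<^sup>2) \<partial>M)"
    by (intro nn_integral_cong) (simp add: lim_imp_Liminf[OF _ lim])
  also have "\<dots> \<le> liminf (\<lambda>k. \<integral>\<^sup>+ x. (\<phi> k x)\<^sup>2 \<partial>M)"
    by (intro nn_integral_liminf) measurable
  also have "\<dots> \<le> liminf (\<lambda>k::nat. \<integral>\<^sup>+ x. (f x)\<^sup>2 \<partial>M)"
    by (intro Liminf_mono) (simp add: bd)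
  also have "\<dots> = (\<integral>\<^sup>+ x. (f x)\<^sup>2 \<partial>M)" by (simp add: Liminf_const)
  finally show ?thesis .
qed

text \<open>\<open>ennreal\<close> sends negative reals to 0, so the two terms are the transfers of
  the positive and the negative part. \<open>enn2real\<close> turns \<infinity> into 0, which is
  harmless once both pushes are finite almost everywhere.\<close>

definition trans :: "('a \<Rightarrow> real) \<Rightarrow> 'a \<Rightarrow> real" where
  "trans f x = enn2real (push (\<lambda>x. ennreal (f x)) x) - enn2real (push (\<lambda>x. ennreal (- f x)) x)"

lemma trans_measurable [measurable]: "trans f \<in> borel_measurable M"
  unfolding trans_def by measurable

lemma has_integral_push:
  fixes a b :: "'a \<Rightarrow> real"
  assumes [measurable]: "a \<in> borel_measurable M" "b \<in> borel_measurable M"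
    and fin: "AE x in M. push (\<lambda>x. ennreal (a x)) x < \<infinity>"
    and int: "integrable M (\<lambda>x. a x * b (T x))"
  shows "has_bochner_integral M (\<lambda>x. enn2real (push (\<lambda>x. ennreal (a x)) x) * max 0 (b x))
           (\<integral>x. max 0 (a x) * max 0 (b (T x)) \<partial>M)"
proof (rule has_bochner_integral_nn_integral)
  have i: "integrable M (\<lambda>x. max 0 (a x) * max 0 (b (T x)))"
    by (rule Bochner_Integration.integrable_bound[OF int]) (auto simp: max_prod)
  have "(\<integral>\<^sup>+ x. ennreal (enn2real (push (\<lambda>x. ennreal (a x)) x) * max 0 (b x)) \<partial>M)
      = (\<integral>\<^sup>+ x. push (\<lambda>x. ennreal (a x)) x * ennreal (max 0 (b x)) \<partial>M)"
    using fin by (intro nn_integral_cong_AE) (auto elim!: eventually_mono simp: ennreal_mult less_top)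
  also have "\<dots> = (\<integral>\<^sup>+ x. ennreal (a x) * ennreal (max 0 (b (T x))) \<partial>M)"
    by (rule nn_integral_push) measurable
  also have "\<dots> = (\<integral>\<^sup>+ x. ennreal (max 0 (a x) * max 0 (b (T x))) \<partial>M)"
    by (intro nn_integral_cong) (auto simp: ennreal_mult max_def ennreal_neg)
  also have "\<dots> = ennreal (\<integral>x. max 0 (a x) * max 0 (b (T x)) \<partial>M)"
    using i by (intro nn_integral_eq_integral) auto
  finally show "(\<integral>\<^sup>+ x. ennreal (enn2real (push (\<lambda>x. ennreal (a x)) x) * max 0 (b x)) \<partial>M)
      = ennreal (\<integral>x. max 0 (a x) * max 0 (b (T x)) \<partial>M)" .
  show "0 \<le> (\<integral>x. max 0 (a x) * max 0 (b (T x)) \<partial>M)"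
    by (intro Bochner_Integration.integral_nonneg) auto
qed auto

text \<open>The four products of positive and negative parts of \<open>f\<close> and
  \<open>g\<close> are handled by \<open>has_integral_push\<close> and recombined. Integrability is
  asked of the product \<open>f x * g (T x)\<close>, so that the pairing of L1 with bounded
  functions and that of L2 with itself are both instances.\<close>

lemma has_integral_trans:
  fixes f g :: "'a \<Rightarrow> real"
  assumes [measurable]: "f \<in> borel_measurable M" "g \<in> borel_measurable M"
    and fin: "AE x in M. push (\<lambda>x. ennreal (f x)) x < \<infinity>"
      "AE x in M. push (\<lambda>x. ennreal (- f x)) x < \<infinity>"
    and int: "integrable M (\<lambda>x. f x * g (T x))"
  shows "has_bochner_integral M (\<lambda>x. trans f x * g x) (\<integral>x. f x * g (T x) \<partial>M)"
proof -
  let ?p = "\<lambda>x. enn2real (push (\<lambda>x. ennreal (f x)) x)"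
  let ?q = "\<lambda>x. enn2real (push (\<lambda>x. ennreal (- f x)) x)"
  have int': "integrable M (\<lambda>x. - f x * g (T x))" "integrable M (\<lambda>x. f x * - g (T x))"
    "integrable M (\<lambda>x. - f x * - g (T x))"
    using int by simp_all
  have sub: "integrable M (\<lambda>x. max 0 (a x) * max 0 (b (T x)))"
    if "integrable M (\<lambda>x. a x * b (T x))" "a \<in> borel_measurable M" "b \<in> borel_measurable M"
    for a b :: "'a \<Rightarrow> real"
    using that(2,3) by (intro Bochner_Integration.integrable_bound[OF that(1)]) (auto simp: max_prod)
  note i = sub[OF int] sub[OF int'(1)] sub[of f "\<lambda>x. - g x"] sub[of "\<lambda>x. - f x" "\<lambda>x. - g x"]
  note h = has_integral_push[of f g, OF _ _ fin(1) int]
    has_integral_push[of "\<lambda>x. - f x" g, OF _ _ fin(2) int'(1)]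
    has_integral_push[of f "\<lambda>x. - g x", OF _ _ fin(1) int'(2)]
    has_integral_push[of "\<lambda>x. - f x" "\<lambda>x. - g x", OF _ _ fin(2) int'(3)]
  have "has_bochner_integral M
     (\<lambda>x. (?p x * max 0 (g x) - ?q x * max 0 (g x)) - (?p x * max 0 (- g x) - ?q x * max 0 (- g x)))
     (((\<integral>x. max 0 (f x) * max 0 (g (T x)) \<partial>M) - (\<integral>x. max 0 (- f x) * max 0 (g (T x)) \<partial>M))
      - ((\<integral>x. max 0 (f x) * max 0 (- g (T x)) \<partial>M) - (\<integral>x. max 0 (- f x) * max 0 (- g (T x)) \<partial>M)))"
    by (intro has_bochner_integral_diff h) measurable
  moreover have "(?p x * max 0 (g x) - ?q x * max 0 (g x)) - (?p x * max 0 (- g x) - ?q x * max 0 (- g x))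
     = trans f x * g x" for x
    unfolding trans_def by (auto simp: max_def algebra_simps)
  moreover have "((\<integral>x. max 0 (f x) * max 0 (g (T x)) \<partial>M) - (\<integral>x. max 0 (- f x) * max 0 (g (T x)) \<partial>M))
      - ((\<integral>x. max 0 (f x) * max 0 (- g (T x)) \<partial>M) - (\<integral>x. max 0 (- f x) * max 0 (- g (T x)) \<partial>M))
     = (\<integral>x. (max 0 (f x) * max 0 (g (T x)) - max 0 (- f x) * max 0 (g (T x)))
      - (max 0 (f x) * max 0 (- g (T x)) - max 0 (- f x) * max 0 (- g (T x))) \<partial>M)"
    using i int' by simp
  moreover have "\<dots> = (\<integral>x. f x * g (T x) \<partial>M)"
    by (intro Bochner_Integration.integral_cong) (auto simp: max_def)
  ultimately show ?thesis by simp
qed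

lemma trans_L1:
  assumes "f \<in> L1 M"
  shows "trans f \<in> L1 M" "(\<integral>x. \<bar>trans f x\<bar> \<partial>M) \<le> (\<integral>x. \<bar>f x\<bar> \<partial>M)"
    and "\<And>g. g \<in> L_infty M \<Longrightarrow> has_bochner_integral M (\<lambda>x. trans f x * g x) (\<integral>x. f x * g (T x) \<partial>M)"
proof -
  have f: "integrable M f" and [measurable]: "f \<in> borel_measurable M"
    using assms by (auto simp: L1_def)
  have nf: "(\<integral>\<^sup>+ x. ennreal (f x) \<partial>M) < \<infinity>" "(\<integral>\<^sup>+ x. ennreal (- f x) \<partial>M) < \<infinity>"
    using f by (auto simp: real_integrable_def top.not_eq_extremum)
  have fin: "AE x in M. push (\<lambda>x. ennreal (f x)) x < \<infinity>" "AE x in M. push (\<lambda>x. ennreal (- f x)) x < \<infinity>"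
    by (intro push_finite nf, measurable)+
  have *: "has_bochner_integral M (\<lambda>x. trans f x * g x) (\<integral>x. f x * g (T x) \<partial>M)"
    if g: "g \<in> L_infty M" for g
  proof -
    from g obtain C where [measurable]: "g \<in> borel_measurable M" and C: "AE x in M. \<bar>g x\<bar> \<le> C"
      by (auto simp: L_infty_def)
    have "AE x in M. \<bar>g (T x)\<bar> \<le> C"
      using C by (subst (asm) distr_T[symmetric]) (simp add: AE_distr_iff)
    then have b: "AE x in M. norm (f x * g (T x)) \<le> norm (C * f x)"
    proof eventually_elim
      case (elim x)
      then have "\<bar>f x\<bar> * \<bar>g (T x)\<bar> \<le> \<bar>f x\<bar> * \<bar>C\<bar>" by (intro mult_left_mono) auto
      then show ?case by (simp add: abs_mult mult.commute)
    qed
    have "integrable M (\<lambda>x. f x * g (T x))"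
      by (rule Bochner_Integration.integrable_bound[OF integrable_mult_right[OF f] _ b]) measurable
    then show ?thesis by (intro has_integral_trans fin) measurable
  qed
  then show "has_bochner_integral M (\<lambda>x. trans f x * g x) (\<integral>x. f x * g (T x) \<partial>M)"
    if "g \<in> L_infty M" for g using that .
  have 1: "integrable M (trans f)"
    using *[of "\<lambda>_. 1"] by (auto simp: L_infty_def has_bochner_integral_iff)
  then show "trans f \<in> L1 M" by (simp add: L1_def)
  \<comment> \<open>The sign of \<open>trans f\<close> is the bounded test function that turns the
    pairing into the L1 norm.\<close>
  have s: "(\<lambda>x. sgn (trans f x)) \<in> L_infty M"
    by (auto simp: L_infty_def sgn_if intro!: exI[of _ 1])
  have "(\<integral>x. \<bar>trans f x\<bar> \<partial>M) = (\<integral>x. trans f x * sgn (trans f x) \<partial>M)"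
    by (simp add: abs_sgn)
  also have "\<dots> = (\<integral>x. f x * sgn (trans f (T x)) \<partial>M)"
    using *[OF s] by (simp add: has_bochner_integral_iff)
  also have "\<dots> \<le> (\<integral>x. \<bar>f x\<bar> \<partial>M)"
    by (intro integral_mono_AE' integrable_abs f AE_I2) (auto simp: sgn_if)
  finally show "(\<integral>x. \<bar>trans f x\<bar> \<partial>M) \<le> (\<integral>x. \<bar>f x\<bar> \<partial>M)" .
qed

end

section \<open>Square integrable functions and the L2 contraction\<close>

lemma L2_mult_integrable:
  assumes "f \<in> L2 M" "g \<in> L2 M"
  shows "integrable M (\<lambda>x. f x * g x)"
proof (rule Bochner_Integration.integrable_bound)
  show "integrable M (\<lambda>x. (f x)\<^sup>2 + (g x)\<^sup>2)" using assms by (auto simp: L2_def)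
  have [measurable]: "f \<in> borel_measurable M" "g \<in> borel_measurable M"
    using assms by (auto simp: L2_def)
  show "(\<lambda>x. f x * g x) \<in> borel_measurable M" by measurable
  have "norm (f x * g x) \<le> norm ((f x)\<^sup>2 + (g x)\<^sup>2)" for x
  proof -
    have "2 * (\<bar>f x\<bar> * \<bar>g x\<bar>) \<le> (f x)\<^sup>2 + (g x)\<^sup>2"
      using sum_squares_bound[of "\<bar>f x\<bar>" "\<bar>g x\<bar>"] by (simp add: mult.assoc)
    moreover have "0 \<le> \<bar>f x\<bar> * \<bar>g x\<bar>" by simp
    ultimately have "\<bar>f x * g x\<bar> \<le> (f x)\<^sup>2 + (g x)\<^sup>2" unfolding abs_mult by linarith
    then show ?thesis by simp
  qed
  then show "AE x in M. norm (f x * g x) \<le> norm ((f x)\<^sup>2 + (g x)\<^sup>2)" by simp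
qed

lemma L2_diff: "f \<in> L2 M \<Longrightarrow> g \<in> L2 M \<Longrightarrow> (\<lambda>x. f x - g x) \<in> L2 M"
  using L2_mult_integrable[of f M g] by (auto simp: L2_def power2_diff mult.assoc)

context measure_preserving
begin

lemma L2_T: "g \<in> L2 M \<Longrightarrow> (\<lambda>x. g (T x)) \<in> L2 M"
  using integrable_T[of "\<lambda>x. (g x)\<^sup>2"] by (auto simp: L2_def)

lemma enn2real_push_L2:
  assumes [measurable]: "a \<in> borel_measurable M" and "integrable M (\<lambda>x. (a x)\<^sup>2)"
  shows "(\<lambda>x. enn2real (push (\<lambda>x. ennreal (a x)) x)) \<in> L2 M"
    and "AE x in M. push (\<lambda>x. ennreal (a x)) x < \<infinity>"
proof -
  let ?p = "push (\<lambda>x. ennreal (a x))"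
  have "(\<integral>\<^sup>+ x. (?p x)\<^sup>2 \<partial>M) \<le> (\<integral>\<^sup>+ x. (ennreal (a x))\<^sup>2 \<partial>M)"
    by (rule push_square) measurable
  also have "\<dots> \<le> (\<integral>\<^sup>+ x. ennreal ((a x)\<^sup>2) \<partial>M)"
  proof (rule nn_integral_mono)
    show "(ennreal (a x))\<^sup>2 \<le> ennreal ((a x)\<^sup>2)" for x
      by (cases "0 \<le> a x") (auto simp: ennreal_power ennreal_neg)
  qed
  also have "\<dots> < \<infinity>" using assms(2) by (simp add: integrable_iff_bounded)
  finally have fin: "(\<integral>\<^sup>+ x. (?p x)\<^sup>2 \<partial>M) < \<infinity>" .
  then have "AE x in M. (?p x)\<^sup>2 \<noteq> \<infinity>"
    by (intro nn_integral_PInf_AE) auto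
  then show f: "AE x in M. ?p x < \<infinity>"
    by eventually_elim (auto simp: power2_eq_square less_top ennreal_mult_less_top)
  have "(\<integral>\<^sup>+ x. ennreal ((enn2real (?p x))\<^sup>2) \<partial>M) = (\<integral>\<^sup>+ x. (?p x)\<^sup>2 \<partial>M)"
    using f by (intro nn_integral_cong_AE) (auto elim!: eventually_mono simp: ennreal_power[symmetric])
  then show "(\<lambda>x. enn2real (?p x)) \<in> L2 M"
    using fin by (auto simp: L2_def integrable_iff_bounded)
qed

lemma trans_L2:
  assumes f: "f \<in> L2 M"
  shows "trans f \<in> L2 M" "(\<integral>x. (trans f x)\<^sup>2 \<partial>M) \<le> (\<integral>x. (f x)\<^sup>2 \<partial>M)"
    and "\<And>g. g \<in> L2 M \<Longrightarrow> has_bochner_integral M (\<lambda>x. trans f x * g x) (\<integral>x. f x * g (T x) \<partial>M)"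
proof -
  have i: "integrable M (\<lambda>x. (f x)\<^sup>2)" "integrable M (\<lambda>x. (- f x)\<^sup>2)"
    and m [measurable]: "f \<in> borel_measurable M" "(\<lambda>x. - f x) \<in> borel_measurable M"
    using assms by (auto simp: L2_def)
  note p = enn2real_push_L2[OF m(1) i(1)] enn2real_push_L2[OF m(2) i(2)]
  show t: "trans f \<in> L2 M"
    using L2_diff[OF p(1) p(3)] by (simp add: trans_def[abs_def])
  show *: "has_bochner_integral M (\<lambda>x. trans f x * g x) (\<integral>x. f x * g (T x) \<partial>M)"
    if g: "g \<in> L2 M" for g
    using g L2_mult_integrable[OF f L2_T[OF g]]
    by (intro has_integral_trans p) (auto simp: L2_def)
  have [simp]: "integrable M (\<lambda>x. (trans f x)\<^sup>2)" "integrable M (\<lambda>x. (trans f (T x))\<^sup>2)"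
    using t L2_T[OF t] by (auto simp: L2_def)
  \<comment> \<open>Test against \<open>trans f\<close> itself and argue as in
    \<open>push_square\<close>; the cancellation is legitimate at once because
    \<open>trans f\<close> is already known to be square integrable.\<close>
  have "2 * (\<integral>x. (trans f x)\<^sup>2 \<partial>M) = 2 * (\<integral>x. f x * trans f (T x) \<partial>M)"
    using *[OF t] by (simp add: has_bochner_integral_iff power2_eq_square)
  also have "\<dots> = (\<integral>x. 2 * f x * trans f (T x) \<partial>M)" by (simp add: mult.assoc)
  also have "\<dots> \<le> (\<integral>x. (f x)\<^sup>2 + (trans f (T x))\<^sup>2 \<partial>M)"
    using L2_mult_integrable[OF f L2_T[OF t]] i(1)
    by (intro Bochner_Integration.integral_mono sum_squares_bound) (auto simp: mult.assoc)
  also have "\<dots> = (\<integral>x. (f x)\<^sup>2 \<partial>M) + (\<integral>x. (trans f x)\<^sup>2 \<partial>M)"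
    using i(1) integral_T[of "\<lambda>x. (trans f x)\<^sup>2"] by simp
  finally show "(\<integral>x. (trans f x)\<^sup>2 \<partial>M) \<le> (\<integral>x. (f x)\<^sup>2 \<partial>M)" by simp
qed

end

section \<open>The Orlicz space as the sum of L2 and L1\<close>

lemma Phi_nonneg: "0 \<le> x \<Longrightarrow> 0 \<le> Phi x"
  by (simp add: Phi_def)

lemma Phi_measurable [measurable]: "Phi \<in> borel_measurable borel"
  unfolding Phi_def by measurable

lemma L_Phi_iff:
  "f \<in> L_Phi M \<longleftrightarrow> f \<in> borel_measurable M \<and> integrable M (\<lambda>x. Phi \<bar>f x\<bar>)"
  by (auto simp: L_Phi_def integrable_iff_bounded Phi_nonneg)

lemma L_PhiI:
  assumes "integrable M G" "f \<in> borel_measurable M" "\<And>x. x \<in> space M \<Longrightarrow> Phi \<bar>f x\<bar> \<le> G x"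
  shows "f \<in> L_Phi M"
  unfolding L_Phi_iff
proof
  have [measurable]: "f \<in> borel_measurable M" by fact
  show "integrable M (\<lambda>x. Phi \<bar>f x\<bar>)"
    by (rule Bochner_Integration.integrable_bound[OF assms(1)])
      (use assms(3) in \<open>auto intro!: AE_I2 simp: Phi_nonneg intro: order_trans[OF _ abs_ge_self]\<close>)
qed fact

text \<open>\<open>x\<close> is at most twice the larger of the two absolute values. If that is |a|,
  the bound \<open>Phi s \<le> s\<^sup>2\<close> gives 4 a^2; otherwise
  \<open>Phi s \<le> 2 * s\<close> gives 4 |b|.\<close>

lemma Phi_le_sum:
  assumes "0 \<le> x" "x \<le> \<bar>a\<bar> + \<bar>b\<bar>" shows "Phi x \<le> 4 * a\<^sup>2 + 8 * \<bar>b\<bar>"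
proof -
  have mono: "Phi s \<le> Phi t" if "0 \<le> s" "s \<le> t" for s t
  proof (cases "t \<le> 1")
    case True
    then show ?thesis using that by (auto simp: Phi_def intro: power_mono)
  next
    case False
    have "s\<^sup>2 \<le> 1" if "s \<le> 1" using that \<open>0 \<le> s\<close> by (simp add: power_le_one)
    then show ?thesis using that False by (auto simp: Phi_def)
  qed
  have sq: "Phi s \<le> s\<^sup>2" for s
    using zero_le_power2[of "s - 1"] by (auto simp: Phi_def power2_diff)
  have lin: "Phi s \<le> 2 * s" if "0 \<le> s" for s
    using that by (auto simp: Phi_def power2_eq_square intro: order_trans[OF mult_left_le])
  show ?thesis
  proof (cases "\<bar>b\<bar> \<le> \<bar>a\<bar>")
    case True
    then have "Phi x \<le> Phi (2 * \<bar>a\<bar>)" using assms by (intro mono) auto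
    also have "\<dots> \<le> (2 * \<bar>a\<bar>)\<^sup>2" by (rule sq)
    finally show ?thesis by (simp add: power_mult_distrib)
  next
    case False
    then have "Phi x \<le> Phi (2 * \<bar>b\<bar>)" using assms by (intro mono) auto
    also have "\<dots> \<le> 4 * \<bar>b\<bar>" using lin[of "2 * \<bar>b\<bar>"] by simp
    finally show ?thesis using zero_le_power2[of a] by linarith
  qed
qed

lemma L2_plus_L1_L_Phi:
  assumes "a \<in> L2 M" "b \<in> L1 M"
  shows "(\<lambda>x. a x + b x) \<in> L_Phi M"
proof (rule L_PhiI)
  show "integrable M (\<lambda>x. 4 * (a x)\<^sup>2 + 8 * \<bar>b x\<bar>)"
    using assms by (auto simp: L2_def L1_def)
  show "(\<lambda>x. a x + b x) \<in> borel_measurable M"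
    using assms by (auto simp: L2_def L1_def)
  show "Phi \<bar>a x + b x\<bar> \<le> 4 * (a x)\<^sup>2 + 8 * \<bar>b x\<bar>" for x
    by (rule Phi_le_sum) auto
qed

lemma zero_L2: "(\<lambda>_. 0) \<in> L2 M" by (simp add: L2_def)

lemma L1_L_Phi: "f \<in> L1 M \<Longrightarrow> f \<in> L_Phi M"
  using L2_plus_L1_L_Phi[OF zero_L2, of f] by simp

text \<open>Where |f| \<le> 1 the constant 1 dominates it, elsewhere \<open>Phi\<close> does. Thus
  indicators of sets of finite measure can be paired with every element of
  \<open>L_Phi M\<close>.\<close>

lemma L_Phi_integrable_on_finite:
  assumes "f \<in> L_Phi M" and [measurable]: "S \<in> sets M" and "emeasure M S < \<infinity>"
  shows "integrable M (\<lambda>x. f x * indicator S x)"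
proof (rule Bochner_Integration.integrable_bound)
  have [measurable]: "f \<in> borel_measurable M" using assms by (simp add: L_Phi_iff)
  show "integrable M (\<lambda>x. indicator S x + Phi \<bar>f x\<bar>)"
    using assms by (intro Bochner_Integration.integrable_add) (auto simp: L_Phi_iff)
  have "\<bar>f x\<bar> \<le> 1 + Phi \<bar>f x\<bar>" for x
  proof (cases "\<bar>f x\<bar> \<le> 1")
    case True
    then show ?thesis using zero_le_power2[of "f x"] by (simp only: Phi_def if_True power2_abs)
  qed (simp add: Phi_def)
  then show "AE x in M. norm (f x * indicator S x) \<le> norm (indicator S x + Phi \<bar>f x\<bar>)"
    using Phi_nonneg[of "\<bar>f _\<bar>"] by (intro AE_I2) (auto simp: indicator_def)
  show "(\<lambda>x. f x * indicator S x) \<in> borel_measurable M" by measurable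
qed

text \<open>The complement of \<open>large_part\<close> at the same level. Cut at any positive
  level, an \<open>L_Phi\<close> function splits into a square integrable and an integrable piece;
  levels near 0 serve for \<open>I1\<close>, high levels for the decay of the norm.\<close>

definition small_part :: "('a \<Rightarrow> real) \<Rightarrow> real \<Rightarrow> 'a \<Rightarrow> real" where
  "small_part f \<epsilon> x = f x * indicator {x. \<bar>f x\<bar> \<le> \<epsilon>} x"

lemma small_plus_large: "small_part f \<epsilon> x + large_part f \<epsilon> x = f x"
  by (simp add: small_part_def large_part_def indicator_def)

lemma part_measurable [measurable]:
  assumes [measurable]: "f \<in> borel_measurable M"
  shows "small_part f \<epsilon> \<in> borel_measurable M" "large_part f \<epsilon> \<in> borel_measurable M"
proof -
  have "small_part f \<epsilon> = (\<lambda>x. if \<bar>f x\<bar> \<le> \<epsilon> then f x else 0)"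
    "large_part f \<epsilon> = (\<lambda>x. if \<bar>f x\<bar> > \<epsilon> then f x else 0)"
    by (auto simp: small_part_def large_part_def fun_eq_iff)
  then show "small_part f \<epsilon> \<in> borel_measurable M" "large_part f \<epsilon> \<in> borel_measurable M"
    by simp_all
qed

lemma small_part_L2:
  assumes "f \<in> L_Phi M" shows "small_part f K \<in> L2 M"
proof -
  have [measurable]: "f \<in> borel_measurable M" using assms by (simp add: L_Phi_iff)
  have "integrable M (\<lambda>x. (small_part f K x)\<^sup>2)"
  proof (rule Bochner_Integration.integrable_bound)
    \<comment> \<open>Where |f| \<le> 1 the square equals \<open>Phi\<close>; where 1 < |f| \<le> K
      it is at most K^2 while \<open>Phi\<close> is at least 1.\<close>
    show "integrable M (\<lambda>x. (1 + K\<^sup>2) * Phi \<bar>f x\<bar>)" using assms by (auto simp: L_Phi_iff)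
    have "(small_part f K x)\<^sup>2 \<le> (1 + K\<^sup>2) * Phi \<bar>f x\<bar>" for x
    proof (cases "\<bar>f x\<bar> \<le> K")
      case True
      have "(f x)\<^sup>2 \<le> (1 + K\<^sup>2) * Phi \<bar>f x\<bar>"
      proof (cases "\<bar>f x\<bar> \<le> 1")
        case True
        then show ?thesis by (simp add: Phi_def algebra_simps)
      next
        case False
        then have "1 \<le> Phi \<bar>f x\<bar>" by (simp add: Phi_def)
        moreover have "(f x)\<^sup>2 \<le> 1 + K\<^sup>2"
          using power_mono[OF True, of 2] by simp
        ultimately show ?thesis
          using mult_mono[of "(f x)\<^sup>2" "1 + K\<^sup>2" 1 "Phi \<bar>f x\<bar>"] by simp
      qed
      then show ?thesis using True by (simp add: small_part_def)
    qed (simp add: small_part_def Phi_nonneg)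
    then show "AE x in M. norm ((small_part f K x)\<^sup>2) \<le> norm ((1 + K\<^sup>2) * Phi \<bar>f x\<bar>)"
      by (intro AE_I2) (simp add: Phi_nonneg)
  qed measurable
  then show ?thesis by (simp add: L2_def)
qed

lemma large_part_L1:
  assumes "f \<in> L_Phi M" "0 < K" shows "large_part f K \<in> L1 M"
proof -
  have [measurable]: "f \<in> borel_measurable M" using assms by (simp add: L_Phi_iff)
  have "integrable M (large_part f K)"
  proof (rule Bochner_Integration.integrable_bound)
    \<comment> \<open>Where K < |f| \<le> 1 the bound |f| \<le> f^2 / K applies, and above 1
      \<open>Phi\<close> itself dominates |f|; the sum of the two constants covers both
      cases.\<close>
    show "integrable M (\<lambda>x. (1 + 1 / K) * Phi \<bar>f x\<bar>)" using assms by (auto simp: L_Phi_iff)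
    have "\<bar>large_part f K x\<bar> \<le> (1 + 1 / K) * Phi \<bar>f x\<bar>" for x
    proof (cases "K < \<bar>f x\<bar>")
      case True
      have "\<bar>f x\<bar> \<le> (1 + 1 / K) * Phi \<bar>f x\<bar>"
      proof (cases "\<bar>f x\<bar> \<le> 1")
        case 1: True
        have "K * \<bar>f x\<bar> \<le> \<bar>f x\<bar> * \<bar>f x\<bar>" using True by (intro mult_right_mono) auto
        then have "\<bar>f x\<bar> \<le> 1 / K * (f x)\<^sup>2"
          using assms(2) by (simp add: field_simps power2_eq_square)
        also have "\<dots> \<le> (1 + 1 / K) * (f x)\<^sup>2" using assms(2) by (intro mult_right_mono) auto
        finally show ?thesis using 1 by (simp add: Phi_def)
      next
        case False
        then have "\<bar>f x\<bar> \<le> Phi \<bar>f x\<bar>" by (simp add: Phi_def)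
        also have "\<dots> \<le> (1 + 1 / K) * Phi \<bar>f x\<bar>" using assms(2) by (simp add: algebra_simps Phi_nonneg)
        finally show ?thesis .
      qed
      then show ?thesis using True by (simp add: large_part_def)
    qed (use assms(2) in \<open>simp add: large_part_def Phi_nonneg\<close>)
    then show "AE x in M. norm (large_part f K x) \<le> norm ((1 + 1 / K) * Phi \<bar>f x\<bar>)"
      using assms(2) by (intro AE_I2) (simp add: Phi_nonneg)
  qed measurable
  then show ?thesis by (simp add: L1_def)
qed

lemma L_Phi_mult_integrable:
  assumes f: "f \<in> L_Phi M" and g: "g \<in> L2 M" "g \<in> L_infty M"
  shows "integrable M (\<lambda>x. f x * g x)"
proof -
  obtain C where C: "AE x in M. \<bar>g x\<bar> \<le> C" and [measurable]: "g \<in> borel_measurable M"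
    using g by (auto simp: L_infty_def)
  have [measurable]: "f \<in> borel_measurable M" using f by (simp add: L_Phi_iff)
  have i: "integrable M (\<lambda>x. small_part f 1 x * g x)"
    by (intro L2_mult_integrable small_part_L2 f g)
  have l: "integrable M (large_part f 1)" using large_part_L1[OF f, of 1] by (simp add: L1_def)
  have "integrable M (\<lambda>x. large_part f 1 x * g x)"
  proof (rule Bochner_Integration.integrable_bound[OF integrable_mult_right[OF l, of C]])
    show "AE x in M. norm (large_part f 1 x * g x) \<le> norm (C * large_part f 1 x)"
      using C
    proof eventually_elim
      case (elim x)
      then have "\<bar>large_part f 1 x\<bar> * \<bar>g x\<bar> \<le> \<bar>large_part f 1 x\<bar> * \<bar>C\<bar>"
        by (intro mult_left_mono) auto
      then show ?case by (simp add: abs_mult mult.commute)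
    qed
  qed measurable
  with i have "integrable M (\<lambda>x. small_part f 1 x * g x + large_part f 1 x * g x)"
    by (rule Bochner_Integration.integrable_add)
  then show ?thesis by (simp only: distrib_right[symmetric] small_plus_large)
qed

text \<open>The indicator of the part of {v < u} inside a set of finite measure is an admissible
  test function, and equal pairings with it force that part to be null; exchanging the roles gives
  equality. This makes the choices by \<open>SOME\<close> in the transfer operators
  harmless.\<close>

lemma (in sigma_finite_measure) L_Phi_unique:
  assumes h: "h \<in> L_Phi M" "k \<in> L_Phi M"
    and eq: "\<And>g. g \<in> L2 M \<inter> L_infty M \<Longrightarrow> (\<integral>x. h x * g x \<partial>M) = (\<integral>x. k x * g x \<partial>M)"
  shows "AE x in M. h x = k x"
proof -
  have le: "AE x in M. u x \<le> v x"
    if u: "u \<in> L_Phi M" "v \<in> L_Phi M"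
      and uv: "\<And>g. g \<in> L2 M \<inter> L_infty M \<Longrightarrow> (\<integral>x. u x * g x \<partial>M) = (\<integral>x. v x * g x \<partial>M)" for u v
  proof -
    have [measurable]: "u \<in> borel_measurable M" "v \<in> borel_measurable M"
      using u by (auto simp: L_Phi_iff)
    obtain S :: "nat \<Rightarrow> 'a set" where S: "range S \<subseteq> sets M" "(\<Union>i. S i) = space M"
      "\<And>i. emeasure M (S i) \<noteq> \<infinity>" using sigma_finite by blast
    have [measurable]: "\<And>i. S i \<in> sets M" using S by auto
    have "AE x in M. x \<in> S i \<longrightarrow> u x \<le> v x" for i
    proof -
      define A where "A = {x \<in> S i. v x < u x}"
      have "A = {x \<in> space M. v x < u x} \<inter> S i"
        using sets.sets_into_space[of "S i" M] S(1) by (auto simp: A_def)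
      then have [measurable]: "A \<in> sets M" by simp
      have fin: "emeasure M A < \<infinity>"
        using emeasure_mono[of A "S i" M] S(3)[of i] by (auto simp: A_def top.not_eq_extremum)
      have g: "indicator A \<in> L2 M \<inter> L_infty M"
        using fin by (auto simp: L2_def L_infty_def power2_eq_square indicator_inter_arith[symmetric] intro!: exI[of _ 1])
      have i: "integrable M (\<lambda>x. u x * indicator A x)" "integrable M (\<lambda>x. v x * indicator A x)"
        using u fin by (auto intro!: L_Phi_integrable_on_finite)
      have "(\<integral>x. u x * indicator A x - v x * indicator A x \<partial>M) = 0"
        using i uv[OF g] by simp
      then have "AE x in M. u x * indicator A x - v x * indicator A x = 0"
        using i by (subst (asm) integral_nonneg_eq_0_iff_AE) (auto simp: A_def indicator_def)
      then show ?thesis by eventually_elim (auto simp: A_def indicator_def split: if_splits)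
    qed
    then have "AE x in M. \<forall>i. x \<in> S i \<longrightarrow> u x \<le> v x" by (subst AE_all_countable) simp
    moreover have "AE x in M. \<exists>i. x \<in> S i" using S(2) by (intro AE_I2) blast
    ultimately show ?thesis by eventually_elim blast
  qed
  have "AE x in M. h x \<le> k x" by (rule le[OF h]) (rule eq)
  moreover have "AE x in M. k x \<le> h x" by (rule le[OF h(2,1)]) (rule eq[symmetric])
  ultimately show ?thesis by eventually_elim auto
qed

context measure_preserving
begin

lemma L_infty_T: "g \<in> L_infty M \<Longrightarrow> (\<lambda>x. g (T x)) \<in> L_infty M"
proof -
  assume "g \<in> L_infty M"
  then obtain C where [measurable]: "g \<in> borel_measurable M" and C: "AE x in M. \<bar>g x\<bar> \<le> C"
    by (auto simp: L_infty_def)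
  have "AE x in M. \<bar>g (T x)\<bar> \<le> C"
    using C by (subst (asm) distr_T[symmetric]) (simp add: AE_distr_iff)
  then show ?thesis by (auto simp: L_infty_def)
qed

text \<open>Existence of the Poisson transfer: the small part is transferred in L2, the large part
  in L1. \<open>K\<close> stays free because the decay argument wants a large part of small L1 norm,
  while the pairings of \<open>h\<close> are the same for every \<open>K\<close>.\<close>

lemma trans_parts:
  assumes f: "f \<in> L_Phi M" and K: "0 < K"
  defines "h \<equiv> \<lambda>x. trans (small_part f K) x + trans (large_part f K) x"
  shows "h \<in> L_Phi M"
    and "\<And>g. g \<in> L2 M \<inter> L_infty M \<Longrightarrow> (\<integral>x. h x * g x \<partial>M) = (\<integral>x. f x * g (T x) \<partial>M)"
proof -
  note s = small_part_L2[OF f, of K] and l = large_part_L1[OF f K]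
  show "h \<in> L_Phi M"
    unfolding h_def by (intro L2_plus_L1_L_Phi trans_L2 trans_L1 s l)
  fix g assume g: "g \<in> L2 M \<inter> L_infty M"
  have gT: "(\<lambda>x. g (T x)) \<in> L2 M" "(\<lambda>x. g (T x)) \<in> L_infty M"
    using g by (auto intro: L2_T L_infty_T)
  have i: "integrable M (\<lambda>x. small_part f K x * g (T x))" "integrable M (\<lambda>x. large_part f K x * g (T x))"
    using L_Phi_mult_integrable[OF L1_L_Phi[OF l] gT] L2_mult_integrable[OF s gT(1)] by auto
  have "has_bochner_integral M (\<lambda>x. trans (small_part f K) x * g x + trans (large_part f K) x * g x)
     ((\<integral>x. small_part f K x * g (T x) \<partial>M) + (\<integral>x. large_part f K x * g (T x) \<partial>M))"
    using g by (intro has_bochner_integral_add trans_L2(3) trans_L1(3) s l) auto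
  then have "(\<integral>x. h x * g x \<partial>M) = (\<integral>x. small_part f K x * g (T x) + large_part f K x * g (T x) \<partial>M)"
    using i by (simp add: has_bochner_integral_iff h_def distrib_right)
  also have "\<dots> = (\<integral>x. f x * g (T x) \<partial>M)"
    by (simp only: distrib_right[symmetric] small_plus_large)
  finally show "(\<integral>x. h x * g x \<partial>M) = (\<integral>x. f x * g (T x) \<partial>M)" .
qed

end

section \<open>Decay in \<open>L\<^sup>2\<close>\<close>

text \<open>Weighting the squared increments by 4^k still leaves a convergent series of integrals,
  so at almost every point the increments are at most C 2^(-k), with C depending on the point.
  Arguing with squares avoids bounding L1 norms by L2 norms, which fails on an infinite measure
  space. The lemma serves both the base space and the Poisson space.\<close>

lemma AE_convergent_L2:
  fixes W :: "nat \<Rightarrow> 'a \<Rightarrow> real"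
  assumes [measurable]: "\<And>k. W k \<in> borel_measurable M"
    and small: "\<And>k. (\<integral>\<^sup>+ x. ennreal ((W (Suc k) x - W k x)\<^sup>2) \<partial>M) \<le> ennreal ((1 / 8) ^ k)"
  shows "AE x in M. convergent (\<lambda>k. W k x)"
proof -
  define \<Delta> where "\<Delta> k x = W (Suc k) x - W k x" for k x
  have [measurable]: "\<Delta> k \<in> borel_measurable M" for k unfolding \<Delta>_def by measurable
  have "(\<integral>\<^sup>+ x. (\<Sum>k. ennreal (4 ^ k * (\<Delta> k x)\<^sup>2)) \<partial>M) = (\<Sum>k. \<integral>\<^sup>+ x. ennreal (4 ^ k * (\<Delta> k x)\<^sup>2) \<partial>M)"
    by (rule nn_integral_suminf) measurable
  also have "\<dots> \<le> (\<Sum>k. ennreal ((1 / 2) ^ k))"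
  proof (rule suminf_le)
    fix k
    have "(\<integral>\<^sup>+ x. ennreal (4 ^ k * (\<Delta> k x)\<^sup>2) \<partial>M) = ennreal (4 ^ k) * (\<integral>\<^sup>+ x. ennreal ((\<Delta> k x)\<^sup>2) \<partial>M)"
      by (subst nn_integral_cmult[symmetric]) (simp_all add: ennreal_mult)
    also have "\<dots> \<le> ennreal (4 ^ k) * ennreal ((1 / 8) ^ k)"
      unfolding \<Delta>_def by (intro mult_left_mono small) simp
    also have "\<dots> = ennreal ((1 / 2) ^ k)"
      by (subst ennreal_mult[symmetric]) (simp_all add: power_mult_distrib[symmetric])
    finally show "(\<integral>\<^sup>+ x. ennreal (4 ^ k * (\<Delta> k x)\<^sup>2) \<partial>M) \<le> ennreal ((1 / 2) ^ k)" .
  qed simp_all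
  also have "\<dots> = ennreal (\<Sum>k. (1 / 2) ^ k)"
    by (intro suminf_ennreal2) (auto intro: summable_geometric)
  finally have "(\<integral>\<^sup>+ x. (\<Sum>k. ennreal (4 ^ k * (\<Delta> k x)\<^sup>2)) \<partial>M) \<noteq> \<infinity>"
    by (auto simp: top_unique)
  then have "AE x in M. (\<Sum>k. ennreal (4 ^ k * (\<Delta> k x)\<^sup>2)) \<noteq> \<infinity>"
    by (intro nn_integral_PInf_AE) measurable
  then show ?thesis
  proof eventually_elim
    case (elim x)
    define c where "c = enn2real (\<Sum>k. ennreal (4 ^ k * (\<Delta> k x)\<^sup>2))"
    have c: "(\<Sum>k. ennreal (4 ^ k * (\<Delta> k x)\<^sup>2)) = ennreal c"
      using elim by (auto simp: c_def less_top)
    have c0: "0 \<le> c" by (simp add: c_def)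
    have bd: "norm (\<Delta> k x) \<le> sqrt c * (1 / 2) ^ k" for k
    proof -
      have "ennreal (4 ^ k * (\<Delta> k x)\<^sup>2) \<le> ennreal c"
        unfolding c[symmetric] by (rule sum_le_suminf[of _ "{k}", simplified]) auto
      then have "4 ^ k * (\<Delta> k x)\<^sup>2 \<le> c" using c0 by simp
      moreover have "((2 :: real) ^ k)\<^sup>2 = 4 ^ k"
        unfolding power2_eq_square power_mult_distrib[symmetric] by simp
      ultimately have "(2 ^ k * \<bar>\<Delta> k x\<bar>)\<^sup>2 \<le> c" by (simp only: power_mult_distrib power2_abs)
      then have "2 ^ k * \<bar>\<Delta> k x\<bar> \<le> sqrt c" by (rule real_le_rsqrt)
      then have "\<bar>\<Delta> k x\<bar> \<le> sqrt c / 2 ^ k" by (simp add: pos_le_divide_eq mult.commute)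
      then show ?thesis
        by (simp only: power_one_over times_divide_eq_right mult_1_right real_norm_def)
    qed
    have "summable (\<lambda>k. sqrt c * (1 / 2) ^ k)" by (intro summable_mult summable_geometric) simp
    then have "summable (\<lambda>k. \<Delta> k x)" by (rule summable_comparison_test'[OF _ bd])
    then have "convergent (\<lambda>n. (\<Sum>k<n. \<Delta> k x) + W 0 x)"
      by (intro convergent_add convergent_const) (simp only: summable_iff_convergent)
    moreover have "(\<Sum>k<n. \<Delta> k x) + W 0 x = W n x" for n
      using sum_lessThan_telescope[of "\<lambda>k. W k x" n] by (simp add: \<Delta>_def)
    ultimately show ?case by simp
  qed
qed

context measure_preserving
begin

lemma measure_preserving_funpow: "measure_preserving M (T ^^ n)"
proof
  show m: "T ^^ n \<in> measurable M M" for n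
    by (induction n) (auto simp: o_def)
  show "distr M M (T ^^ n) = M"
  proof (induction n)
    case (Suc n)
    have "distr M M (T ^^ Suc n) = distr (distr M M (T ^^ n)) M T"
      by (subst distr_distr[OF T_measurable m]) (simp add: o_def)
    also have "\<dots> = M" by (simp only: Suc distr_T)
    finally show ?case .
  qed (simp add: id_def)
qed

end

lemma (in sigma_finite_measure) measure_preservingI:
  assumes "endomorphism M T" shows "measure_preserving M T"
proof
  show T: "T \<in> measurable M M" using assms by (simp add: endomorphism_def)
  show "distr M M T = M"
    using assms T by (intro measure_eqI) (auto simp: endomorphism_def emeasure_distr)
qed

context measure_preserving
begin

definition transn :: "nat \<Rightarrow> ('a \<Rightarrow> real) \<Rightarrow> 'a \<Rightarrow> real" where
  "transn n = measure_preserving.trans M (T ^^ n)"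

text \<open>\<open>transn n f \<circ> T ^^ n\<close> is the conditional expectation of \<open>f\<close> with respect to
  \<open>T\<^sup>-\<^sup>n \<A>\<close>; these orthogonal projections decrease with \<open>n\<close>.\<close>

lemma transn_inner:
  assumes f: "f \<in> L2 M" and "n \<le> m"
  shows "(\<integral>x. transn n f ((T ^^ n) x) * transn m f ((T ^^ m) x) \<partial>M) = (\<integral>x. (transn m f x)\<^sup>2 \<partial>M)"
proof -
  interpret n: measure_preserving M "T ^^ n" by (rule measure_preserving_funpow)
  interpret m: measure_preserving M "T ^^ m" by (rule measure_preserving_funpow)
  interpret d: measure_preserving M "T ^^ (m - n)" by (rule measure_preserving_funpow)
  let ?u = "n.trans f" and ?v = "m.trans f"
  have v: "?v \<in> L2 M" by (rule m.trans_L2[OF f])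
  have split: "(T ^^ m) x = (T ^^ (m - n)) ((T ^^ n) x)" for x
    using \<open>n \<le> m\<close> by (metis comp_apply funpow_add le_add_diff_inverse2)
  have "(\<integral>x. ?u ((T ^^ n) x) * ?v ((T ^^ m) x) \<partial>M)
      = (\<integral>x. (\<lambda>y. ?u y * ?v ((T ^^ (m - n)) y)) ((T ^^ n) x) \<partial>M)"
    by (simp add: split)
  also have "\<dots> = (\<integral>y. ?u y * ?v ((T ^^ (m - n)) y) \<partial>M)"
    by (rule n.integral_T) measurable
  also have "\<dots> = (\<integral>x. f x * ?v ((T ^^ (m - n)) ((T ^^ n) x)) \<partial>M)"
    using n.trans_L2(3)[OF f d.L2_T[OF v]] by (simp add: has_bochner_integral_iff)
  also have "\<dots> = (\<integral>x. f x * ?v ((T ^^ m) x) \<partial>M)" by (simp add: split)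
  also have "\<dots> = (\<integral>x. (?v x)\<^sup>2 \<partial>M)"
    using m.trans_L2(3)[OF f v] by (simp add: has_bochner_integral_iff power2_eq_square)
  finally show ?thesis by (simp add: transn_def)
qed

lemma transn_L2: "f \<in> L2 M \<Longrightarrow> transn n f \<in> L2 M"
  unfolding transn_def by (rule measure_preserving.trans_L2[OF measure_preserving_funpow])

lemma transn_L2_funpow: "f \<in> L2 M \<Longrightarrow> (\<lambda>x. transn n f ((T ^^ n) x)) \<in> L2 M"
  by (rule measure_preserving.L2_T[OF measure_preserving_funpow transn_L2])

text \<open>Pythagoras: by \<open>transn_inner\<close> the mixed term equals the squared norm of the
  later projection.\<close>

lemma transn_diff:
  assumes f: "f \<in> L2 M" and "n \<le> m"
  shows "(\<integral>\<^sup>+ x. ennreal ((transn n f ((T ^^ n) x) - transn m f ((T ^^ m) x))\<^sup>2) \<partial>M)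
       = ennreal ((\<integral>x. (transn n f x)\<^sup>2 \<partial>M) - (\<integral>x. (transn m f x)\<^sup>2 \<partial>M))"
proof -
  let ?f = "\<lambda>n x. transn n f ((T ^^ n) x)"
  have i: "integrable M (\<lambda>x. (?f k x)\<^sup>2)" for k
    using transn_L2_funpow[OF f, of k] by (simp add: L2_def)
  have p: "integrable M (\<lambda>x. ?f n x * ?f m x)"
    by (intro L2_mult_integrable transn_L2_funpow f)
  have d: "integrable M (\<lambda>x. (?f n x - ?f m x)\<^sup>2)"
    using L2_diff[OF transn_L2_funpow[OF f, of n] transn_L2_funpow[OF f, of m]] by (simp add: L2_def)
  have sq: "(\<integral>x. (?f k x)\<^sup>2 \<partial>M) = (\<integral>x. (transn k f x)\<^sup>2 \<partial>M)" for k
    using transn_inner[OF f order_refl, of k] by (simp add: power2_eq_square)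
  have "(\<integral>\<^sup>+ x. ennreal ((?f n x - ?f m x)\<^sup>2) \<partial>M) = ennreal (\<integral>x. (?f n x - ?f m x)\<^sup>2 \<partial>M)"
    using d by (intro nn_integral_eq_integral) auto
  also have "(\<integral>x. (?f n x - ?f m x)\<^sup>2 \<partial>M) = (\<integral>x. (?f n x)\<^sup>2 + (?f m x)\<^sup>2 - 2 * (?f n x * ?f m x) \<partial>M)"
    by (simp add: power2_diff mult.assoc)
  also have "\<dots> = (\<integral>x. (?f n x)\<^sup>2 \<partial>M) + (\<integral>x. (?f m x)\<^sup>2 \<partial>M) - 2 * (\<integral>x. ?f n x * ?f m x \<partial>M)"
    using i p by simp
  also have "\<dots> = (\<integral>x. (transn n f x)\<^sup>2 \<partial>M) - (\<integral>x. (transn m f x)\<^sup>2 \<partial>M)"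
    by (simp only: sq transn_inner[OF assms])
  finally show ?thesis .
qed

text \<open>By Markov's inequality each set where \<open>(g x)\<^sup>2\<close> is at least a given
  positive level has finite measure; it is a tail set, hence null.\<close>

lemma remotely_infinite_AE_zero:
  assumes ri: "remotely_infinite M T"
    and meas: "\<And>n. g \<in> borel_measurable (vimage_algebra (space M) (T ^^ n) M)"
    and fin: "(\<integral>\<^sup>+ x. ennreal ((g x)\<^sup>2) \<partial>M) < \<infinity>"
  shows "AE x in M. g x = (0 :: real)"
proof -
  have [measurable]: "g \<in> borel_measurable M"
  proof -
    have "sets (vimage_algebra (space M) (T ^^ 0) M) = sets M"
      using sets.Int_space_eq2 by (subst sets_vimage_algebra2) (auto simp: sets.Int_space_eq2)
    then show ?thesis using meas[of 0] by (subst measurable_cong_sets[OF _ refl, symmetric])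
  qed
  have "AE x in M. (g x)\<^sup>2 < 1 / Suc k" for k
  proof -
    define A where "A = {x \<in> space M. 1 / Suc k \<le> (g x)\<^sup>2}"
    have "A \<in> sets (vimage_algebra (space M) (T ^^ n) M)" for n
    proof -
      have "(\<lambda>x. (g x)\<^sup>2) \<in> borel_measurable (vimage_algebra (space M) (T ^^ n) M)"
        using meas[of n] by measurable
      then have "{x \<in> space (vimage_algebra (space M) (T ^^ n) M). 1 / Suc k \<le> (g x)\<^sup>2}
          \<in> sets (vimage_algebra (space M) (T ^^ n) M)"
        by (rule borel_measurable_le[OF borel_measurable_const])
      then show ?thesis by (simp add: A_def)
    qed
    then have "emeasure M A = 0 \<or> emeasure M A = \<infinity>"
      using ri by (auto simp: remotely_infinite_def)
    moreover have [measurable]: "A \<in> sets M" unfolding A_def by measurable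
    moreover have "emeasure M A < \<infinity>"
    proof -
      have "ennreal (1 / Suc k) * emeasure M A = (\<integral>\<^sup>+ x. ennreal (1 / Suc k) * indicator A x \<partial>M)"
        by (simp add: nn_integral_cmult_indicator)
      also have "\<dots> \<le> (\<integral>\<^sup>+ x. ennreal ((g x)\<^sup>2) \<partial>M)"
        by (intro nn_integral_mono) (auto simp: A_def indicator_def intro: ennreal_leI)
      finally have "ennreal (1 / Suc k) * emeasure M A < \<infinity>" using fin by (rule le_less_trans)
      then show ?thesis by (auto simp: ennreal_mult_less_top)
    qed
    ultimately have "A \<in> null_sets M" by (auto intro: null_setsI)
    then show ?thesis by (rule AE_I') (auto simp: A_def not_less)
  qed
  then have "AE x in M. \<forall>k. (g x)\<^sup>2 < 1 / Suc k" by (subst AE_all_countable) simp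
  then show ?thesis
  proof eventually_elim
    case (elim x)
    have "(g x)\<^sup>2 \<le> 0"
    proof (rule LIMSEQ_le_const[OF LIMSEQ_inverse_real_of_nat])
      show "\<exists>N. \<forall>n\<ge>N. (g x)\<^sup>2 \<le> inverse (real (Suc n))"
        using elim by (auto simp: inverse_eq_divide intro: less_imp_le)
    qed
    then show ?case by simp
  qed
qed

lemma remotely_infinite_L2_tendsto:
  assumes ri: "remotely_infinite M T" and f: "f \<in> L2 M"
  shows "(\<lambda>n. \<integral>x. (transn n f x)\<^sup>2 \<partial>M) \<longlonglongrightarrow> 0"
proof -
  define F where "F n x = transn n f ((T ^^ n) x)" for n x
  define a where "a n = (\<integral>x. (transn n f x)\<^sup>2 \<partial>M)" for n
  have Tn [measurable]: "T ^^ n \<in> measurable M M" for n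
    using measure_preserving_funpow by (rule measure_preserving.T_measurable)
  have u [measurable]: "transn n f \<in> borel_measurable M" for n
    using transn_L2[OF f] by (simp add: L2_def)
  have [measurable]: "F n \<in> borel_measurable M" for n unfolding F_def by measurable
  have d: "(\<integral>\<^sup>+ x. ennreal ((F n x - F m x)\<^sup>2) \<partial>M) = ennreal (a n - a m)" if "n \<le> m" for n m
    unfolding F_def a_def by (rule transn_diff[OF f that])
  have F2: "(\<integral>\<^sup>+ x. ennreal ((F n x)\<^sup>2) \<partial>M) = ennreal (a n)" for n
  proof -
    have "(\<integral>\<^sup>+ x. ennreal ((F n x)\<^sup>2) \<partial>M) = ennreal (\<integral>x. (F n x)\<^sup>2 \<partial>M)"
      using transn_L2_funpow[OF f, of n] by (intro nn_integral_eq_integral) (auto simp: L2_def F_def)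
    then show ?thesis
      using transn_inner[OF f order_refl, of n] by (simp add: F_def a_def power2_eq_square)
  qed
  have a0: "0 \<le> a n" for n unfolding a_def by (intro Bochner_Integration.integral_nonneg) simp
  have sq: "(\<integral>x. (F k x)\<^sup>2 \<partial>M) = a k" for k
    using transn_inner[OF f order_refl, of k] by (simp add: F_def a_def power2_eq_square)
  have dec: "decseq a"
    unfolding decseq_def
  proof (intro allI impI)
    fix n m :: nat assume "n \<le> m"
    have "0 \<le> (\<integral>x. (F n x - F m x)\<^sup>2 \<partial>M)" by (intro Bochner_Integration.integral_nonneg) simp
    also have "\<dots> = (\<integral>x. (F n x)\<^sup>2 + (F m x)\<^sup>2 - 2 * (F n x * F m x) \<partial>M)"
      by (simp add: power2_diff mult.assoc)
    also have "\<dots> = a n + a m - 2 * a m"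
      using transn_L2_funpow[OF f, of n] transn_L2_funpow[OF f, of m]
        L2_mult_integrable[OF transn_L2_funpow[OF f, of n] transn_L2_funpow[OF f, of m]]
        transn_inner[OF f \<open>n \<le> m\<close>] sq[of n] sq[of m]
      by (simp add: L2_def F_def a_def)
    finally show "a m \<le> a n" by simp
  qed
  obtain L where L: "a \<longlonglongrightarrow> L" "\<And>n. L \<le> a n"
    using decseq_convergent[OF dec, of 0] a0 by auto
  \<comment> \<open>\<open>a n\<close> is the squared norm of the n-th projection. The subsequence
    \<open>r\<close> approaches the limit \<open>L\<close> so fast that its consecutive differences
    satisfy the hypothesis of \<open>AE_convergent_L2\<close>.\<close>
  have "\<exists>n>m. a n \<le> L + (1 / 8) ^ k" for m k :: nat
  proof -
    have "\<forall>\<^sub>F n in sequentially. a n < L + (1 / 8) ^ k"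
      by (intro order_tendstoD[OF L(1)]) simp
    then obtain N where "\<And>n. N \<le> n \<Longrightarrow> a n < L + (1 / 8) ^ k"
      by (auto simp: eventually_sequentially)
    then show ?thesis by (intro exI[of _ "max N (Suc m)"]) (auto intro: less_imp_le)
  qed
  then obtain r where r: "\<And>k. r k < r (Suc k)" "\<And>k. a (r (Suc k)) \<le> L + (1 / 8) ^ Suc k"
    and r0: "a (r 0) \<le> L + (1 / 8) ^ 0"
    using dependent_nat_choice[of "\<lambda>k n. a n \<le> L + (1 / 8) ^ k" "\<lambda>k n m. n < m"] by metis
  have ar: "a (r k) \<le> L + (1 / 8) ^ k" for k using r(2) r0 by (cases k) auto
  have sm: "strict_mono r" using r(1) by (rule strict_mono_Suc_iff[THEN iffD2, rule_format])
  have conv: "AE x in M. convergent (\<lambda>k. F (r k) x)"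
  proof (rule AE_convergent_L2)
    fix k
    have "(\<integral>\<^sup>+ x. ennreal ((F (r (Suc k)) x - F (r k) x)\<^sup>2) \<partial>M) = ennreal (a (r k) - a (r (Suc k)))"
      using d[of "r k" "r (Suc k)"] r(1)[of k] by (simp add: power2_commute)
    also have "\<dots> \<le> ennreal ((1 / 8) ^ k)"
      using ar[of k] L(2)[of "r (Suc k)"] by (intro ennreal_leI) simp
    finally show "(\<integral>\<^sup>+ x. ennreal ((F (r (Suc k)) x - F (r k) x)\<^sup>2) \<partial>M) \<le> ennreal ((1 / 8) ^ k)" .
  qed measurable
  \<comment> \<open>\<open>lim\<close> is taken at every point, not just almost everywhere: the tail
    \<sigma>-algebra is not completed, so \<open>g\<close> must be exactly measurable. Discarding
    the first n terms leaves \<open>lim\<close> unchanged even where the sequence diverges, and the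
    remaining terms factor through \<open>T ^^ n\<close>.\<close>
  define g where "g x = lim (\<lambda>k. F (r k) x)" for x
  have meas: "g \<in> borel_measurable (vimage_algebra (space M) (T ^^ n) M)" for n
  proof -
    have "((\<lambda>k. F (r k) x) \<longlonglongrightarrow> l) = ((\<lambda>k. F (r (k + n)) x) \<longlonglongrightarrow> l)" for x l
      using LIMSEQ_ignore_initial_segment[of "\<lambda>k. F (r k) x" l n]
        LIMSEQ_offset[of "\<lambda>k. F (r k) x" n l] by blast
    then have "g = (\<lambda>x. lim (\<lambda>k. F (r (k + n)) x))"
      unfolding g_def lim_def by presburger
    moreover have "F (r (k + n)) \<in> borel_measurable (vimage_algebra (space M) (T ^^ n) M)" for k
    proof -
      have le: "n \<le> r (k + n)" using seq_suble[OF sm, of "k + n"] by simp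
      have "F (r (k + n)) = (\<lambda>x. transn (r (k + n)) f ((T ^^ (r (k + n) - n)) ((T ^^ n) x)))"
        using le unfolding F_def by (metis comp_apply funpow_add le_add_diff_inverse2)
      moreover have "T ^^ n \<in> measurable (vimage_algebra (space M) (T ^^ n) M) M"
        by (rule measurable_vimage_algebra1) (use measurable_space[OF Tn] in auto)
      ultimately show ?thesis by simp
    qed
    ultimately show ?thesis by (simp add: borel_measurable_lim_metric)
  qed
  have lim: "AE x in M. (\<lambda>k. F (r k) x) \<longlonglongrightarrow> g x"
    using conv by eventually_elim (simp add: g_def convergent_LIMSEQ_iff)
  have "(\<integral>\<^sup>+ x. ennreal ((g x)\<^sup>2) \<partial>M) = (\<integral>\<^sup>+ x. liminf (\<lambda>k. ennreal ((F (r k) x)\<^sup>2)) \<partial>M)"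
    by (intro nn_integral_cong_AE, use lim in eventually_elim)
      (auto intro!: lim_imp_Liminf[symmetric] tendsto_ennrealI tendsto_power)
  also have "\<dots> \<le> liminf (\<lambda>k. \<integral>\<^sup>+ x. ennreal ((F (r k) x)\<^sup>2) \<partial>M)"
    by (intro nn_integral_liminf) measurable
  also have "\<dots> \<le> liminf (\<lambda>k::nat. ennreal (a 0))"
    using decseqD[OF dec, of 0] by (intro Liminf_mono always_eventually allI) (simp add: F2 ennreal_leI)
  also have "\<dots> < \<infinity>" by (simp add: Liminf_const)
  finally have "AE x in M. g x = 0"
    by (intro remotely_infinite_AE_zero ri meas)
  with lim have lim0: "AE x in M. (\<lambda>k. F (r k) x) \<longlonglongrightarrow> 0"
    by eventually_elim simp
  \<comment> \<open>Almost everywhere convergence to 0 does not by itself exclude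
    \<open>L > 0\<close>. Fatou's lemma is therefore applied to the differences from the first term,
    whose squared norms are at most \<open>a (r 0) - L\<close>; this gives
    \<open>a (r 0) \<le> a (r 0) - L\<close>.\<close>
  have "ennreal (a (r 0)) = (\<integral>\<^sup>+ x. liminf (\<lambda>k. ennreal ((F (r 0) x - F (r k) x)\<^sup>2)) \<partial>M)"
    unfolding F2[symmetric]
  proof (intro nn_integral_cong_AE, use lim0 in eventually_elim)
    fix x assume "(\<lambda>k. F (r k) x) \<longlonglongrightarrow> 0"
    then have "(\<lambda>k. ennreal ((F (r 0) x - F (r k) x)\<^sup>2)) \<longlonglongrightarrow> ennreal ((F (r 0) x - 0)\<^sup>2)"
      by (intro tendsto_intros)
    then show "ennreal ((F (r 0) x)\<^sup>2) = liminf (\<lambda>k. ennreal ((F (r 0) x - F (r k) x)\<^sup>2))"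
      by (intro lim_imp_Liminf[symmetric]) simp_all
  qed
  also have "\<dots> \<le> liminf (\<lambda>k. \<integral>\<^sup>+ x. ennreal ((F (r 0) x - F (r k) x)\<^sup>2) \<partial>M)"
    by (intro nn_integral_liminf) measurable
  also have "\<dots> \<le> liminf (\<lambda>k::nat. ennreal (a (r 0) - L))"
    using L(2) strict_mono_leD[OF sm] by (intro Liminf_mono) (auto simp: d intro!: ennreal_leI)
  also have "\<dots> = ennreal (a (r 0) - L)" by (simp add: Liminf_const)
  finally have "a (r 0) \<le> a (r 0) - L" using L(2)[of "r 0"] by simp
  moreover have "0 \<le> L" using L(1) a0 by (intro LIMSEQ_le_const) auto
  ultimately show ?thesis using L(1) by (simp add: a_def[abs_def])
qed

end

section \<open>Moments of Poisson integrals\<close>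

text \<open>The Poisson measure is described through sets of finite measure only, so the usual
  induction over measurable functions is started from their indicators; an exhaustion by such sets
  yields the other indicators as monotone limits.\<close>

lemma (in sigma_finite_measure) borel_measurable_induct_finite
    [consumes 1, case_names cong set mult add seq]:
  fixes u :: "'a \<Rightarrow> ennreal"
  assumes u: "u \<in> borel_measurable M"
    and cong: "\<And>f g. f \<in> borel_measurable M \<Longrightarrow> g \<in> borel_measurable M \<Longrightarrow>
      (\<And>x. x \<in> space M \<Longrightarrow> f x = g x) \<Longrightarrow> Q g \<Longrightarrow> Q f"
    and set: "\<And>A. A \<in> sets M \<Longrightarrow> emeasure M A < \<infinity> \<Longrightarrow> Q (indicator A)"
    and mult: "\<And>u c. c < top \<Longrightarrow> u \<in> borel_measurable M \<Longrightarrow> Q u \<Longrightarrow> Q (\<lambda>x. c * u x)"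
    and add: "\<And>u v. u \<in> borel_measurable M \<Longrightarrow> v \<in> borel_measurable M \<Longrightarrow> Q u \<Longrightarrow> Q v \<Longrightarrow>
      Q (\<lambda>x. v x + u x)"
    and seq: "\<And>U. (\<And>i. U i \<in> borel_measurable M) \<Longrightarrow> (\<And>i. Q (U i)) \<Longrightarrow> incseq U \<Longrightarrow> Q (SUP i. U i)"
  shows "Q u"
  using u
proof (induction rule: borel_measurable_induct)
  case (set A)
  obtain S :: "nat \<Rightarrow> 'a set" where S: "range S \<subseteq> sets M" "(\<Union>i. S i) = space M"
      "\<And>i. emeasure M (S i) \<noteq> \<infinity>" "incseq S"
    using sigma_finite_incseq by blast
  have [measurable]: "\<And>i. S i \<in> sets M" using S by auto
  have "Q (SUP i. indicator (A \<inter> S i))"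
  proof (rule seq)
    fix i
    show "indicator (A \<inter> S i) \<in> borel_measurable M" using set by simp
    have "emeasure M (A \<inter> S i) \<le> emeasure M (S i)" by (intro emeasure_mono) auto
    also have "\<dots> < \<infinity>" using S(3)[of i] by (simp add: top.not_eq_extremum)
    finally show "Q (indicator (A \<inter> S i))" using set by (intro assms(3)) auto
    show "incseq (\<lambda>i. indicator (A \<inter> S i) :: 'a \<Rightarrow> ennreal)"
      using S(4) by (auto simp: incseq_def le_fun_def indicator_def)
  qed
  moreover have "(SUP i. indicator (A \<inter> S i)) = (indicator A :: 'a \<Rightarrow> ennreal)"
  proof
    fix x
    show "(SUP i. indicator (A \<inter> S i)) x = (indicator A x :: ennreal)"
    proof (cases "x \<in> A")
      case True
      then obtain j where "x \<in> S j" using S(2) sets.sets_into_space[OF set] by auto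
      then have "(1 :: ennreal) \<le> (SUP i. indicator (A \<inter> S i) x)"
        using True by (intro SUP_upper2[of j]) auto
      moreover have "(SUP i. indicator (A \<inter> S i) x) \<le> (1 :: ennreal)"
        by (intro SUP_least) (auto simp: indicator_def)
      ultimately show ?thesis using True by (simp add: SUP_apply image_image)
    qed (simp add: SUP_apply image_image)
  qed
  ultimately show ?case by simp
qed (blast intro: cong mult add seq)+

section \<open>Mean and second moment of the Poisson law\<close>

lemma poisson_prob_sums: "(\<lambda>j. a ^ j / fact j * exp (- a)) sums (1 :: real)"
  using sums_mult2[OF exp_converges[of a], of "exp (- a)"]
  by (simp add: scaleR_conv_of_real exp_minus divide_inverse mult.commute)

lemma poisson_moment_sums:
  fixes a :: real
  shows "(\<lambda>j. real j * (a ^ j / fact j * exp (- a))) sums a"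
    and "(\<lambda>j. (real j)\<^sup>2 * (a ^ j / fact j * exp (- a))) sums (a + a\<^sup>2)"
proof -
  note 0 = poisson_prob_sums[of a]
  \<comment> \<open>Index shift: j a^j / j! = a a^(j-1) / (j-1)!, so the mean is \<open>a\<close>
    times the total mass. The same shift turns the second moment into \<open>a\<close> times the sum
    of (j + 1) p_j, with p_j the Poisson probabilities.\<close>
  have "(\<lambda>j. a * (a ^ j / fact j * exp (- a))) sums (a * 1)" by (rule sums_mult[OF 0])
  moreover have "a * (a ^ j / fact j * exp (- a)) = real (Suc j) * (a ^ Suc j / fact (Suc j) * exp (- a))" for j
    by (simp add: divide_simps del: of_nat_Suc)
  ultimately have "(\<lambda>j. real (Suc j) * (a ^ Suc j / fact (Suc j) * exp (- a))) sums a"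
    by (simp only: mult_1_right)
  from sums_Suc[of "\<lambda>j. real j * (a ^ j / fact j * exp (- a))" a, OF this]
  show 1: "(\<lambda>j. real j * (a ^ j / fact j * exp (- a))) sums a" by simp
  have "(\<lambda>j. a * (real j * (a ^ j / fact j * exp (- a)) + a ^ j / fact j * exp (- a))) sums (a * (a + 1))"
    by (rule sums_mult[OF sums_add[OF 1 0]])
  moreover have "a * (real j * (a ^ j / fact j * exp (- a)) + a ^ j / fact j * exp (- a))
    = (real (Suc j))\<^sup>2 * (a ^ Suc j / fact (Suc j) * exp (- a))" for j
  proof -
    have "fact (Suc j) = real (Suc j) * fact j" by simp
    then have "(real (Suc j))\<^sup>2 * (a ^ Suc j / fact (Suc j) * exp (- a)) =
       real (Suc j) * a * (a ^ j / fact j * exp (- a))"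
      by (simp add: power2_eq_square divide_simps del: of_nat_Suc fact_Suc)
    moreover have "real (Suc j) * a * e = a * (real j * e + e)" for e by (simp add: algebra_simps)
    ultimately show ?thesis by (simp only:)
  qed
  ultimately have "(\<lambda>j. (real (Suc j))\<^sup>2 * (a ^ Suc j / fact (Suc j) * exp (- a))) sums (a * (a + 1))"
    by (simp only:)
  from sums_Suc[of "\<lambda>j. (real j)\<^sup>2 * (a ^ j / fact j * exp (- a))" "a * (a + 1)", OF this]
  show "(\<lambda>j. (real j)\<^sup>2 * (a ^ j / fact j * exp (- a))) sums (a + a\<^sup>2)"
    by (simp add: power2_eq_square distrib_left add.commute)
qed

section \<open>Measurability on the Poisson space and moments of counts\<close>

locale poisson_space = sigma_finite_measure M + P: prob_space P
  for M :: "'a measure" and P :: "'a measure measure" +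
  assumes poisson: "poisson_measure M P"
begin

lemma space_P: "space P = point_measures M"
proof -
  have "sets P = sets (point_measure_algebra M)" using poisson by (simp add: poisson_measure_def)
  then have "space P = space (point_measure_algebra M)" by (rule sets_eq_imp_space_eq)
  then show ?thesis unfolding point_measure_algebra_def by (subst (asm) space_measure_of) auto
qed

lemma sets_points: "\<omega> \<in> space P \<Longrightarrow> sets \<omega> = sets M"
  by (simp add: space_P point_measures_def)

lemma space_points: "\<omega> \<in> space P \<Longrightarrow> space \<omega> = space M"
  by (rule sets_eq_imp_space_eq[OF sets_points])

lemma measurable_points: "\<omega> \<in> space P \<Longrightarrow> f \<in> measurable M N \<Longrightarrow> f \<in> measurable \<omega> N"
  using measurable_cong_sets[OF sets_points refl] by blast

lemma emeasure_measurable [measurable]: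
  assumes "A \<in> sets M"
  shows "(\<lambda>\<omega>. emeasure \<omega> A) \<in> borel_measurable P"
proof (rule measurableI)
  fix B :: "ennreal set" assume B: "B \<in> sets borel"
  have "(\<lambda>\<omega>. emeasure \<omega> A) -` B \<inter> point_measures M \<in> sets (point_measure_algebra M)"
    unfolding point_measure_algebra_def using assms B by (subst sets_measure_of) (auto intro!: sigma_sets.Basic)
  then show "(\<lambda>\<omega>. emeasure \<omega> A) -` B \<inter> space P \<in> sets P"
    using poisson by (simp add: poisson_measure_def space_P)
qed simp

lemma nn_integral_measurable:
  assumes "f \<in> borel_measurable M"
  shows "(\<lambda>\<omega>. \<integral>\<^sup>+ x. f x \<partial>\<omega>) \<in> borel_measurable P"
  using assms
proof (induction rule: borel_measurable_induct)
  case (cong f g)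
  then have "(\<integral>\<^sup>+ x. f x \<partial>\<omega>) = (\<integral>\<^sup>+ x. g x \<partial>\<omega>)" if "\<omega> \<in> space P" for \<omega>
    using that by (intro nn_integral_cong) (simp add: space_points)
  then show ?case using cong by (simp cong: measurable_cong)
next
  case (set A)
  then have "(\<integral>\<^sup>+ x. indicator A x \<partial>\<omega>) = emeasure \<omega> A" if "\<omega> \<in> space P" for \<omega>
    using that by (simp add: sets_points)
  then show ?case using set by (simp cong: measurable_cong)
next
  case (mult u c)
  then have "(\<integral>\<^sup>+ x. c * u x \<partial>\<omega>) = c * (\<integral>\<^sup>+ x. u x \<partial>\<omega>)" if "\<omega> \<in> space P" for \<omega>
    using that by (simp add: nn_integral_cmult measurable_points)
  then show ?case using mult by (simp cong: measurable_cong)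
next
  case (add u v)
  then have "(\<integral>\<^sup>+ x. v x + u x \<partial>\<omega>) = (\<integral>\<^sup>+ x. v x \<partial>\<omega>) + (\<integral>\<^sup>+ x. u x \<partial>\<omega>)" if "\<omega> \<in> space P" for \<omega>
    using that by (simp add: nn_integral_add measurable_points)
  then show ?case using add by (simp cong: measurable_cong)
next
  case (seq U)
  then have "(\<integral>\<^sup>+ x. (SUP i. U i) x \<partial>\<omega>) = (SUP i. \<integral>\<^sup>+ x. U i x \<partial>\<omega>)" if "\<omega> \<in> space P" for \<omega>
    using that unfolding SUP_apply
    by (intro nn_integral_monotone_convergence_SUP) (auto simp: measurable_points)
  then show ?case using seq by (simp cong: measurable_cong)
qed

lemma integral_measurable:
  fixes f :: "'a \<Rightarrow> real"
  assumes [measurable]: "f \<in> borel_measurable M"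
  shows "(\<lambda>\<omega>. \<integral>x. f x \<partial>\<omega>) \<in> borel_measurable P"
proof -
  let ?n = "\<lambda>g \<omega>. \<integral>\<^sup>+ x. ennreal (g x) \<partial>\<omega>"
  \<comment> \<open>A Bochner integral that does not exist has the value 0, so the real integral is
    a measurable case distinction between nonnegative integrals.\<close>
  have "(\<integral>x. f x \<partial>\<omega>) = (if ?n (\<lambda>x. \<bar>f x\<bar>) \<omega> < \<infinity> then enn2real (?n f \<omega>) - enn2real (?n (\<lambda>x. - f x) \<omega>) else 0)"
    if "\<omega> \<in> space P" for \<omega>
  proof (cases "integrable \<omega> f")
    case True
    then show ?thesis
      by (subst real_lebesgue_integral_def) (auto simp: integrable_iff_bounded)
  next
    case False
    then show ?thesis using measurable_points[OF that assms]
      by (subst not_integrable_integral_eq) (auto simp: integrable_iff_bounded)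
  qed
  moreover have [measurable]: "?n g \<in> borel_measurable P" if "g \<in> borel_measurable M" for g
    using that by (intro nn_integral_measurable) simp
  have "(\<lambda>\<omega>. if ?n (\<lambda>x. \<bar>f x\<bar>) \<omega> < \<infinity> then enn2real (?n f \<omega>) - enn2real (?n (\<lambda>x. - f x) \<omega>) else 0)
      \<in> borel_measurable P"
    by measurable
  ultimately show ?thesis by (simp cong: measurable_cong)
qed

lemma compensated_N_measurable [measurable]:
  "f \<in> borel_measurable M \<Longrightarrow> compensated_N M f \<in> borel_measurable P"
  unfolding compensated_N_def[abs_def] by (intro borel_measurable_diff integral_measurable) auto

lemma poisson_prob:
  assumes "A \<in> sets M" "emeasure M A < \<infinity>"
  shows "measure P {\<omega> \<in> space P. emeasure \<omega> A = of_nat j} = measure M A ^ j / fact j * exp (- measure M A)"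
proof -
  have *: "\<forall>(k :: nat) A.
        (\<forall>i<k. A i \<in> sets M \<and> emeasure M (A i) < \<infinity>) \<and> disjoint_family_on A {..<k} \<longrightarrow>
        prob_space.indep_vars P (\<lambda>_. borel) (\<lambda>i \<omega>. emeasure \<omega> (A i)) {..<k} \<and>
        (\<forall>i<k. \<forall>j::nat.
           measure P {\<omega> \<in> space P. emeasure \<omega> (A i) = of_nat j} =
             measure M (A i) ^ j / fact j * exp (- measure M (A i)))"
    using poisson by (simp add: poisson_measure_def)
  show ?thesis
    using *[rule_format, of 1 "\<lambda>_. A"] assms by (simp add: disjoint_family_on_def)
qed

lemma poisson_indep:
  fixes A :: "nat \<Rightarrow> 'a set"
  assumes "\<And>i. i < k \<Longrightarrow> A i \<in> sets M" "\<And>i. i < k \<Longrightarrow> emeasure M (A i) < \<infinity>"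
    "disjoint_family_on A {..<k}"
  shows "P.indep_vars (\<lambda>_. borel) (\<lambda>i \<omega>. emeasure \<omega> (A i)) {..<k}"
  using poisson assms unfolding poisson_measure_def by blast

text \<open>The Poisson probabilities sum to 1, so the count is almost surely a natural number, in
  particular finite, and the expectation of a function of it becomes a series.\<close>

lemma nn_integral_poisson:
  fixes F :: "ennreal \<Rightarrow> ennreal"
  assumes A: "A \<in> sets M" "emeasure M A < \<infinity>" and F: "F \<in> borel_measurable borel"
    "\<And>j :: nat. F (of_nat j) = ennreal (\<phi> j)" "\<And>j. 0 \<le> \<phi> j"
    and S: "(\<lambda>j. \<phi> j * (measure M A ^ j / fact j * exp (- measure M A))) sums s"
  shows "(\<integral>\<^sup>+ \<omega>. F (emeasure \<omega> A) \<partial>P) = ennreal s"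
proof -
  note [measurable] = A(1) F(1)
  define E where "E j = {\<omega> \<in> space P. emeasure \<omega> A = of_nat j}" for j :: nat
  define p where "p j = measure M A ^ j / fact j * exp (- measure M A)" for j :: nat
  have [measurable]: "E j \<in> sets P" for j unfolding E_def by measurable
  have pE: "measure P (E j) = p j" for j unfolding E_def p_def by (rule poisson_prob[OF A])
  have p0: "0 \<le> p j" for j unfolding p_def by simp
  have inj: "of_nat i = (of_nat j :: ennreal) \<longleftrightarrow> i = j" for i j :: nat
    by (simp add: ennreal_of_nat_eq_real_of_nat)
  have disj: "disjoint_family E" by (auto simp: disjoint_family_on_def E_def inj)
  have "(\<lambda>j. measure P (E j)) sums measure P (\<Union>j. E j)"
    using disj by (intro P.finite_measure_UNION) auto
  then have "measure P (\<Union>j. E j) = 1"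
    using poisson_prob_sums[of "measure M A"] unfolding pE p_def by (rule sums_unique2)
  then have "AE \<omega> in P. \<omega> \<in> (\<Union>j. E j)" by (subst P.prob_eq_1[symmetric]) auto
  then have "AE \<omega> in P. F (emeasure \<omega> A) = (\<Sum>j. ennreal (\<phi> j) * indicator (E j) \<omega>)"
  proof eventually_elim
    case (elim \<omega>)
    then obtain i where i: "\<omega> \<in> E i" by blast
    then have "indicator (E j) \<omega> = (if j = i then 1 else 0 :: ennreal)" for j
      using disj by (auto simp: disjoint_family_on_def indicator_def)
    then have "(\<lambda>j. ennreal (\<phi> j) * indicator (E j) \<omega>) = (\<lambda>j. if j = i then ennreal (\<phi> j) else 0)"
      by auto
    then have "(\<Sum>j. ennreal (\<phi> j) * indicator (E j) \<omega>) = ennreal (\<phi> i)"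
      using sums_single[of i "\<lambda>j. ennreal (\<phi> j)"] by (simp add: sums_iff)
    then show ?case using i by (simp add: E_def F(2))
  qed
  then have "(\<integral>\<^sup>+ \<omega>. F (emeasure \<omega> A) \<partial>P) = (\<integral>\<^sup>+ \<omega>. (\<Sum>j. ennreal (\<phi> j) * indicator (E j) \<omega>) \<partial>P)"
    by (rule nn_integral_cong_AE)
  also have "\<dots> = (\<Sum>j. \<integral>\<^sup>+ \<omega>. ennreal (\<phi> j) * indicator (E j) \<omega> \<partial>P)"
    by (rule nn_integral_suminf) measurable
  also have "\<dots> = (\<Sum>j. ennreal (\<phi> j * p j))"
    by (simp add: nn_integral_cmult_indicator P.emeasure_eq_measure pE ennreal_mult F(3) p0)
  also have "\<dots> = ennreal (\<Sum>j. \<phi> j * p j)"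
    using S F(3) p0 by (intro suminf_ennreal2) (auto simp: sums_iff p_def)
  also have "(\<Sum>j. \<phi> j * p j) = s" using S by (simp add: sums_iff p_def)
  finally show ?thesis .
qed

lemma nn_integral_N:
  assumes "A \<in> sets M" "emeasure M A < \<infinity>"
  shows "(\<integral>\<^sup>+ \<omega>. emeasure \<omega> A \<partial>P) = emeasure M A"
    and "(\<integral>\<^sup>+ \<omega>. emeasure \<omega> A * emeasure \<omega> A \<partial>P) = emeasure M A * emeasure M A + emeasure M A"
proof -
  have e: "emeasure M A = ennreal (measure M A)"
    using assms by (intro emeasure_eq_ennreal_measure) auto
  show "(\<integral>\<^sup>+ \<omega>. emeasure \<omega> A \<partial>P) = emeasure M A"
    unfolding e using nn_integral_poisson[OF assms, of "\<lambda>x. x" real] poisson_moment_sums(1)[of "measure M A"]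
    by (simp add: ennreal_of_nat_eq_real_of_nat)
  show "(\<integral>\<^sup>+ \<omega>. emeasure \<omega> A * emeasure \<omega> A \<partial>P) = emeasure M A * emeasure M A + emeasure M A"
    unfolding e using nn_integral_poisson[OF assms, of "\<lambda>x. x * x" "\<lambda>j. (real j)\<^sup>2"]
      poisson_moment_sums(2)[of "measure M A"]
    by (simp add: ennreal_of_nat_eq_real_of_nat ennreal_mult ennreal_plus power2_eq_square add.commute)
qed

lemma nn_integral_N_disjoint:
  assumes A: "A \<in> sets M" "emeasure M A < \<infinity>" and B: "B \<in> sets M" "emeasure M B < \<infinity>"
    and "A \<inter> B = {}"
  shows "(\<integral>\<^sup>+ \<omega>. emeasure \<omega> A * emeasure \<omega> B \<partial>P) = emeasure M A * emeasure M B"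
proof -
  \<comment> \<open>Independence is given for families indexed by initial segments of the naturals,
    so the pair is encoded as a family over {0, 1}.\<close>
  let ?A = "\<lambda>i :: nat. if i = 0 then A else B"
  have ind: "P.indep_vars (\<lambda>_. borel) (\<lambda>i \<omega>. emeasure \<omega> (?A i)) {..<2}"
    using assms by (intro poisson_indep) (auto simp: disjoint_family_on_def)
  have "(\<integral>\<^sup>+ \<omega>. (\<Prod>i\<in>{..<2}. emeasure \<omega> (?A i)) \<partial>P) = (\<Prod>i\<in>{..<2}. \<integral>\<^sup>+ \<omega>. emeasure \<omega> (?A i) \<partial>P)"
    by (rule P.indep_vars_nn_integral[OF _ ind]) auto
  then show ?thesis by (simp add: numeral_2_eq_2 nn_integral_N(1)[OF A] nn_integral_N(1)[OF B])
qed

text \<open>Both sets are split along their intersection. Counts of disjoint pieces are independent,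
  so the only term beyond the product of the means comes from the squared count of
  \<open>A \<inter> B\<close>: its variance.\<close>

lemma nn_integral_N_mult:
  assumes A: "A \<in> sets M" "emeasure M A < \<infinity>" and B: "B \<in> sets M" "emeasure M B < \<infinity>"
  shows "(\<integral>\<^sup>+ \<omega>. emeasure \<omega> A * emeasure \<omega> B \<partial>P) = emeasure M A * emeasure M B + emeasure M (A \<inter> B)"
proof -
  note [measurable] = A(1) B(1)
  have sub: "X \<in> sets M" "emeasure M X < \<infinity>" if "X = A - B \<or> X = B - A \<or> X = A \<inter> B" for X
  proof -
    show X: "X \<in> sets M" using that by auto
    have "emeasure M X \<le> emeasure M A \<or> emeasure M X \<le> emeasure M B"
      using that emeasure_mono[of X A M] emeasure_mono[of X B M] A(1) B(1) by auto
    then show "emeasure M X < \<infinity>" using A(2) B(2) by (auto intro: le_less_trans)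
  qed
  note D = sub[of "A - B", simplified] and G = sub[of "B - A", simplified] and I = sub[of "A \<inter> B", simplified]
  have split: "emeasure N A = emeasure N (A - B) + emeasure N (A \<inter> B)"
    "emeasure N B = emeasure N (B - A) + emeasure N (A \<inter> B)" if "sets N = sets M" for N
  proof -
    have [measurable]: "A \<in> sets N" "B \<in> sets N" using that A(1) B(1) by auto
    have u: "(A - B) \<union> (A \<inter> B) = A" "(B - A) \<union> (A \<inter> B) = B" by auto
    show "emeasure N A = emeasure N (A - B) + emeasure N (A \<inter> B)"
      by (subst plus_emeasure) (auto simp: u)
    show "emeasure N B = emeasure N (B - A) + emeasure N (A \<inter> B)"
      by (subst plus_emeasure) (auto simp: u)
  qed
  have "(\<integral>\<^sup>+ \<omega>. emeasure \<omega> A * emeasure \<omega> B \<partial>P) =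
    (\<integral>\<^sup>+ \<omega>. (emeasure \<omega> (A - B) * emeasure \<omega> (B - A) + emeasure \<omega> (A - B) * emeasure \<omega> (A \<inter> B))
       + (emeasure \<omega> (A \<inter> B) * emeasure \<omega> (B - A) + emeasure \<omega> (A \<inter> B) * emeasure \<omega> (A \<inter> B)) \<partial>P)"
    by (intro nn_integral_cong) (simp add: split sets_points distrib_left distrib_right ac_simps)
  also have "\<dots> = (emeasure M (A - B) * emeasure M (B - A) + emeasure M (A - B) * emeasure M (A \<inter> B))
       + (emeasure M (A \<inter> B) * emeasure M (B - A)
       + (emeasure M (A \<inter> B) * emeasure M (A \<inter> B) + emeasure M (A \<inter> B)))"
  proof -
    have [measurable]: "A - B \<in> sets M" "B - A \<in> sets M" "A \<inter> B \<in> sets M" by auto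
    have "(A - B) \<inter> (B - A) = {}" "(A - B) \<inter> (A \<inter> B) = {}" "(A \<inter> B) \<inter> (B - A) = {}" by auto
    then show ?thesis
      by (simp add: nn_integral_add nn_integral_N_disjoint D G I nn_integral_N(2))
  qed
  also have "\<dots> = emeasure M A * emeasure M B + emeasure M (A \<inter> B)"
    by (simp add: split distrib_left distrib_right ac_simps)
  finally show ?thesis .
qed

end

section \<open>Campbell formulas and the L2 isometry\<close>

context poisson_space
begin

lemma nn_integral_points_SUP:
  fixes U :: "nat \<Rightarrow> 'a \<Rightarrow> ennreal"
  assumes "\<And>i. U i \<in> borel_measurable M" "incseq U" "\<omega> \<in> space P"
  shows "(\<integral>\<^sup>+ x. (SUP i. U i) x \<partial>\<omega>) = (SUP i. \<integral>\<^sup>+ x. U i x \<partial>\<omega>)"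
  using assms unfolding SUP_apply
  by (intro nn_integral_monotone_convergence_SUP) (auto simp: measurable_points)

lemma incseq_nn_integral: "incseq U \<Longrightarrow> incseq (\<lambda>i. \<integral>\<^sup>+ x. U i x \<partial>N)"
  by (auto simp: incseq_def le_fun_def intro!: nn_integral_mono)

text \<open>Campbell's formula: both sides are additive, homogeneous and stable under monotone
  limits, and for a set of finite measure the mean of its Poisson count is its measure.\<close>

lemma campbell:
  assumes "f \<in> borel_measurable M"
  shows "(\<integral>\<^sup>+ \<omega>. (\<integral>\<^sup>+ x. f x \<partial>\<omega>) \<partial>P) = (\<integral>\<^sup>+ x. f x \<partial>M)"
  using assms
proof (induction rule: borel_measurable_induct_finite)
  case (cong f g)
  have "(\<integral>\<^sup>+ \<omega>. (\<integral>\<^sup>+ x. f x \<partial>\<omega>) \<partial>P) = (\<integral>\<^sup>+ \<omega>. (\<integral>\<^sup>+ x. g x \<partial>\<omega>) \<partial>P)"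
    using cong by (intro nn_integral_cong) (simp add: space_points)
  moreover have "(\<integral>\<^sup>+ x. f x \<partial>M) = (\<integral>\<^sup>+ x. g x \<partial>M)"
    using cong by (intro nn_integral_cong) simp
  ultimately show ?case using cong by simp
next
  case (set A)
  have "(\<integral>\<^sup>+ \<omega>. (\<integral>\<^sup>+ x. indicator A x \<partial>\<omega>) \<partial>P) = (\<integral>\<^sup>+ \<omega>. emeasure \<omega> A \<partial>P)"
    using set by (intro nn_integral_cong) (simp add: sets_points)
  then show ?case using nn_integral_N(1)[OF set] set by simp
next
  case (mult u c)
  have "(\<integral>\<^sup>+ \<omega>. (\<integral>\<^sup>+ x. c * u x \<partial>\<omega>) \<partial>P) = (\<integral>\<^sup>+ \<omega>. c * (\<integral>\<^sup>+ x. u x \<partial>\<omega>) \<partial>P)"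
    using mult by (intro nn_integral_cong) (simp add: nn_integral_cmult measurable_points)
  then show ?case using mult by (simp add: nn_integral_cmult nn_integral_measurable)
next
  case (add u v)
  have "(\<integral>\<^sup>+ \<omega>. (\<integral>\<^sup>+ x. v x + u x \<partial>\<omega>) \<partial>P) = (\<integral>\<^sup>+ \<omega>. (\<integral>\<^sup>+ x. v x \<partial>\<omega>) + (\<integral>\<^sup>+ x. u x \<partial>\<omega>) \<partial>P)"
    using add by (intro nn_integral_cong) (simp add: nn_integral_add measurable_points)
  then show ?case using add by (simp add: nn_integral_add nn_integral_measurable)
next
  case (seq U)
  have "(\<integral>\<^sup>+ \<omega>. (\<integral>\<^sup>+ x. (SUP i. U i) x \<partial>\<omega>) \<partial>P) = (\<integral>\<^sup>+ \<omega>. (SUP i. \<integral>\<^sup>+ x. U i x \<partial>\<omega>) \<partial>P)"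
    using seq by (intro nn_integral_cong nn_integral_points_SUP) auto
  also have "\<dots> = (SUP i. \<integral>\<^sup>+ \<omega>. (\<integral>\<^sup>+ x. U i x \<partial>\<omega>) \<partial>P)"
    using seq(1) incseq_nn_integral[OF seq(2)]
    by (intro nn_integral_monotone_convergence_SUP)
      (auto simp: nn_integral_measurable incseq_def le_fun_def)
  also have "\<dots> = (SUP i. \<integral>\<^sup>+ x. U i x \<partial>M)" using seq by simp
  also have "\<dots> = (\<integral>\<^sup>+ x. (SUP i. U i) x \<partial>M)"
    unfolding SUP_apply using seq by (intro nn_integral_monotone_convergence_SUP[symmetric])
  finally show ?case .
qed

text \<open>The second moment formula is bilinear in the two functions and stable under monotone
  limits, so it suffices to know it for sets of finite measure.\<close>

lemma campbell_mult_step: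
  assumes G: "G \<in> borel_measurable P" and h: "h \<in> borel_measurable M"
    and fin: "\<And>A. A \<in> sets M \<Longrightarrow> emeasure M A < \<infinity> \<Longrightarrow>
      (\<integral>\<^sup>+ \<omega>. emeasure \<omega> A * G \<omega> \<partial>P) = emeasure M A * c + (\<integral>\<^sup>+ x. indicator A x * h x \<partial>M)"
    and f: "f \<in> borel_measurable M"
  shows "(\<integral>\<^sup>+ \<omega>. (\<integral>\<^sup>+ x. f x \<partial>\<omega>) * G \<omega> \<partial>P) = (\<integral>\<^sup>+ x. f x \<partial>M) * c + (\<integral>\<^sup>+ x. f x * h x \<partial>M)"
  using f
proof (induction rule: borel_measurable_induct_finite)
  case (cong f g)
  have "(\<integral>\<^sup>+ \<omega>. (\<integral>\<^sup>+ x. f x \<partial>\<omega>) * G \<omega> \<partial>P) = (\<integral>\<^sup>+ \<omega>. (\<integral>\<^sup>+ x. g x \<partial>\<omega>) * G \<omega> \<partial>P)"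
    using cong by (intro nn_integral_cong arg_cong2[where f = times] refl) (simp add: space_points)
  moreover have "(\<integral>\<^sup>+ x. f x \<partial>M) = (\<integral>\<^sup>+ x. g x \<partial>M)" "(\<integral>\<^sup>+ x. f x * h x \<partial>M) = (\<integral>\<^sup>+ x. g x * h x \<partial>M)"
    using cong by (auto intro!: nn_integral_cong)
  ultimately show ?case using cong by simp
next
  case (set A)
  have "(\<integral>\<^sup>+ \<omega>. (\<integral>\<^sup>+ x. indicator A x \<partial>\<omega>) * G \<omega> \<partial>P) = (\<integral>\<^sup>+ \<omega>. emeasure \<omega> A * G \<omega> \<partial>P)"
    using set by (intro nn_integral_cong) (simp add: sets_points)
  then show ?case using fin[OF set] set by simp
next
  case (mult u k)
  have "(\<integral>\<^sup>+ \<omega>. (\<integral>\<^sup>+ x. k * u x \<partial>\<omega>) * G \<omega> \<partial>P) = (\<integral>\<^sup>+ \<omega>. k * ((\<integral>\<^sup>+ x. u x \<partial>\<omega>) * G \<omega>) \<partial>P)"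
    using mult by (intro nn_integral_cong) (simp add: nn_integral_cmult measurable_points mult.assoc)
  also have "\<dots> = k * (\<integral>\<^sup>+ \<omega>. (\<integral>\<^sup>+ x. u x \<partial>\<omega>) * G \<omega> \<partial>P)"
    using mult G by (intro nn_integral_cmult borel_measurable_times_ennreal nn_integral_measurable)
  finally show ?case using mult h by (simp add: nn_integral_cmult mult.assoc distrib_left)
next
  case (add u v)
  have "(\<integral>\<^sup>+ \<omega>. (\<integral>\<^sup>+ x. v x + u x \<partial>\<omega>) * G \<omega> \<partial>P)
      = (\<integral>\<^sup>+ \<omega>. (\<integral>\<^sup>+ x. v x \<partial>\<omega>) * G \<omega> + (\<integral>\<^sup>+ x. u x \<partial>\<omega>) * G \<omega> \<partial>P)"
    using add by (intro nn_integral_cong) (simp add: nn_integral_add measurable_points distrib_right)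
  also have "\<dots> = (\<integral>\<^sup>+ \<omega>. (\<integral>\<^sup>+ x. v x \<partial>\<omega>) * G \<omega> \<partial>P) + (\<integral>\<^sup>+ \<omega>. (\<integral>\<^sup>+ x. u x \<partial>\<omega>) * G \<omega> \<partial>P)"
    using add G by (intro nn_integral_add borel_measurable_times_ennreal nn_integral_measurable)
  also have "\<dots> = ((\<integral>\<^sup>+ x. v x \<partial>M) * c + (\<integral>\<^sup>+ x. u x \<partial>M) * c)
      + ((\<integral>\<^sup>+ x. v x * h x \<partial>M) + (\<integral>\<^sup>+ x. u x * h x \<partial>M))"
    using add by (simp only: ac_simps)
  also have "\<dots> = (\<integral>\<^sup>+ x. v x + u x \<partial>M) * c + (\<integral>\<^sup>+ x. (v x + u x) * h x \<partial>M)"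
    using add h by (simp add: nn_integral_add distrib_right)
  finally show ?case .
next
  case (seq U)
  have inc: "incseq (\<lambda>i. U i x * h x)" for x
    using seq(2) by (auto simp: incseq_def le_fun_def intro!: mult_right_mono)
  have "(\<integral>\<^sup>+ \<omega>. (\<integral>\<^sup>+ x. (SUP i. U i) x \<partial>\<omega>) * G \<omega> \<partial>P) = (\<integral>\<^sup>+ \<omega>. (SUP i. (\<integral>\<^sup>+ x. U i x \<partial>\<omega>) * G \<omega>) \<partial>P)"
  proof (rule nn_integral_cong)
    fix \<omega> assume \<omega>: "\<omega> \<in> space P"
    show "(\<integral>\<^sup>+ x. (SUP i. U i) x \<partial>\<omega>) * G \<omega> = (SUP i. (\<integral>\<^sup>+ x. U i x \<partial>\<omega>) * G \<omega>)"
      unfolding nn_integral_points_SUP[OF seq(1,2) \<omega>] by (rule SUP_mult_right_ennreal)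
  qed
  also have "\<dots> = (SUP i. \<integral>\<^sup>+ \<omega>. (\<integral>\<^sup>+ x. U i x \<partial>\<omega>) * G \<omega> \<partial>P)"
    using seq(1) incseq_nn_integral[OF seq(2)] G
    by (intro nn_integral_monotone_convergence_SUP borel_measurable_times_ennreal nn_integral_measurable)
      (auto simp: incseq_def le_fun_def intro!: mult_right_mono)
  also have "\<dots> = (SUP i. (\<integral>\<^sup>+ x. U i x \<partial>M) * c + (\<integral>\<^sup>+ x. U i x * h x \<partial>M))" using seq by simp
  also have "\<dots> = (SUP i. (\<integral>\<^sup>+ x. U i x \<partial>M) * c) + (SUP i. \<integral>\<^sup>+ x. U i x * h x \<partial>M)"
    using incseq_nn_integral[OF seq(2), of M] incseq_nn_integral[of "\<lambda>i x. U i x * h x" M] inc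
    by (intro ennreal_SUP_add) (auto simp: incseq_def le_fun_def intro!: mult_right_mono)
  also have "(SUP i. (\<integral>\<^sup>+ x. U i x \<partial>M) * c) = (\<integral>\<^sup>+ x. (SUP i. U i) x \<partial>M) * c"
    unfolding SUP_apply using seq
    by (subst nn_integral_monotone_convergence_SUP) (auto simp: SUP_mult_right_ennreal)
  also have "(SUP i. \<integral>\<^sup>+ x. U i x * h x \<partial>M) = (\<integral>\<^sup>+ x. (SUP i. U i x * h x) \<partial>M)"
    using seq(1) h inc by (intro nn_integral_monotone_convergence_SUP[symmetric]) (auto simp: incseq_def le_fun_def)
  also have "\<dots> = (\<integral>\<^sup>+ x. (SUP i. U i) x * h x \<partial>M)"
    by (simp add: SUP_apply SUP_mult_right_ennreal image_image)
  finally show ?case .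
qed

text \<open>Two uses of \<open>campbell_mult_step\<close>: one extends the formula for two sets to
  \<open>g\<close> against a fixed \<open>A\<close>, the other then replaces \<open>A\<close> by
  \<open>f\<close>.\<close>

lemma campbell_mult:
  assumes f: "f \<in> borel_measurable M" and g: "g \<in> borel_measurable M"
  shows "(\<integral>\<^sup>+ \<omega>. (\<integral>\<^sup>+ x. f x \<partial>\<omega>) * (\<integral>\<^sup>+ x. g x \<partial>\<omega>) \<partial>P)
       = (\<integral>\<^sup>+ x. f x \<partial>M) * (\<integral>\<^sup>+ x. g x \<partial>M) + (\<integral>\<^sup>+ x. f x * g x \<partial>M)"
proof (rule campbell_mult_step[OF nn_integral_measurable[OF g] g _ f])
  fix A assume A: "A \<in> sets M" "emeasure M A < \<infinity>"
  have "(\<integral>\<^sup>+ \<omega>. (\<integral>\<^sup>+ x. g x \<partial>\<omega>) * emeasure \<omega> A \<partial>P)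
      = (\<integral>\<^sup>+ x. g x \<partial>M) * emeasure M A + (\<integral>\<^sup>+ x. g x * indicator A x \<partial>M)"
  proof (rule campbell_mult_step[OF emeasure_measurable[OF A(1)] _ _ g])
    show "indicator A \<in> borel_measurable M" using A by simp
    fix B assume B: "B \<in> sets M" "emeasure M B < \<infinity>"
    have "(\<integral>\<^sup>+ x. indicator B x * indicator A x \<partial>M) = emeasure M (B \<inter> A)"
      using A B by (simp add: indicator_inter_arith[symmetric])
    then show "(\<integral>\<^sup>+ \<omega>. emeasure \<omega> B * emeasure \<omega> A \<partial>P)
        = emeasure M B * emeasure M A + (\<integral>\<^sup>+ x. indicator B x * indicator A x \<partial>M)"
      by (simp add: nn_integral_N_mult[OF B A])
  qed
  then show "(\<integral>\<^sup>+ \<omega>. emeasure \<omega> A * (\<integral>\<^sup>+ x. g x \<partial>\<omega>) \<partial>P)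
      = emeasure M A * (\<integral>\<^sup>+ x. g x \<partial>M) + (\<integral>\<^sup>+ x. indicator A x * g x \<partial>M)"
    by (simp add: mult.commute)
qed

text \<open>Campbell's formula makes the expected integral of |u| finite. The exceptional \<omega>
  are why linearity of \<open>compensated_N\<close> is claimed only almost surely: there the
  integral defaults to 0.\<close>

lemma AE_integrable_points:
  fixes u :: "'a \<Rightarrow> real"
  assumes u: "integrable M u"
  shows "AE \<omega> in P. integrable \<omega> u"
proof -
  have m [measurable]: "u \<in> borel_measurable M" using u by auto
  have "(\<integral>\<^sup>+ \<omega>. (\<integral>\<^sup>+ x. ennreal \<bar>u x\<bar> \<partial>\<omega>) \<partial>P) \<noteq> \<infinity>"
    using u by (subst campbell) (auto simp: integrable_iff_bounded)
  then have "AE \<omega> in P. (\<integral>\<^sup>+ x. ennreal \<bar>u x\<bar> \<partial>\<omega>) \<noteq> \<infinity>"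
    by (intro nn_integral_PInf_AE nn_integral_measurable) measurable
  moreover have "AE \<omega> in P. u \<in> borel_measurable \<omega>" by (intro AE_I2 measurable_points[OF _ m])
  ultimately show ?thesis by eventually_elim (simp add: integrable_iff_bounded less_top)
qed

lemma compensated_N_add:
  assumes "integrable M u" "integrable M v"
  shows "AE \<omega> in P. compensated_N M (\<lambda>x. u x + v x) \<omega> = compensated_N M u \<omega> + compensated_N M v \<omega>"
  using AE_integrable_points[OF assms(1)] AE_integrable_points[OF assms(2)]
  by eventually_elim (simp add: compensated_N_def assms)

lemma compensated_N_diff:
  assumes "integrable M u" "integrable M v"
  shows "AE \<omega> in P. compensated_N M (\<lambda>x. u x - v x) \<omega> = compensated_N M u \<omega> - compensated_N M v \<omega>"
  using AE_integrable_points[OF assms(1)] AE_integrable_points[OF assms(2)]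
  by eventually_elim (simp add: compensated_N_def assms)

text \<open>The random integral of |u| and the constant subtracted in absolute value each contribute
  at most the L1 norm of \<open>u\<close>, whence the factor 2.\<close>

lemma compensated_N_L1:
  assumes u: "integrable M u"
  shows "(\<integral>\<^sup>+ \<omega>. ennreal \<bar>compensated_N M u \<omega>\<bar> \<partial>P) \<le> ennreal (2 * (\<integral>x. \<bar>u x\<bar> \<partial>M))"
proof -
  let ?s = "\<integral>x. \<bar>u x\<bar> \<partial>M"
  have [measurable]: "u \<in> borel_measurable M" using u by auto
  have s: "(\<integral>\<^sup>+ x. ennreal \<bar>u x\<bar> \<partial>M) = ennreal ?s"
    using u by (intro nn_integral_eq_integral) auto
  have "(\<integral>\<^sup>+ \<omega>. ennreal \<bar>compensated_N M u \<omega>\<bar> \<partial>P)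
      \<le> (\<integral>\<^sup>+ \<omega>. (\<integral>\<^sup>+ x. ennreal \<bar>u x\<bar> \<partial>\<omega>) + ennreal ?s \<partial>P)"
  proof (rule nn_integral_mono_AE)
    show "AE \<omega> in P. ennreal \<bar>compensated_N M u \<omega>\<bar> \<le> (\<integral>\<^sup>+ x. ennreal \<bar>u x\<bar> \<partial>\<omega>) + ennreal ?s"
      using AE_integrable_points[OF u]
    proof eventually_elim
      case (elim \<omega>)
      have "\<bar>compensated_N M u \<omega>\<bar> \<le> (\<integral>x. \<bar>u x\<bar> \<partial>\<omega>) + ?s"
        unfolding compensated_N_def
        using integral_abs_bound[of \<omega> u] integral_abs_bound[of M u] by linarith
      then have "ennreal \<bar>compensated_N M u \<omega>\<bar> \<le> ennreal ((\<integral>x. \<bar>u x\<bar> \<partial>\<omega>) + ?s)"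
        by (rule ennreal_leI)
      also have "\<dots> = ennreal (\<integral>x. \<bar>u x\<bar> \<partial>\<omega>) + ennreal ?s"
        by (intro ennreal_plus) auto
      also have "ennreal (\<integral>x. \<bar>u x\<bar> \<partial>\<omega>) = (\<integral>\<^sup>+ x. ennreal \<bar>u x\<bar> \<partial>\<omega>)"
        using elim by (intro nn_integral_eq_integral[symmetric]) auto
      finally show ?case .
    qed
  qed
  also have "\<dots> = ennreal ?s + ennreal ?s"
    by (subst nn_integral_add) (simp_all add: nn_integral_measurable campbell s P.emeasure_space_1)
  also have "\<dots> = ennreal (2 * ?s)" by (subst ennreal_plus[symmetric]) auto
  finally show ?thesis .
qed

lemma has_integral_N_mult:
  fixes p q :: "'a \<Rightarrow> real"
  assumes p: "integrable M p" "\<And>x. 0 \<le> p x" and q: "integrable M q" "\<And>x. 0 \<le> q x"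
    and pq: "integrable M (\<lambda>x. p x * q x)"
  shows "has_bochner_integral P (\<lambda>\<omega>. (\<integral>x. p x \<partial>\<omega>) * (\<integral>x. q x \<partial>\<omega>))
    ((\<integral>x. p x \<partial>M) * (\<integral>x. q x \<partial>M) + (\<integral>x. p x * q x \<partial>M))"
proof (rule has_bochner_integral_nn_integral)
  have [measurable]: "p \<in> borel_measurable M" "q \<in> borel_measurable M" using p q by auto
  show "(\<lambda>\<omega>. (\<integral>x. p x \<partial>\<omega>) * (\<integral>x. q x \<partial>\<omega>)) \<in> borel_measurable P"
    by (intro borel_measurable_times integral_measurable) measurable
  show "AE \<omega> in P. 0 \<le> (\<integral>x. p x \<partial>\<omega>) * (\<integral>x. q x \<partial>\<omega>)"
    using p q by (intro AE_I2 mult_nonneg_nonneg Bochner_Integration.integral_nonneg)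
  show "0 \<le> (\<integral>x. p x \<partial>M) * (\<integral>x. q x \<partial>M) + (\<integral>x. p x * q x \<partial>M)"
    using p q by (intro add_nonneg_nonneg mult_nonneg_nonneg Bochner_Integration.integral_nonneg)
  have "(\<integral>\<^sup>+ \<omega>. ennreal ((\<integral>x. p x \<partial>\<omega>) * (\<integral>x. q x \<partial>\<omega>)) \<partial>P)
      = (\<integral>\<^sup>+ \<omega>. (\<integral>\<^sup>+ x. ennreal (p x) \<partial>\<omega>) * (\<integral>\<^sup>+ x. ennreal (q x) \<partial>\<omega>) \<partial>P)"
  proof (rule nn_integral_cong_AE)
    show "AE \<omega> in P. ennreal ((\<integral>x. p x \<partial>\<omega>) * (\<integral>x. q x \<partial>\<omega>))
        = (\<integral>\<^sup>+ x. ennreal (p x) \<partial>\<omega>) * (\<integral>\<^sup>+ x. ennreal (q x) \<partial>\<omega>)"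
      using AE_integrable_points[OF p(1)] AE_integrable_points[OF q(1)]
      by eventually_elim (simp add: nn_integral_eq_integral p q ennreal_mult)
  qed
  also have "\<dots> = (\<integral>\<^sup>+ x. ennreal (p x) \<partial>M) * (\<integral>\<^sup>+ x. ennreal (q x) \<partial>M) + (\<integral>\<^sup>+ x. ennreal (p x * q x) \<partial>M)"
    by (subst campbell_mult) (simp_all add: ennreal_mult p q)
  also have "\<dots> = ennreal (\<integral>x. p x \<partial>M) * ennreal (\<integral>x. q x \<partial>M) + ennreal (\<integral>x. p x * q x \<partial>M)"
    using p q pq by (simp add: nn_integral_eq_integral)
  also have "\<dots> = ennreal ((\<integral>x. p x \<partial>M) * (\<integral>x. q x \<partial>M) + (\<integral>x. p x * q x \<partial>M))"
    using p q by (simp add: ennreal_mult ennreal_plus Bochner_Integration.integral_nonneg)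
  finally show "(\<integral>\<^sup>+ \<omega>. ennreal ((\<integral>x. p x \<partial>\<omega>) * (\<integral>x. q x \<partial>\<omega>)) \<partial>P)
      = ennreal ((\<integral>x. p x \<partial>M) * (\<integral>x. q x \<partial>M) + (\<integral>x. p x * q x \<partial>M))" .
qed

lemma has_integral_N:
  fixes p :: "'a \<Rightarrow> real"
  assumes p: "integrable M p" "\<And>x. 0 \<le> p x"
  shows "has_bochner_integral P (\<lambda>\<omega>. \<integral>x. p x \<partial>\<omega>) (\<integral>x. p x \<partial>M)"
proof (rule has_bochner_integral_nn_integral)
  have [measurable]: "p \<in> borel_measurable M" using p by auto
  show "(\<lambda>\<omega>. \<integral>x. p x \<partial>\<omega>) \<in> borel_measurable P" by (intro integral_measurable) measurable
  have "(\<integral>\<^sup>+ \<omega>. ennreal (\<integral>x. p x \<partial>\<omega>) \<partial>P) = (\<integral>\<^sup>+ \<omega>. (\<integral>\<^sup>+ x. ennreal (p x) \<partial>\<omega>) \<partial>P)"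
  proof (rule nn_integral_cong_AE)
    show "AE \<omega> in P. ennreal (\<integral>x. p x \<partial>\<omega>) = (\<integral>\<^sup>+ x. ennreal (p x) \<partial>\<omega>)"
      using AE_integrable_points[OF p(1)] by eventually_elim (simp add: nn_integral_eq_integral p)
  qed
  also have "\<dots> = ennreal (\<integral>x. p x \<partial>M)"
    by (subst campbell) (simp_all add: nn_integral_eq_integral p)
  finally show "(\<integral>\<^sup>+ \<omega>. ennreal (\<integral>x. p x \<partial>\<omega>) \<partial>P) = ennreal (\<integral>x. p x \<partial>M)" .
qed (use p in \<open>auto intro!: Bochner_Integration.integral_nonneg\<close>)

text \<open>The mixed moment formula is available for nonnegative functions, so \<open>u\<close> is
  split into positive and negative part. Their product vanishes, hence their integrals are
  uncorrelated; after centring all products of means cancel and the integrals of the two squares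
  remain.\<close>

lemma compensated_N_square:
  assumes u: "integrable M u" and u2: "integrable M (\<lambda>x. (u x)\<^sup>2)"
  shows "has_bochner_integral P (\<lambda>\<omega>. (compensated_N M u \<omega>)\<^sup>2) (\<integral>x. (u x)\<^sup>2 \<partial>M)"
proof -
  define p where "p x = max 0 (u x)" for x
  define q where "q x = max 0 (- u x)" for x
  have [measurable]: "u \<in> borel_measurable M" using u by auto
  have pq: "integrable M p" "integrable M q" "\<And>x. 0 \<le> p x" "\<And>x. 0 \<le> q x"
    using u by (auto simp: p_def[abs_def] q_def[abs_def])
  have sq: "integrable M (\<lambda>x. p x * p x)" "integrable M (\<lambda>x. q x * q x)" and pq0: "p x * q x = 0" for x
    by (auto intro!: Bochner_Integration.integrable_bound[OF u2] simp: p_def q_def max_def power2_eq_square)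
  have eq: "u x = p x - q x" for x by (auto simp: p_def q_def)
  let ?X = "\<lambda>\<omega>. \<integral>x. p x \<partial>\<omega>" and ?Y = "\<lambda>\<omega>. \<integral>x. q x \<partial>\<omega>"
  let ?m = "\<integral>x. p x \<partial>M" and ?n = "\<integral>x. q x \<partial>M"
  note h = has_integral_N_mult[OF pq(1,3) pq(1,3) sq(1)] has_integral_N_mult[OF pq(2,4) pq(2,4) sq(2)]
    has_integral_N_mult[OF pq(1,3) pq(2,4)] has_integral_N[OF pq(1,3)] has_integral_N[OF pq(2,4)]
  have XY: "has_bochner_integral P (\<lambda>\<omega>. ?X \<omega> * ?Y \<omega>) (?m * ?n)" using h(3) by (simp add: pq0)
  have const: "has_bochner_integral P (\<lambda>\<omega>. (?m - ?n)\<^sup>2) ((?m - ?n)\<^sup>2)"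
    using P.prob_space by (simp add: has_bochner_integral_iff)
  have "has_bochner_integral P
     (\<lambda>\<omega>. ((?X \<omega> * ?X \<omega> + ?Y \<omega> * ?Y \<omega>) - 2 * (?X \<omega> * ?Y \<omega>))
        - (2 * (?m - ?n) * ?X \<omega> - 2 * (?m - ?n) * ?Y \<omega>) + (?m - ?n)\<^sup>2)
     ((((?m * ?m + (\<integral>x. p x * p x \<partial>M)) + (?n * ?n + (\<integral>x. q x * q x \<partial>M))) - 2 * (?m * ?n))
        - (2 * (?m - ?n) * ?m - 2 * (?m - ?n) * ?n) + (?m - ?n)\<^sup>2)"
    by (intro has_bochner_integral_add has_bochner_integral_diff has_bochner_integral_mult_right h XY const)
  moreover have "((((?m * ?m + (\<integral>x. p x * p x \<partial>M)) + (?n * ?n + (\<integral>x. q x * q x \<partial>M))) - 2 * (?m * ?n))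
        - (2 * (?m - ?n) * ?m - 2 * (?m - ?n) * ?n) + (?m - ?n)\<^sup>2)
     = (\<integral>x. p x * p x \<partial>M) + (\<integral>x. q x * q x \<partial>M)"
    by (simp add: power2_eq_square algebra_simps)
  moreover have "\<dots> = (\<integral>x. p x * p x + q x * q x \<partial>M)" using sq by simp
  moreover have "\<dots> = (\<integral>x. (u x)\<^sup>2 \<partial>M)"
    by (intro Bochner_Integration.integral_cong) (auto simp: p_def q_def max_def power2_eq_square)
  ultimately have main: "has_bochner_integral P
     (\<lambda>\<omega>. ((?X \<omega> * ?X \<omega> + ?Y \<omega> * ?Y \<omega>) - 2 * (?X \<omega> * ?Y \<omega>))
        - (2 * (?m - ?n) * ?X \<omega> - 2 * (?m - ?n) * ?Y \<omega>) + (?m - ?n)\<^sup>2) (\<integral>x. (u x)\<^sup>2 \<partial>M)"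
    by simp
  have ae: "AE \<omega> in P. ((?X \<omega> * ?X \<omega> + ?Y \<omega> * ?Y \<omega>) - 2 * (?X \<omega> * ?Y \<omega>))
        - (2 * (?m - ?n) * ?X \<omega> - 2 * (?m - ?n) * ?Y \<omega>) + (?m - ?n)\<^sup>2 = (compensated_N M u \<omega>)\<^sup>2"
    using AE_integrable_points[OF pq(1)] AE_integrable_points[OF pq(2)]
  proof eventually_elim
    case (elim \<omega>)
    have "compensated_N M u \<omega> = (?X \<omega> - ?Y \<omega>) - (?m - ?n)"
      using elim pq by (simp add: compensated_N_def eq[abs_def])
    then show ?case by (simp only:) (simp add: power2_eq_square algebra_simps)
  qed
  have m: "compensated_N M u \<in> borel_measurable P" by measurable
  show ?thesis
    using has_bochner_integral_cong_AE[OF _ _ ae, THEN iffD1, OF _ _ main] main m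
    by (auto simp: has_bochner_integral_iff)
qed

end

section \<open>Estimates for the Poisson-Orlicz norm\<close>

lemma small_part_tendsto_0: "(\<lambda>n. small_part f (1 / real (Suc n)) x) \<longlonglongrightarrow> 0"
proof -
  have "\<forall>\<^sub>F n in sequentially. small_part f (1 / real (Suc n)) x = 0"
  proof (cases "f x = 0")
    case False
    then obtain N where N: "inverse (real (Suc N)) < \<bar>f x\<bar>" using reals_Archimedean[of "\<bar>f x\<bar>"] by auto
    show ?thesis
      using eventually_ge_at_top[of N]
    proof eventually_elim
      case (elim n)
      then have "1 / real (Suc n) \<le> inverse (real (Suc N))"
        by (simp add: inverse_eq_divide frac_le)
      then show ?case using N by (simp add: small_part_def)
    qed
  qed (simp add: small_part_def)
  then show ?thesis by (rule tendsto_eventually)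
qed

lemma abs_small_part_mono: "\<epsilon> \<le> \<delta> \<Longrightarrow> \<bar>small_part f \<epsilon> x\<bar> \<le> \<bar>small_part f \<delta> x\<bar>"
  by (auto simp: small_part_def indicator_def)

text \<open>Dominated convergence along the levels 1 / (n + 1), then monotonicity in the level to
  reach all small \<epsilon>. \<open>H\<close> is used as the identity for integrable functions and
  as the square for \<open>L_Phi\<close> functions.\<close>

lemma small_part_integral_small:
  fixes M :: "'a measure" and H :: "real \<Rightarrow> real"
  assumes [measurable]: "f \<in> borel_measurable M" and int: "integrable M (\<lambda>x. H \<bar>small_part f 1 x\<bar>)"
    and H: "\<And>s t. 0 \<le> s \<Longrightarrow> s \<le> t \<Longrightarrow> H s \<le> H t" "H 0 = 0" "isCont H 0" "H \<in> borel_measurable borel"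
    and "0 < e"
  shows "\<exists>\<delta>>0. \<forall>\<epsilon>\<in>{0<..\<delta>}. (\<integral>x. H \<bar>small_part f \<epsilon> x\<bar> \<partial>M) < e"
proof -
  note H(4)[measurable]
  have H0: "0 \<le> H \<bar>t\<bar>" for t using H(1)[of 0 "\<bar>t\<bar>"] H(2) by simp
  have "(\<lambda>n. \<integral>x. H \<bar>small_part f (1 / real (Suc n)) x\<bar> \<partial>M) \<longlonglongrightarrow> (\<integral>x. 0 \<partial>M)"
  proof (rule integral_dominated_convergence[OF _ _ int])
    show "AE x in M. (\<lambda>n. H \<bar>small_part f (1 / real (Suc n)) x\<bar>) \<longlonglongrightarrow> 0"
    proof (rule AE_I2)
      fix x
      have "(\<lambda>n. \<bar>small_part f (1 / real (Suc n)) x\<bar>) \<longlonglongrightarrow> 0"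
        using small_part_tendsto_0[of f x] by (rule tendsto_rabs_zero)
      from isCont_tendsto_compose[OF H(3) this] show "(\<lambda>n. H \<bar>small_part f (1 / real (Suc n)) x\<bar>) \<longlonglongrightarrow> 0"
        by (simp add: H(2))
    qed
    show "AE x in M. norm (H \<bar>small_part f (1 / real (Suc n)) x\<bar>) \<le> H \<bar>small_part f 1 x\<bar>" for n
      by (intro AE_I2) (auto simp: H0 intro!: H(1) abs_small_part_mono)
  qed measurable
  then have "\<forall>\<^sub>F n in sequentially. (\<integral>x. H \<bar>small_part f (1 / real (Suc n)) x\<bar> \<partial>M) < e"
    using \<open>0 < e\<close> by (intro order_tendstoD) auto
  then obtain n where n: "(\<integral>x. H \<bar>small_part f (1 / real (Suc n)) x\<bar> \<partial>M) < e"
    by (auto simp: eventually_sequentially)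
  have intn: "integrable M (\<lambda>x. H \<bar>small_part f \<epsilon> x\<bar>)" if "\<epsilon> \<le> 1" for \<epsilon>
    by (rule Bochner_Integration.integrable_bound[OF int])
      (auto simp: H0 intro!: AE_I2 H(1) abs_small_part_mono that)
  have "(\<integral>x. H \<bar>small_part f \<epsilon> x\<bar> \<partial>M) < e" if "\<epsilon> \<in> {0<..1 / real (Suc n)}" for \<epsilon>
  proof -
    have "1 / real (Suc n) \<le> 1" by simp
    moreover from this have "\<epsilon> \<le> 1" using that by (meson greaterThanAtMost_iff order_trans)
    ultimately have "(\<integral>x. H \<bar>small_part f \<epsilon> x\<bar> \<partial>M) \<le> (\<integral>x. H \<bar>small_part f (1 / real (Suc n)) x\<bar> \<partial>M)"
      using that by (intro Bochner_Integration.integral_mono intn H(1) abs_small_part_mono) auto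
    then show ?thesis using n by simp
  qed
  then show ?thesis by (intro exI[of _ "1 / real (Suc n)"]) auto
qed

text \<open>Cauchy-Schwarz against the constant 1, whose norm is 1 in a probability space.\<close>

lemma (in prob_space) nn_integral_abs_le_sqrt:
  assumes [measurable]: "Z \<in> borel_measurable M" and "(\<integral>\<^sup>+ x. ennreal ((Z x)\<^sup>2) \<partial>M) \<le> ennreal s" "0 \<le> s"
  shows "(\<integral>\<^sup>+ x. ennreal \<bar>Z x\<bar> \<partial>M) \<le> ennreal (sqrt s)"
proof -
  let ?I = "\<integral>\<^sup>+ x. ennreal \<bar>Z x\<bar> \<partial>M"
  have "?I\<^sup>2 = (\<integral>\<^sup>+ x. ennreal \<bar>Z x\<bar> * 1 \<partial>M)\<^sup>2" by simp
  also have "\<dots> \<le> (\<integral>\<^sup>+ x. (ennreal \<bar>Z x\<bar>)\<^sup>2 \<partial>M) * (\<integral>\<^sup>+ x. 1\<^sup>2 \<partial>M)"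
    by (rule Cauchy_Schwarz_nn_integral) measurable
  also have "\<dots> = (\<integral>\<^sup>+ x. ennreal ((Z x)\<^sup>2) \<partial>M)" by (simp add: ennreal_power emeasure_space_1)
  finally have le: "?I\<^sup>2 \<le> ennreal s" using assms(2) by (rule order_trans)
  show ?thesis
  proof (cases ?I)
    case (real r)
    then have "r\<^sup>2 \<le> s" using le assms(3) by (simp add: ennreal_power)
    then have "r \<le> sqrt s" by (rule real_le_rsqrt)
    then show ?thesis unfolding real by (rule ennreal_leI)
  next
    case top
    then show ?thesis using le by (simp add: power2_eq_square top_unique)
  qed
qed

section \<open>The compensated integral as a limit in mean\<close>

context poisson_space
begin

text \<open>Convergence in mean is stronger than the convergence in measure that defines
  \<open>I1\<close>. It still holds on all of \<open>L_Phi M\<close>, and unlike convergence in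
  measure it lets norm bounds pass to the limit directly.\<close>

definition has_I1 :: "('a \<Rightarrow> real) \<Rightarrow> ('a measure \<Rightarrow> real) \<Rightarrow> bool" where
  "has_I1 f Y \<longleftrightarrow> Y \<in> borel_measurable P \<and> (\<forall>e>0. \<forall>\<^sub>F \<epsilon> in at_right 0.
     (\<integral>\<^sup>+ \<omega>. ennreal \<bar>compensated_N M (large_part f \<epsilon>) \<omega> - Y \<omega>\<bar> \<partial>P) \<le> ennreal e)"

text \<open>Markov's inequality turns convergence in mean into convergence in measure, so the choice
  in \<open>I1\<close> has a candidate; limits in measure are almost surely unique, so whatever is
  chosen agrees with \<open>Y\<close>.\<close>

lemma I1_AE:
  assumes f [measurable]: "f \<in> borel_measurable M" and Y: "has_I1 f Y"
  shows "I1 M P f \<in> borel_measurable P" "AE \<omega> in P. I1 M P f \<omega> = Y \<omega>"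
proof -
  define W where "W \<epsilon> = compensated_N M (large_part f \<epsilon>)" for \<epsilon>
  define lim where "lim Y \<longleftrightarrow> Y \<in> borel_measurable P \<and>
     (\<forall>\<delta>>0. ((\<lambda>\<epsilon>. measure P {\<omega> \<in> space P. \<bar>W \<epsilon> \<omega> - Y \<omega>\<bar> > \<delta>}) \<longlongrightarrow> 0) (at_right 0))" for Y
  have [measurable]: "W \<epsilon> \<in> borel_measurable P" for \<epsilon> unfolding W_def by measurable
  have Ym [measurable]: "Y \<in> borel_measurable P" using Y by (simp add: has_I1_def)
  have limY: "lim Y"
    unfolding lim_def
  proof (intro conjI allI impI)
    fix \<delta> :: real assume \<delta>: "0 < \<delta>"
    show "((\<lambda>\<epsilon>. measure P {\<omega> \<in> space P. \<bar>W \<epsilon> \<omega> - Y \<omega>\<bar> > \<delta>}) \<longlongrightarrow> 0) (at_right 0)"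
    proof (rule tendstoI)
      fix e :: real assume e: "0 < e"
      then have "\<forall>\<^sub>F \<epsilon> in at_right 0. (\<integral>\<^sup>+ \<omega>. ennreal \<bar>W \<epsilon> \<omega> - Y \<omega>\<bar> \<partial>P) \<le> ennreal (\<delta> * e / 2)"
        using Y \<delta> by (auto simp: has_I1_def W_def)
      then show "\<forall>\<^sub>F \<epsilon> in at_right 0. dist (measure P {\<omega> \<in> space P. \<bar>W \<epsilon> \<omega> - Y \<omega>\<bar> > \<delta>}) 0 < e"
      proof eventually_elim
        case (elim \<epsilon>)
        let ?A = "{\<omega> \<in> space P. \<bar>W \<epsilon> \<omega> - Y \<omega>\<bar> > \<delta>}"
        have "ennreal (\<delta> * measure P ?A) = (\<integral>\<^sup>+ \<omega>. ennreal \<delta> * indicator ?A \<omega> \<partial>P)"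
          using \<delta> by (simp add: nn_integral_cmult_indicator P.emeasure_eq_measure ennreal_mult)
        also have "\<dots> \<le> (\<integral>\<^sup>+ \<omega>. ennreal \<bar>W \<epsilon> \<omega> - Y \<omega>\<bar> \<partial>P)"
          by (intro nn_integral_mono) (auto simp: indicator_def intro!: ennreal_leI)
        also note elim
        finally have "\<delta> * measure P ?A \<le> \<delta> * (e / 2)" using \<delta> e by simp
        then have "measure P ?A \<le> e / 2" using \<delta> by (simp only: mult_le_cancel_left_pos)
        then show ?case using e by simp
      qed
    qed
  qed (rule Ym)
  have "I1 M P f = (SOME Y. lim Y)" by (simp add: I1_def lim_def W_def)
  then have limI: "lim (I1 M P f)" using someI[of lim, OF limY] by simp
  then show Im [measurable]: "I1 M P f \<in> borel_measurable P" by (simp add: lim_def)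
  have "AE \<omega> in P. \<bar>I1 M P f \<omega> - Y \<omega>\<bar> \<le> 2 / real (Suc k)" for k
  proof -
    let ?\<delta> = "1 / real (Suc k)"
    \<comment> \<open>If the two limits differ by more than twice the threshold, every truncated
      integral is more than the threshold away from one of them, and both probabilities vanish as
      \<epsilon> tends to 0.\<close>
    let ?A = "{\<omega> \<in> space P. \<bar>I1 M P f \<omega> - Y \<omega>\<bar> > 2 * ?\<delta>}"
    have t: "((\<lambda>\<epsilon>. measure P {\<omega> \<in> space P. \<bar>W \<epsilon> \<omega> - I1 M P f \<omega>\<bar> > ?\<delta>}
        + measure P {\<omega> \<in> space P. \<bar>W \<epsilon> \<omega> - Y \<omega>\<bar> > ?\<delta>}) \<longlongrightarrow> 0 + 0) (at_right 0)"
      using limI limY unfolding lim_def by (intro tendsto_add) auto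
    have "measure P ?A \<le> measure P {\<omega> \<in> space P. \<bar>W \<epsilon> \<omega> - I1 M P f \<omega>\<bar> > ?\<delta>}
        + measure P {\<omega> \<in> space P. \<bar>W \<epsilon> \<omega> - Y \<omega>\<bar> > ?\<delta>}" for \<epsilon>
    proof -
      have "measure P ?A \<le> measure P ({\<omega> \<in> space P. \<bar>W \<epsilon> \<omega> - I1 M P f \<omega>\<bar> > ?\<delta>}
          \<union> {\<omega> \<in> space P. \<bar>W \<epsilon> \<omega> - Y \<omega>\<bar> > ?\<delta>})"
        by (intro P.finite_measure_mono) auto
      also have "\<dots> \<le> measure P {\<omega> \<in> space P. \<bar>W \<epsilon> \<omega> - I1 M P f \<omega>\<bar> > ?\<delta>}
          + measure P {\<omega> \<in> space P. \<bar>W \<epsilon> \<omega> - Y \<omega>\<bar> > ?\<delta>}"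
        by (intro measure_Un_le) auto
      finally show ?thesis .
    qed
    then have "measure P ?A \<le> 0"
      using tendsto_lowerbound[OF t, of "measure P ?A"] by (simp add: trivial_limit_at_right_real)
    then have "?A \<in> null_sets P"
      by (intro null_setsI) (auto simp: P.emeasure_eq_measure measure_le_0_iff)
    then show ?thesis by (rule AE_I') (auto simp: not_le)
  qed
  then have "AE \<omega> in P. \<forall>k. \<bar>I1 M P f \<omega> - Y \<omega>\<bar> \<le> 2 / real (Suc k)"
    by (subst AE_all_countable) simp
  then show "AE \<omega> in P. I1 M P f \<omega> = Y \<omega>"
  proof eventually_elim
    case (elim \<omega>)
    have "(\<lambda>k. 2 * inverse (real (Suc k))) \<longlonglongrightarrow> 2 * 0"
      by (intro tendsto_mult tendsto_const LIMSEQ_inverse_real_of_nat)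
    then have "\<bar>I1 M P f \<omega> - Y \<omega>\<bar> \<le> 2 * 0"
      using elim by (intro LIMSEQ_le_const) (auto simp: inverse_eq_divide)
    then show ?case by simp
  qed
qed

lemma has_I1_L1:
  assumes u: "integrable M u"
  shows "has_I1 u (compensated_N M u)"
  unfolding has_I1_def
proof (intro conjI allI impI)
  have [measurable]: "u \<in> borel_measurable M" using u by auto
  show "compensated_N M u \<in> borel_measurable P" by measurable
  have ip: "integrable M (small_part u \<epsilon>)" "integrable M (large_part u \<epsilon>)" for \<epsilon>
    by (intro Bochner_Integration.integrable_bound[OF u];
        auto simp: small_part_def large_part_def indicator_def)+
  fix e :: real assume e: "0 < e"
  \<comment> \<open>The error is the compensated integral of the small part, of norm at most twice
    its L1 norm; hence e / 2.\<close>
  have "\<exists>\<delta>>0. \<forall>\<epsilon>\<in>{0<..\<delta>}. (\<integral>x. \<bar>small_part u \<epsilon> x\<bar> \<partial>M) < e / 2"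
    by (rule small_part_integral_small[where H = "\<lambda>t. t"]) (use e ip(1)[of 1] in simp_all)
  then obtain \<delta> where \<delta>: "0 < \<delta>"
    "\<And>\<epsilon>. \<epsilon> \<in> {0<..\<delta>} \<Longrightarrow> (\<integral>x. \<bar>small_part u \<epsilon> x\<bar> \<partial>M) < e / 2" by blast
  have "\<forall>\<^sub>F \<epsilon> in at_right 0. \<epsilon> \<in> {0<..\<delta>}"
    using \<delta>(1) unfolding eventually_at_right_field by (intro exI[of _ \<delta>]) auto
  then show "\<forall>\<^sub>F \<epsilon> in at_right 0.
     (\<integral>\<^sup>+ \<omega>. ennreal \<bar>compensated_N M (large_part u \<epsilon>) \<omega> - compensated_N M u \<omega>\<bar> \<partial>P) \<le> ennreal e"
  proof eventually_elim
    case (elim \<epsilon>)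
    have "(\<integral>\<^sup>+ \<omega>. ennreal \<bar>compensated_N M (large_part u \<epsilon>) \<omega> - compensated_N M u \<omega>\<bar> \<partial>P)
        = (\<integral>\<^sup>+ \<omega>. ennreal \<bar>compensated_N M (small_part u \<epsilon>) \<omega>\<bar> \<partial>P)"
    proof (rule nn_integral_cong_AE)
      show "AE \<omega> in P. ennreal \<bar>compensated_N M (large_part u \<epsilon>) \<omega> - compensated_N M u \<omega>\<bar>
          = ennreal \<bar>compensated_N M (small_part u \<epsilon>) \<omega>\<bar>"
        using compensated_N_add[OF ip(1)[of \<epsilon>] ip(2)[of \<epsilon>]]
        by eventually_elim (simp add: small_plus_large)
    qed
    also have "\<dots> \<le> ennreal (2 * (\<integral>x. \<bar>small_part u \<epsilon> x\<bar> \<partial>M))" by (rule compensated_N_L1[OF ip(1)])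
    also have "\<dots> \<le> ennreal e" using \<delta>(2)[OF elim] by (intro ennreal_leI) simp
    finally show ?case .
  qed
qed

lemma poisson_orlicz_norm_L1:
  assumes "integrable M u"
  shows "poisson_orlicz_norm M P u = (\<integral>\<^sup>+ \<omega>. ennreal \<bar>compensated_N M u \<omega>\<bar> \<partial>P)"
  unfolding poisson_orlicz_norm_def
proof (rule nn_integral_cong_AE)
  have "u \<in> borel_measurable M" using assms by auto
  from I1_AE(2)[OF this has_I1_L1[OF assms]]
  show "AE \<omega> in P. ennreal \<bar>I1 M P u \<omega>\<bar> = ennreal \<bar>compensated_N M u \<omega>\<bar>"
    by eventually_elim simp
qed

lemma compensated_N_L2:
  assumes u: "integrable M u" and u2: "integrable M (\<lambda>x. (u x)\<^sup>2)"
  shows "(\<integral>\<^sup>+ \<omega>. ennreal ((compensated_N M u \<omega>)\<^sup>2) \<partial>P) = ennreal (\<integral>x. (u x)\<^sup>2 \<partial>M)"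
    and "(\<integral>\<^sup>+ \<omega>. ennreal \<bar>compensated_N M u \<omega>\<bar> \<partial>P) \<le> ennreal (sqrt (\<integral>x. (u x)\<^sup>2 \<partial>M))"
proof -
  have [measurable]: "u \<in> borel_measurable M" using u by auto
  show *: "(\<integral>\<^sup>+ \<omega>. ennreal ((compensated_N M u \<omega>)\<^sup>2) \<partial>P) = ennreal (\<integral>x. (u x)\<^sup>2 \<partial>M)"
    using compensated_N_square[OF assms] by (simp add: has_bochner_integral_iff nn_integral_eq_integral)
  show "(\<integral>\<^sup>+ \<omega>. ennreal \<bar>compensated_N M u \<omega>\<bar> \<partial>P) \<le> ennreal (sqrt (\<integral>x. (u x)\<^sup>2 \<partial>M))"
    by (rule P.nn_integral_abs_le_sqrt) (auto simp: * intro!: Bochner_Integration.integral_nonneg)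
qed

text \<open>Two truncations differ only where \<epsilon> < |f| \<le> \<delta>, so their difference
  is dominated by \<open>small_part f \<delta>\<close>; it is both integrable and square integrable,
  and the isometry applies to it.\<close>

lemma large_part_diff_L2:
  assumes f: "f \<in> L_Phi M" and "0 < \<epsilon>" "\<epsilon> \<le> \<delta>"
  defines "W \<equiv> \<lambda>\<epsilon>. compensated_N M (large_part f \<epsilon>)"
  shows "(\<integral>\<^sup>+ \<omega>. ennreal ((W \<epsilon> \<omega> - W \<delta> \<omega>)\<^sup>2) \<partial>P) \<le> ennreal (\<integral>x. (small_part f \<delta> x)\<^sup>2 \<partial>M)"
    and "(\<integral>\<^sup>+ \<omega>. ennreal \<bar>W \<delta> \<omega> - W \<epsilon> \<omega>\<bar> \<partial>P) \<le> ennreal (sqrt (\<integral>x. (small_part f \<delta> x)\<^sup>2 \<partial>M))"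
proof -
  have [measurable]: "f \<in> borel_measurable M" using f by (simp add: L_Phi_iff)
  let ?v = "\<lambda>x. large_part f \<epsilon> x - large_part f \<delta> x"
  have ip: "integrable M (large_part f \<epsilon>)" "integrable M (large_part f \<delta>)"
    using large_part_L1[OF f, of \<epsilon>] large_part_L1[OF f, of \<delta>] assms by (auto simp: L1_def)
  have s2: "integrable M (\<lambda>x. (small_part f \<delta> x)\<^sup>2)"
    using small_part_L2[OF f] by (simp add: L2_def)
  have le: "(?v x)\<^sup>2 \<le> (small_part f \<delta> x)\<^sup>2" for x
    using \<open>\<epsilon> \<le> \<delta>\<close> by (auto simp: large_part_def small_part_def indicator_def)
  have v: "integrable M ?v" "integrable M (\<lambda>x. (?v x)\<^sup>2)"
    using ip le by (auto intro!: Bochner_Integration.integrable_bound[OF s2])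
  have mono: "(\<integral>x. (?v x)\<^sup>2 \<partial>M) \<le> (\<integral>x. (small_part f \<delta> x)\<^sup>2 \<partial>M)"
    by (intro Bochner_Integration.integral_mono v s2 le)
  have ae: "AE \<omega> in P. compensated_N M ?v \<omega> = W \<epsilon> \<omega> - W \<delta> \<omega>"
    unfolding W_def by (rule compensated_N_diff[OF ip])
  have "(\<integral>\<^sup>+ \<omega>. ennreal ((W \<epsilon> \<omega> - W \<delta> \<omega>)\<^sup>2) \<partial>P) = (\<integral>\<^sup>+ \<omega>. ennreal ((compensated_N M ?v \<omega>)\<^sup>2) \<partial>P)"
    by (rule nn_integral_cong_AE, use ae in eventually_elim) simp
  also have "\<dots> \<le> ennreal (\<integral>x. (small_part f \<delta> x)\<^sup>2 \<partial>M)"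
    unfolding compensated_N_L2(1)[OF v] by (rule ennreal_leI[OF mono])
  finally show "(\<integral>\<^sup>+ \<omega>. ennreal ((W \<epsilon> \<omega> - W \<delta> \<omega>)\<^sup>2) \<partial>P) \<le> ennreal (\<integral>x. (small_part f \<delta> x)\<^sup>2 \<partial>M)" .
  have "(\<integral>\<^sup>+ \<omega>. ennreal \<bar>W \<delta> \<omega> - W \<epsilon> \<omega>\<bar> \<partial>P) = (\<integral>\<^sup>+ \<omega>. ennreal \<bar>compensated_N M ?v \<omega>\<bar> \<partial>P)"
    by (rule nn_integral_cong_AE, use ae in eventually_elim) (simp add: abs_minus_commute)
  also have "\<dots> \<le> ennreal (sqrt (\<integral>x. (?v x)\<^sup>2 \<partial>M))" by (rule compensated_N_L2(2)[OF v])
  also have "\<dots> \<le> ennreal (sqrt (\<integral>x. (small_part f \<delta> x)\<^sup>2 \<partial>M))"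
    using mono by (intro ennreal_leI) simp
  finally show "(\<integral>\<^sup>+ \<omega>. ennreal \<bar>W \<delta> \<omega> - W \<epsilon> \<omega>\<bar> \<partial>P) \<le> ennreal (sqrt (\<integral>x. (small_part f \<delta> x)\<^sup>2 \<partial>M))" .
qed

text \<open>By \<open>large_part_diff_L2\<close> the truncated integrals are Cauchy in L2 as the
  level decreases. Fast decreasing levels give an almost sure limit \<open>Y\<close>, and Fatou's
  lemma then bounds the distance from \<open>Y\<close> at every level, not only at the selected
  ones.\<close>

lemma has_I1_exists:
  assumes f: "f \<in> L_Phi M"
  shows "\<exists>Y. has_I1 f Y"
proof -
  have [measurable]: "f \<in> borel_measurable M" using f by (simp add: L_Phi_iff)
  define W where "W \<epsilon> = compensated_N M (large_part f \<epsilon>)" for \<epsilon>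
  define r where "r \<epsilon> = (\<integral>x. (small_part f \<epsilon> x)\<^sup>2 \<partial>M)" for \<epsilon>
  have [measurable]: "W \<epsilon> \<in> borel_measurable P" for \<epsilon> unfolding W_def by measurable
  have small: "\<exists>\<delta>>0. \<forall>\<epsilon>\<in>{0<..\<delta>}. r \<epsilon> < e" if "0 < e" for e
  proof -
    have "integrable M (\<lambda>x. \<bar>small_part f 1 x\<bar>\<^sup>2)"
      using small_part_L2[OF f, of 1] by (simp add: L2_def)
    then have "\<exists>\<delta>>0. \<forall>\<epsilon>\<in>{0<..\<delta>}. (\<integral>x. \<bar>small_part f \<epsilon> x\<bar>\<^sup>2 \<partial>M) < e"
      by (intro small_part_integral_small[where H = "\<lambda>t. t\<^sup>2"]) (use that in \<open>simp_all add: power_mono\<close>)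
    then show ?thesis by (simp add: r_def)
  qed
  \<comment> \<open>The bound 1 / (k + 1) drives the selected levels below any given \<epsilon>; the
    bound 8^(-k) is the one required by \<open>AE_convergent_L2\<close>.\<close>
  define Q where "Q k s \<longleftrightarrow> 0 < s \<and> s \<le> 1 / real (Suc k) \<and> r s \<le> (1 / 8) ^ k" for k :: nat and s
  have ex: "\<exists>s. Q k s \<and> s \<le> t" if "0 < t" for k t
  proof -
    obtain \<delta> where \<delta>: "0 < \<delta>" "\<forall>\<epsilon>\<in>{0<..\<delta>}. r \<epsilon> < (1 / 8) ^ k" using small[of "(1 / 8) ^ k"] by auto
    then show ?thesis
      using that by (intro exI[of _ "min \<delta> (min t (1 / real (Suc k)))"]) (auto simp: Q_def intro: less_imp_le)
  qed
  obtain s where s: "\<And>k. Q k (s k)" "\<And>k. s (Suc k) \<le> s k"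
    using dependent_nat_choice[of Q "\<lambda>k x y. y \<le> x"] ex[of 1 0] ex by (metis Q_def zero_less_one)
  have s0: "0 < s k" "s k \<le> 1 / real (Suc k)" "r (s k) \<le> (1 / 8) ^ k" for k using s(1)[of k] by (auto simp: Q_def)
  have "AE \<omega> in P. convergent (\<lambda>k. W (s k) \<omega>)"
  proof (rule AE_convergent_L2)
    fix k
    have "(\<integral>\<^sup>+ \<omega>. ennreal ((W (s (Suc k)) \<omega> - W (s k) \<omega>)\<^sup>2) \<partial>P) \<le> ennreal (r (s k))"
      unfolding W_def r_def by (rule large_part_diff_L2(1)[OF f s0(1) s(2)])
    also have "\<dots> \<le> ennreal ((1 / 8) ^ k)" by (rule ennreal_leI[OF s0(3)])
    finally show "(\<integral>\<^sup>+ \<omega>. ennreal ((W (s (Suc k)) \<omega> - W (s k) \<omega>)\<^sup>2) \<partial>P) \<le> ennreal ((1 / 8) ^ k)" .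
  qed measurable
  define Y where "Y \<omega> = lim (\<lambda>k. W (s k) \<omega>)" for \<omega>
  have Ym: "Y \<in> borel_measurable P" unfolding Y_def by (rule borel_measurable_lim_metric) measurable
  have lim: "AE \<omega> in P. (\<lambda>k. W (s k) \<omega>) \<longlonglongrightarrow> Y \<omega>"
    using \<open>AE \<omega> in P. convergent _\<close> by eventually_elim (simp add: Y_def convergent_LIMSEQ_iff)
  have bd: "(\<integral>\<^sup>+ \<omega>. ennreal \<bar>W \<epsilon> \<omega> - Y \<omega>\<bar> \<partial>P) \<le> ennreal (sqrt (r \<epsilon>))" if \<epsilon>: "0 < \<epsilon>" for \<epsilon>
  proof -
    have "(\<integral>\<^sup>+ \<omega>. ennreal \<bar>W \<epsilon> \<omega> - Y \<omega>\<bar> \<partial>P) = (\<integral>\<^sup>+ \<omega>. liminf (\<lambda>k. ennreal \<bar>W \<epsilon> \<omega> - W (s k) \<omega>\<bar>) \<partial>P)"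
    proof (rule nn_integral_cong_AE, use lim in eventually_elim)
      fix \<omega> assume "(\<lambda>k. W (s k) \<omega>) \<longlonglongrightarrow> Y \<omega>"
      then have "(\<lambda>k. ennreal \<bar>W \<epsilon> \<omega> - W (s k) \<omega>\<bar>) \<longlonglongrightarrow> ennreal \<bar>W \<epsilon> \<omega> - Y \<omega>\<bar>"
        by (intro tendsto_intros)
      then show "ennreal \<bar>W \<epsilon> \<omega> - Y \<omega>\<bar> = liminf (\<lambda>k. ennreal \<bar>W \<epsilon> \<omega> - W (s k) \<omega>\<bar>)"
        by (intro lim_imp_Liminf[symmetric]) simp_all
    qed
    also have "\<dots> \<le> liminf (\<lambda>k. \<integral>\<^sup>+ \<omega>. ennreal \<bar>W \<epsilon> \<omega> - W (s k) \<omega>\<bar> \<partial>P)"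
      by (intro nn_integral_liminf) measurable
    also have "\<dots> \<le> liminf (\<lambda>k::nat. ennreal (sqrt (r \<epsilon>)))"
    proof (rule Liminf_mono)
      obtain N where N: "inverse (real (Suc N)) < \<epsilon>" using reals_Archimedean[OF \<epsilon>] by auto
      show "\<forall>\<^sub>F k in sequentially. (\<integral>\<^sup>+ \<omega>. ennreal \<bar>W \<epsilon> \<omega> - W (s k) \<omega>\<bar> \<partial>P) \<le> ennreal (sqrt (r \<epsilon>))"
        using eventually_ge_at_top[of N]
      proof eventually_elim
        case (elim k)
        then have "1 / real (Suc k) \<le> inverse (real (Suc N))" by (simp add: inverse_eq_divide frac_le)
        then have "s k \<le> \<epsilon>" using s0(2)[of k] N by linarith
        then show ?case unfolding W_def r_def by (rule large_part_diff_L2(2)[OF f s0(1)])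
      qed
    qed
    also have "\<dots> = ennreal (sqrt (r \<epsilon>))" by (simp add: Liminf_const)
    finally show ?thesis .
  qed
  have "has_I1 f Y"
    unfolding has_I1_def
  proof (intro conjI allI impI)
    fix e :: real assume e: "0 < e"
    then obtain \<delta> where \<delta>: "0 < \<delta>" "\<forall>\<epsilon>\<in>{0<..\<delta>}. r \<epsilon> < e\<^sup>2" using small[of "e\<^sup>2"] by auto
    have "\<forall>\<^sub>F \<epsilon> in at_right 0. \<epsilon> \<in> {0<..\<delta>}"
      using \<delta>(1) unfolding eventually_at_right_field by (intro exI[of _ \<delta>]) auto
    then show "\<forall>\<^sub>F \<epsilon> in at_right 0.
       (\<integral>\<^sup>+ \<omega>. ennreal \<bar>compensated_N M (large_part f \<epsilon>) \<omega> - Y \<omega>\<bar> \<partial>P) \<le> ennreal e"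
    proof eventually_elim
      case (elim \<epsilon>)
      then have "r \<epsilon> \<le> e\<^sup>2" using \<delta>(2) by (auto intro: less_imp_le)
      then have "sqrt (r \<epsilon>) \<le> e" using e by (intro real_le_lsqrt) auto
      then have "ennreal (sqrt (r \<epsilon>)) \<le> ennreal e" by (rule ennreal_leI)
      moreover have "0 < \<epsilon>" using elim by simp
      ultimately show ?case using bd[of \<epsilon>] unfolding W_def by (meson order_trans)
    qed
  qed (rule Ym)
  then show ?thesis by blast
qed

text \<open>\<open>g\<close> is only square integrable, so its plain integrals may not exist. The
  estimate is therefore proved for the truncations of \<open>f\<close>, uniformly in the level, and
  passed to the limit in mean.\<close>

lemma poisson_orlicz_norm_le:
  assumes f: "f \<in> L_Phi M" and g: "g \<in> L2 M" and h: "h \<in> L1 M"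
    and eq: "AE x in M. f x = g x + h x"
  shows "poisson_orlicz_norm M P f \<le> ennreal (sqrt (\<integral>x. (g x)\<^sup>2 \<partial>M) + 2 * (\<integral>x. \<bar>h x\<bar> \<partial>M))"
proof -
  let ?B = "ennreal (sqrt (\<integral>x. (g x)\<^sup>2 \<partial>M) + 2 * (\<integral>x. \<bar>h x\<bar> \<partial>M))"
  have [measurable]: "f \<in> borel_measurable M" "g \<in> borel_measurable M" "h \<in> borel_measurable M"
    and h1: "integrable M h" and g2: "integrable M (\<lambda>x. (g x)\<^sup>2)"
    using f g h by (auto simp: L_Phi_iff L2_def L1_def)
  define W where "W \<epsilon> = compensated_N M (large_part f \<epsilon>)" for \<epsilon>
  have [measurable]: "W \<epsilon> \<in> borel_measurable P" for \<epsilon> unfolding W_def by measurable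
  have bd: "(\<integral>\<^sup>+ \<omega>. ennreal \<bar>W \<epsilon> \<omega>\<bar> \<partial>P) \<le> ?B" if "0 < \<epsilon>" for \<epsilon>
  proof -
    \<comment> \<open>\<open>g\<close> is cut by the size of \<open>f\<close>, not by its own, and
      \<open>k\<close> is defined by subtraction, so that \<open>w\<close> and \<open>k\<close> add
      up to the truncation of \<open>f\<close> at every point. Almost everywhere \<open>k\<close> is
      dominated by \<open>h\<close>, hence integrable, and so is \<open>w\<close> as a difference of
      integrable functions.\<close>
    define w where "w x = (if \<epsilon> < \<bar>f x\<bar> then g x else 0)" for x
    define k where "k x = large_part f \<epsilon> x - w x" for x
    have [measurable]: "w \<in> borel_measurable M" unfolding w_def by measurable
    have [measurable]: "k \<in> borel_measurable M" unfolding k_def by measurable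
    have kh: "AE x in M. \<bar>k x\<bar> \<le> \<bar>h x\<bar>"
      using eq by eventually_elim (auto simp: k_def w_def large_part_def)
    have k: "integrable M k" by (rule Bochner_Integration.integrable_bound[OF h1]) (use kh in auto)
    have l: "integrable M (large_part f \<epsilon>)" using large_part_L1[OF f that] by (simp add: L1_def)
    have w: "integrable M w"
      using Bochner_Integration.integrable_diff[OF l k] by (simp add: k_def)
    have wg: "(w x)\<^sup>2 \<le> (g x)\<^sup>2" for x by (simp add: w_def)
    have w2: "integrable M (\<lambda>x. (w x)\<^sup>2)"
      by (rule Bochner_Integration.integrable_bound[OF g2]) (use wg in auto)
    have ae: "AE \<omega> in P. W \<epsilon> \<omega> = compensated_N M w \<omega> + compensated_N M k \<omega>"
      using compensated_N_add[OF w k] by (simp add: W_def k_def)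
    have "(\<integral>\<^sup>+ \<omega>. ennreal \<bar>W \<epsilon> \<omega>\<bar> \<partial>P)
        \<le> (\<integral>\<^sup>+ \<omega>. ennreal \<bar>compensated_N M w \<omega>\<bar> + ennreal \<bar>compensated_N M k \<omega>\<bar> \<partial>P)"
    proof (rule nn_integral_mono_AE, use ae in eventually_elim)
      fix \<omega> assume "W \<epsilon> \<omega> = compensated_N M w \<omega> + compensated_N M k \<omega>"
      then have "\<bar>W \<epsilon> \<omega>\<bar> \<le> \<bar>compensated_N M w \<omega>\<bar> + \<bar>compensated_N M k \<omega>\<bar>" by linarith
      then show "ennreal \<bar>W \<epsilon> \<omega>\<bar> \<le> ennreal \<bar>compensated_N M w \<omega>\<bar> + ennreal \<bar>compensated_N M k \<omega>\<bar>"
        by (simp add: ennreal_leI flip: ennreal_plus)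
    qed
    also have "\<dots> = (\<integral>\<^sup>+ \<omega>. ennreal \<bar>compensated_N M w \<omega>\<bar> \<partial>P) + (\<integral>\<^sup>+ \<omega>. ennreal \<bar>compensated_N M k \<omega>\<bar> \<partial>P)"
      by (rule nn_integral_add) measurable
    also have "\<dots> \<le> ennreal (sqrt (\<integral>x. (w x)\<^sup>2 \<partial>M)) + ennreal (2 * (\<integral>x. \<bar>k x\<bar> \<partial>M))"
      by (intro add_mono compensated_N_L2(2) compensated_N_L1 w w2 k)
    also have "\<dots> = ennreal (sqrt (\<integral>x. (w x)\<^sup>2 \<partial>M) + 2 * (\<integral>x. \<bar>k x\<bar> \<partial>M))"
      by (intro ennreal_plus[symmetric]) auto
    also have "\<dots> \<le> ?B"
    proof (intro ennreal_leI add_mono mult_left_mono)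
      show "sqrt (\<integral>x. (w x)\<^sup>2 \<partial>M) \<le> sqrt (\<integral>x. (g x)\<^sup>2 \<partial>M)"
        using Bochner_Integration.integral_mono[OF w2 g2 wg] by simp
      show "(\<integral>x. \<bar>k x\<bar> \<partial>M) \<le> (\<integral>x. \<bar>h x\<bar> \<partial>M)"
        by (intro integral_mono_AE kh integrable_abs k h1)
    qed simp
    finally show ?thesis .
  qed
  obtain Y where Y: "has_I1 f Y" using has_I1_exists[OF f] by blast
  then have [measurable]: "Y \<in> borel_measurable P" by (simp add: has_I1_def)
  have "poisson_orlicz_norm M P f = (\<integral>\<^sup>+ \<omega>. ennreal \<bar>Y \<omega>\<bar> \<partial>P)"
    unfolding poisson_orlicz_norm_def
  proof (rule nn_integral_cong_AE)
    have "AE \<omega> in P. I1 M P f \<omega> = Y \<omega>" by (rule I1_AE(2)[OF _ Y]) measurable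
    then show "AE \<omega> in P. ennreal \<bar>I1 M P f \<omega>\<bar> = ennreal \<bar>Y \<omega>\<bar>"
      by eventually_elim simp
  qed
  also have "\<dots> \<le> ?B"
  proof (rule ennreal_le_epsilon)
    fix e :: real assume e: "0 < e"
    have "\<forall>\<^sub>F \<epsilon> in at_right 0. 0 < \<epsilon> \<and> (\<integral>\<^sup>+ \<omega>. ennreal \<bar>W \<epsilon> \<omega> - Y \<omega>\<bar> \<partial>P) \<le> ennreal e"
      using Y e eventually_at_right_less[of "0 :: real"] by (auto simp: has_I1_def W_def eventually_conj_iff)
    then obtain \<epsilon> where \<epsilon>: "0 < \<epsilon>" "(\<integral>\<^sup>+ \<omega>. ennreal \<bar>W \<epsilon> \<omega> - Y \<omega>\<bar> \<partial>P) \<le> ennreal e"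
      using eventually_happens'[OF trivial_limit_at_right_real] by blast
    have "(\<integral>\<^sup>+ \<omega>. ennreal \<bar>Y \<omega>\<bar> \<partial>P) \<le> (\<integral>\<^sup>+ \<omega>. ennreal \<bar>W \<epsilon> \<omega>\<bar> + ennreal \<bar>W \<epsilon> \<omega> - Y \<omega>\<bar> \<partial>P)"
    proof (rule nn_integral_mono)
      fix \<omega>
      have "\<bar>Y \<omega>\<bar> \<le> \<bar>W \<epsilon> \<omega>\<bar> + \<bar>W \<epsilon> \<omega> - Y \<omega>\<bar>" by linarith
      then show "ennreal \<bar>Y \<omega>\<bar> \<le> ennreal \<bar>W \<epsilon> \<omega>\<bar> + ennreal \<bar>W \<epsilon> \<omega> - Y \<omega>\<bar>"
        by (simp add: ennreal_leI flip: ennreal_plus)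
    qed
    also have "\<dots> = (\<integral>\<^sup>+ \<omega>. ennreal \<bar>W \<epsilon> \<omega>\<bar> \<partial>P) + (\<integral>\<^sup>+ \<omega>. ennreal \<bar>W \<epsilon> \<omega> - Y \<omega>\<bar> \<partial>P)"
      by (rule nn_integral_add) measurable
    also have "\<dots> \<le> ?B + ennreal e" by (intro add_mono bd \<epsilon>)
    finally show "(\<integral>\<^sup>+ \<omega>. ennreal \<bar>Y \<omega>\<bar> \<partial>P) \<le> ?B + ennreal e" .
  qed
  finally show ?thesis .
qed

end

section \<open>Remote infiniteness\<close>

context measure_preserving
begin

text \<open>\<open>trans_parts\<close> at level 1 supplies a witness for \<open>SOME\<close>. The
  facts extracted here have the same form as those in \<open>transfer_props\<close>, so that later
  arguments do not distinguish the two operators.\<close>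

lemma poisson_transfer_props:
  assumes f: "f \<in> L_Phi M"
  shows "poisson_transfer M T f \<in> L_Phi M"
    and "\<And>g. g \<in> L2 M \<inter> L_infty M \<Longrightarrow>
      (\<integral>x. poisson_transfer M T f x * g x \<partial>M) = (\<integral>x. f x * g (T x) \<partial>M)"
proof -
  let ?P = "\<lambda>h. h \<in> L_Phi M \<and> (\<forall>g \<in> L2 M \<inter> L_infty M. (\<integral>x. h x * g x \<partial>M) = (\<integral>x. f x * g (T x) \<partial>M))"
  have "?P (poisson_transfer M T f)"
    unfolding poisson_transfer_def
    by (rule someI[of ?P "\<lambda>x. trans (small_part f 1) x + trans (large_part f 1) x"])
      (use trans_parts[OF f, of 1] in auto)
  then show "poisson_transfer M T f \<in> L_Phi M"
    and "\<And>g. g \<in> L2 M \<inter> L_infty M \<Longrightarrow>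
      (\<integral>x. poisson_transfer M T f x * g x \<partial>M) = (\<integral>x. f x * g (T x) \<partial>M)"
    by auto
qed

lemma transfer_props:
  assumes f: "f \<in> L1 M"
  shows "transfer M T f \<in> L_Phi M"
    and "\<And>g. g \<in> L2 M \<inter> L_infty M \<Longrightarrow>
      (\<integral>x. transfer M T f x * g x \<partial>M) = (\<integral>x. f x * g (T x) \<partial>M)"
proof -
  let ?P = "\<lambda>h. h \<in> L1 M \<and> (\<forall>g \<in> L_infty M. (\<integral>x. h x * g x \<partial>M) = (\<integral>x. f x * g (T x) \<partial>M))"
  have "?P (transfer M T f)"
    unfolding transfer_def
    by (rule someI[of ?P "trans f"]) (use trans_L1[OF f] in \<open>auto simp: has_bochner_integral_iff\<close>)
  then show "transfer M T f \<in> L_Phi M"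
    and "\<And>g. g \<in> L2 M \<inter> L_infty M \<Longrightarrow>
      (\<integral>x. transfer M T f x * g x \<partial>M) = (\<integral>x. f x * g (T x) \<partial>M)"
    by (auto intro: L1_L_Phi)
qed

end

text \<open>Dominated convergence along the levels n + 1, with \<open>large_part f 1\<close> as
  majorant; at each point the large part is eventually 0.\<close>

lemma large_part_L1_small:
  assumes f: "f \<in> L_Phi M" and "0 < e"
  shows "\<exists>K>0. (\<integral>x. \<bar>large_part f K x\<bar> \<partial>M) < e"
proof -
  have [measurable]: "f \<in> borel_measurable M" using f by (simp add: L_Phi_iff)
  have int: "integrable M (\<lambda>x. \<bar>large_part f 1 x\<bar>)"
    using large_part_L1[OF f, of 1] by (simp add: L1_def)
  have "(\<lambda>n. \<integral>x. \<bar>large_part f (real (Suc n)) x\<bar> \<partial>M) \<longlonglongrightarrow> (\<integral>x. 0 \<partial>M)"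
  proof (rule integral_dominated_convergence[OF _ _ int])
    show "AE x in M. (\<lambda>n. \<bar>large_part f (real (Suc n)) x\<bar>) \<longlonglongrightarrow> 0"
    proof (rule AE_I2)
      fix x
      obtain N :: nat where N: "\<bar>f x\<bar> \<le> N" using real_arch_simple by blast
      have "\<forall>\<^sub>F n in sequentially. \<bar>large_part f (real (Suc n)) x\<bar> = 0"
        using eventually_ge_at_top[of N]
      proof eventually_elim
        case (elim n)
        then have "\<bar>f x\<bar> \<le> real (Suc n)" using N by simp
        then show ?case by (simp add: large_part_def)
      qed
      then show "(\<lambda>n. \<bar>large_part f (real (Suc n)) x\<bar>) \<longlonglongrightarrow> 0" by (rule tendsto_eventually)
    qed
    show "AE x in M. norm \<bar>large_part f (real (Suc n)) x\<bar> \<le> \<bar>large_part f 1 x\<bar>" for n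
      by (intro AE_I2) (auto simp: large_part_def indicator_def)
  qed measurable
  then have "\<forall>\<^sub>F n in sequentially. (\<integral>x. \<bar>large_part f (real (Suc n)) x\<bar> \<partial>M) < e"
    using \<open>0 < e\<close> by (intro order_tendstoD) auto
  then obtain n where "(\<integral>x. \<bar>large_part f (real (Suc n)) x\<bar> \<partial>M) < e"
    by (auto simp: eventually_sequentially)
  then show ?thesis by (intro exI[of _ "real (Suc n)"]) simp
qed

section \<open>The two implications\<close>

locale poisson_suspension = poisson_space M P + measure_preserving M T
  for M :: "'a measure" and P :: "'a measure measure" and T :: "'a \<Rightarrow> 'a"
begin

text \<open>Uniqueness identifies \<open>u n\<close>, almost everywhere, with the sum of the
  transferred small and large parts of \<open>f\<close>. The L2 part decays, the L1 part stays
  uniformly small.\<close>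

lemma remotely_infinite_imp_tendsto:
  assumes ri: "remotely_infinite M T" and f: "f \<in> L_Phi M"
    and u: "\<And>n. u n \<in> L_Phi M"
    and eq: "\<And>n g. g \<in> L2 M \<inter> L_infty M \<Longrightarrow> (\<integral>x. u n x * g x \<partial>M) = (\<integral>x. f x * g ((T ^^ n) x) \<partial>M)"
  shows "(\<lambda>n. poisson_orlicz_norm M P (u n)) \<longlonglongrightarrow> 0"
proof (rule tendsto_zero_ennreal)
  fix e :: real assume e: "0 < e"
  \<comment> \<open>The L1 norm does not grow under transfer and enters the norm bound with factor
    2, so e / 4 leaves e / 2 for the L2 part.\<close>
  obtain K where K: "0 < K" "(\<integral>x. \<bar>large_part f K x\<bar> \<partial>M) < e / 4"
    using large_part_L1_small[OF f, of "e / 4"] e by auto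
  note s = small_part_L2[OF f, of K] and l = large_part_L1[OF f K(1)]
  have "(\<lambda>n. sqrt (\<integral>x. (transn n (small_part f K) x)\<^sup>2 \<partial>M)) \<longlonglongrightarrow> sqrt 0"
    by (intro tendsto_real_sqrt remotely_infinite_L2_tendsto ri s)
  then have "\<forall>\<^sub>F n in sequentially. sqrt (\<integral>x. (transn n (small_part f K) x)\<^sup>2 \<partial>M) < e / 2"
    using e by (intro order_tendstoD(2)) auto
  then show "\<forall>\<^sub>F n in sequentially. poisson_orlicz_norm M P (u n) < ennreal e"
  proof eventually_elim
    case (elim n)
    interpret n: measure_preserving M "T ^^ n" by (rule measure_preserving_funpow)
    have "poisson_orlicz_norm M P (u n) \<le> ennreal (sqrt (\<integral>x. (n.trans (small_part f K) x)\<^sup>2 \<partial>M)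
        + 2 * (\<integral>x. \<bar>n.trans (large_part f K) x\<bar> \<partial>M))"
    proof (rule poisson_orlicz_norm_le[OF u n.trans_L2(1)[OF s] n.trans_L1(1)[OF l]])
      show "AE x in M. u n x = n.trans (small_part f K) x + n.trans (large_part f K) x"
        by (rule L_Phi_unique[OF u n.trans_parts(1)[OF f K(1)]])
          (simp only: eq n.trans_parts(2)[OF f K(1)])
    qed
    also have "\<dots> < ennreal e"
      using elim n.trans_L1(2)[OF l] K(2) e
      by (intro ennreal_lessI) (simp_all add: transn_def)
    finally show ?case .
  qed
qed

text \<open>Only the event that no point falls in \<open>A\<close> is kept: it has probability
  \<open>exp (- measure M A)\<close>, and on it the compensated count is
  \<open>- measure M A\<close>.\<close>

lemma compensated_N_indicator_lower:
  assumes A: "A \<in> sets M" "emeasure M A < \<infinity>"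
  shows "ennreal (measure M A * exp (- measure M A)) \<le> (\<integral>\<^sup>+ \<omega>. ennreal \<bar>compensated_N M (indicator A) \<omega>\<bar> \<partial>P)"
proof -
  note [measurable] = A(1)
  let ?E = "{\<omega> \<in> space P. emeasure \<omega> A = of_nat 0}"
  have [measurable]: "?E \<in> sets P" by measurable
  have "ennreal (measure M A * exp (- measure M A)) = (\<integral>\<^sup>+ \<omega>. ennreal (measure M A) * indicator ?E \<omega> \<partial>P)"
    using poisson_prob[OF A, of 0]
    by (simp add: nn_integral_cmult_indicator P.emeasure_eq_measure ennreal_mult)
  also have "\<dots> \<le> (\<integral>\<^sup>+ \<omega>. ennreal \<bar>compensated_N M (indicator A) \<omega>\<bar> \<partial>P)"
  proof (rule nn_integral_mono)
    fix \<omega> assume \<omega>: "\<omega> \<in> space P"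
    show "ennreal (measure M A) * indicator ?E \<omega> \<le> ennreal \<bar>compensated_N M (indicator A) \<omega>\<bar>"
    proof (cases "emeasure \<omega> A = 0")
      case True
      have i: "A \<inter> space M = A" using sets.sets_into_space[OF A(1)] by auto
      have "(\<integral>x. indicator A x \<partial>\<omega>) = measure \<omega> A"
        using i sets_points[OF \<omega>] space_points[OF \<omega>] by simp
      then have "(\<integral>x. indicator A x \<partial>\<omega>) = (0 :: real)" using True by (simp add: measure_def)
      moreover have "(\<integral>x. indicator A x \<partial>M) = measure M A" using i by simp
      ultimately show ?thesis using True \<omega> by (simp add: compensated_N_def)
    qed simp
  qed
  finally show ?thesis .
qed

lemma tendsto_imp_remotely_infinite:
  assumes big: "\<And>b :: real. 0 < b \<Longrightarrow> \<exists>B\<in>sets M. emeasure M B = ennreal b"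
    and nri: "\<not> remotely_infinite M T"
  shows "\<exists>f\<in>L1_0 M. \<forall>u. (\<forall>n. u n \<in> L_Phi M \<and> (\<forall>g\<in>L2 M \<inter> L_infty M.
      (\<integral>x. u n x * g x \<partial>M) = (\<integral>x. f x * g ((T ^^ n) x) \<partial>M))) \<longrightarrow>
      \<not> (\<lambda>n. poisson_orlicz_norm M P (u n)) \<longlonglongrightarrow> 0"
proof -
  from nri obtain A where tail: "\<And>n. A \<in> sets (vimage_algebra (space M) (T ^^ n) M)"
    and A0: "emeasure M A \<noteq> 0" and Afin: "emeasure M A < \<infinity>"
    by (auto simp: remotely_infinite_def less_top)
  have Tn: "T ^^ n \<in> measurable M M" for n
    using measure_preserving_funpow by (rule measure_preserving.T_measurable)
  have ex: "\<exists>An. An \<in> sets M \<and> A = (T ^^ n) -` An \<inter> space M" for n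
    using tail[of n] measurable_space[OF Tn[of n]] by (subst (asm) sets_vimage_algebra2) auto
  then obtain An where An [measurable]: "\<And>n. An n \<in> sets M" and A_eq: "\<And>n. A = (T ^^ n) -` An n \<inter> space M"
    by metis
  have [measurable]: "A \<in> sets M" using An[of 0] A_eq[of 0] by simp
  have mA: "emeasure M (An n) = emeasure M A" for n
  proof -
    interpret n: measure_preserving M "T ^^ n" by (rule measure_preserving_funpow)
    show ?thesis using emeasure_distr[OF n.T_measurable An[of n]] A_eq[of n] by (simp add: n.distr_T)
  qed
  define a where "a = measure M A"
  have a: "emeasure M A = ennreal a" using Afin by (simp add: a_def emeasure_eq_ennreal_measure)
  then have "0 < a" using A0 by (cases "0 < a") (auto simp: ennreal_neg)
  \<comment> \<open>The compensated indicator of \<open>An n\<close> has norm at least a e^(-a),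
    which is 2 \<kappa>. Integral 0 forces the coefficient a / b on \<open>B\<close>, of L2 norm a /
    sqrt b, and b = (2 e^a)^2 makes this equal to \<kappa>; so \<kappa> remains for the
    difference.\<close>
  define \<kappa> where "\<kappa> = a * exp (- a) / 2"
  have \<kappa>: "0 < \<kappa>" using \<open>0 < a\<close> by (simp add: \<kappa>_def)
  define b where "b = (2 * exp a)\<^sup>2"
  have b0: "0 < b" by (simp add: b_def)
  obtain B where B [measurable]: "B \<in> sets M" and b: "emeasure M B = ennreal b" using big[OF b0] by blast
  define f where "f x = indicator A x - a / b * indicator B x" for x
  have mB: "measure M B = b" using b b0 by (simp add: measure_def)
  have iB: "integrable M (\<lambda>x. a / b * indicator B x)" using b by (auto simp: less_top[symmetric])
  have iA: "integrable M (indicator A :: 'a \<Rightarrow> real)" using a by (auto simp: less_top[symmetric])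
  have f0: "f \<in> L1_0 M"
  proof -
    have "(\<integral>x. f x \<partial>M) = a - a / b * b"
      using iA iB sets.sets_into_space[of A M] sets.sets_into_space[of B M]
      by (simp add: f_def mB a_def Int_absorb1 Int_absorb2)
    then show ?thesis using iA iB b0 by (simp add: L1_0_def L1_def f_def[abs_def])
  qed
  have B2: "(\<lambda>x. a / b * indicator B x) \<in> L2 M"
  proof -
    have "(a / b * indicator B x)\<^sup>2 = (a / b)\<^sup>2 * indicator B x" for x
      by (simp add: power_mult_distrib indicator_def)
    then show ?thesis using b by (simp add: L2_def less_top[symmetric])
  qed
  have lower: "ennreal \<kappa> \<le> poisson_orlicz_norm M P u"
    if u: "u \<in> L_Phi M" and eq: "\<And>g. g \<in> L2 M \<inter> L_infty M \<Longrightarrow>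
        (\<integral>x. u x * g x \<partial>M) = (\<integral>x. f x * g ((T ^^ n) x) \<partial>M)" for u n
  proof -
    interpret n: measure_preserving M "T ^^ n" by (rule measure_preserving_funpow)
    have um [measurable]: "u \<in> borel_measurable M" using u by (simp add: L_Phi_iff)
    define v where "v = n.trans (\<lambda>x. a / b * indicator B x)"
    have v: "integrable M v" using n.trans_L1(1) iB by (simp add: v_def L1_def)
    have v2: "v \<in> L2 M" unfolding v_def by (rule n.trans_L2(1)[OF B2])
    have iAn: "integrable M (indicator (An n) :: 'a \<Rightarrow> real)"
      using mA[of n] Afin by auto
    \<comment> \<open>\<open>T ^^ n\<close> pulls \<open>An n\<close> back to \<open>A\<close>, so
      the indicator of \<open>An n\<close> has the pairings required of a transfer of the indicator
      of \<open>A\<close>; uniqueness does the rest.\<close>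
    have ae: "AE x in M. u x = indicator (An n) x - v x"
    proof (rule L_Phi_unique[OF u])
      show "(\<lambda>x. indicator (An n) x - v x) \<in> L_Phi M"
        by (rule L1_L_Phi) (use iAn v in \<open>simp add: L1_def\<close>)
      fix g assume g: "g \<in> L2 M \<inter> L_infty M"
      then have [measurable]: "g \<in> borel_measurable M" by (simp add: L2_def)
      have i: "integrable M (\<lambda>x. indicator (An n) x * g x)" "integrable M (\<lambda>x. v x * g x)"
        "integrable M (\<lambda>x. indicator A x * g ((T ^^ n) x))"
        using g n.L2_T[of g] n.L_infty_T[of g] iAn v iA
        by (auto intro!: L_Phi_mult_integrable L1_L_Phi simp: L1_def)
      have i': "integrable M (\<lambda>x. a / b * indicator B x * g ((T ^^ n) x))"
        using g by (intro L2_mult_integrable[OF B2 n.L2_T]) simp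
      have "(\<integral>x. indicator (An n) x * g x \<partial>M) = (\<integral>x. indicator (An n) ((T ^^ n) x) * g ((T ^^ n) x) \<partial>M)"
        by (rule n.integral_T[symmetric]) measurable
      also have "\<dots> = (\<integral>x. indicator A x * g ((T ^^ n) x) \<partial>M)"
      proof (rule Bochner_Integration.integral_cong[OF refl])
        fix x assume "x \<in> space M"
        then have "(T ^^ n) x \<in> An n \<longleftrightarrow> x \<in> A" by (subst A_eq[of n]) simp
        then show "indicator (An n) ((T ^^ n) x) * g ((T ^^ n) x) = indicator A x * g ((T ^^ n) x)"
          by (simp add: indicator_def)
      qed
      finally have 1: "(\<integral>x. indicator (An n) x * g x \<partial>M) = (\<integral>x. indicator A x * g ((T ^^ n) x) \<partial>M)" .
      have 2: "(\<integral>x. v x * g x \<partial>M) = (\<integral>x. a / b * indicator B x * g ((T ^^ n) x) \<partial>M)"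
        using n.trans_L2(3)[OF B2, of g] g by (simp only: v_def has_bochner_integral_iff IntD1)
      have "(\<integral>x. (indicator (An n) x - v x) * g x \<partial>M)
          = (\<integral>x. indicator (An n) x * g x \<partial>M) - (\<integral>x. v x * g x \<partial>M)"
        unfolding left_diff_distrib by (rule Bochner_Integration.integral_diff[OF i(1,2)])
      also have "\<dots> = (\<integral>x. f x * g ((T ^^ n) x) \<partial>M)"
        unfolding 1 2 f_def left_diff_distrib by (rule Bochner_Integration.integral_diff[OF i(3) i', symmetric])
      finally show "(\<integral>x. u x * g x \<partial>M) = (\<integral>x. (indicator (An n) x - v x) * g x \<partial>M)"
        using eq[OF g] by simp
    qed
    have iu: "integrable M u"
    proof (rule integrable_cong_AE_imp[OF Bochner_Integration.integrable_diff[OF iAn v] um])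
      show "AE x in M. indicator (An n) x - v x = u x" using ae by eventually_elim simp
    qed
    \<comment> \<open>\<open>z\<close> equals \<open>v\<close> almost everywhere, but being defined
      by subtraction it lets \<open>compensated_N_diff\<close> relate it directly to
      \<open>u\<close> and the indicator of \<open>An n\<close>.\<close>
    define z where "z x = indicator (An n) x - u x" for x
    have iz: "integrable M z" unfolding z_def by (rule Bochner_Integration.integrable_diff[OF iAn iu])
    have [measurable]: "z \<in> borel_measurable M" using iz by auto
    have zv: "AE x in M. (v x)\<^sup>2 = (z x)\<^sup>2" using ae by eventually_elim (simp add: z_def)
    have v2i: "integrable M (\<lambda>x. (v x)\<^sup>2)" using v2 by (simp add: L2_def)
    have z2: "integrable M (\<lambda>x. (z x)\<^sup>2)"
      by (rule integrable_cong_AE_imp[OF v2i _ zv]) measurable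
    have "(\<integral>x. (z x)\<^sup>2 \<partial>M) = (\<integral>x. (v x)\<^sup>2 \<partial>M)"
      using zv v2i z2 by (intro integral_cong_AE) auto
    also have "\<dots> \<le> (\<integral>x. (a / b * indicator B x)\<^sup>2 \<partial>M)" unfolding v_def by (rule n.trans_L2(2)[OF B2])
    also have "\<dots> = (\<integral>x. (a / b)\<^sup>2 * indicator B x \<partial>M)"
      by (intro Bochner_Integration.integral_cong) (auto simp: power_mult_distrib indicator_def)
    also have "\<dots> = (a / b)\<^sup>2 * b"
      using sets.sets_into_space[OF B] by (simp add: mB Int_absorb2 Int_absorb1)
    also have "\<dots> = a\<^sup>2 / b" using b0 by (simp add: power2_eq_square)
    also have "\<dots> = (a / (2 * exp a))\<^sup>2" by (simp only: b_def power_divide)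
    also have "a / (2 * exp a) = \<kappa>" by (simp only: \<kappa>_def exp_minus divide_inverse inverse_mult_distrib ac_simps)
    finally have "sqrt (\<integral>x. (z x)\<^sup>2 \<partial>M) \<le> \<kappa>" using \<kappa> by (intro real_le_lsqrt) auto
    then have Cz: "(\<integral>\<^sup>+ \<omega>. ennreal \<bar>compensated_N M z \<omega>\<bar> \<partial>P) \<le> ennreal \<kappa>"
      using compensated_N_L2(2)[OF iz z2] by (meson ennreal_leI order_trans)
    have "ennreal \<kappa> + ennreal \<kappa> = ennreal (a * exp (- a))"
      using \<kappa> by (subst ennreal_plus[symmetric]) (auto simp: \<kappa>_def)
    also have "\<dots> \<le> (\<integral>\<^sup>+ \<omega>. ennreal \<bar>compensated_N M (indicator (An n)) \<omega>\<bar> \<partial>P)"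
      using compensated_N_indicator_lower[OF An[of n]] mA[of n] Afin by (simp add: a_def measure_def)
    also have "\<dots> \<le> (\<integral>\<^sup>+ \<omega>. ennreal \<bar>compensated_N M z \<omega>\<bar> + ennreal \<bar>compensated_N M u \<omega>\<bar> \<partial>P)"
    proof (rule nn_integral_mono_AE, use compensated_N_diff[OF iAn iu] in eventually_elim)
      fix \<omega> assume "compensated_N M (\<lambda>x. indicator (An n) x - u x) \<omega>
          = compensated_N M (indicator (An n)) \<omega> - compensated_N M u \<omega>"
      then have "\<bar>compensated_N M (indicator (An n)) \<omega>\<bar> \<le> \<bar>compensated_N M z \<omega>\<bar> + \<bar>compensated_N M u \<omega>\<bar>"
        unfolding z_def[abs_def, symmetric] by linarith
      then show "ennreal \<bar>compensated_N M (indicator (An n)) \<omega>\<bar>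
          \<le> ennreal \<bar>compensated_N M z \<omega>\<bar> + ennreal \<bar>compensated_N M u \<omega>\<bar>"
        by (simp add: ennreal_leI flip: ennreal_plus)
    qed
    also have "\<dots> = (\<integral>\<^sup>+ \<omega>. ennreal \<bar>compensated_N M z \<omega>\<bar> \<partial>P) + (\<integral>\<^sup>+ \<omega>. ennreal \<bar>compensated_N M u \<omega>\<bar> \<partial>P)"
      by (rule nn_integral_add) measurable
    also have "\<dots> \<le> ennreal \<kappa> + poisson_orlicz_norm M P u"
      unfolding poisson_orlicz_norm_L1[OF iu] by (rule add_right_mono[OF Cz])
    finally show ?thesis unfolding ennreal_add_left_cancel_le by auto
  qed
  show ?thesis
  proof (intro bexI[OF _ f0] allI impI notI)
    fix u
    assume u: "\<forall>n. u n \<in> L_Phi M \<and> (\<forall>g\<in>L2 M \<inter> L_infty M.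
        (\<integral>x. u n x * g x \<partial>M) = (\<integral>x. f x * g ((T ^^ n) x) \<partial>M))"
      and lim: "(\<lambda>n. poisson_orlicz_norm M P (u n)) \<longlonglongrightarrow> 0"
    have "ennreal \<kappa> \<le> poisson_orlicz_norm M P (u n)" for n using lower[of "u n" n] u by blast
    then have "ennreal \<kappa> \<le> 0" using LIMSEQ_le_const[OF lim] by blast
    then show False using \<kappa> by (simp add: ennreal_le_epsilon)
  qed
qed

end

theorem mainTheorem5:
  fixes M :: "'a measure" and T :: "'a \<Rightarrow> 'a" and P :: "'a measure measure"
  assumes "lebesgue_line_space M"
    and "endomorphism M T"
    and "poisson_measure M P"
  shows "(remotely_infinite M T \<longleftrightarrow>
            (\<forall>f \<in> L_Phi M.
               (\<lambda>n. poisson_orlicz_norm M P (poisson_transfer M (T ^^ n) f)) \<longlonglongrightarrow> 0)) \<and>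
         (remotely_infinite M T \<longleftrightarrow>
            (\<forall>f \<in> L1_0 M.
               (\<lambda>n. poisson_orlicz_norm M P (transfer M (T ^^ n) f)) \<longlonglongrightarrow> 0)) \<and>
         (remotely_infinite M T \<longleftrightarrow>
            (\<forall>f \<in> L1 M.
               (\<lambda>n. poisson_orlicz_norm M P (transfer M (T ^^ n) f)) \<longlonglongrightarrow> 0))"
proof -
  obtain \<phi> :: "'a \<Rightarrow> real" where \<phi>: "\<phi> \<in> measurable M lborel" "distr M lborel \<phi> = lborel"
    using assms(1) unfolding lebesgue_line_space_def by blast
  interpret M: sigma_finite_measure M
    \<comment> \<open>An exhaustion of the line pulls back along \<phi>, so \<sigma>-finiteness
      passes from the image measure to \<open>M\<close>.\<close>
    using sigma_finite_measure_distr[OF _ \<phi>(1)] \<phi>(2) lborel.sigma_finite_measure_axioms by simp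
  interpret prob_space P using assms(3) by (simp add: poisson_measure_def)
  interpret poisson_space M P by standard (rule assms(3))
  interpret measure_preserving M T by (rule M.measure_preservingI[OF assms(2)])
  interpret poisson_suspension M P T ..
  \<comment> \<open>Preimages of intervals; arbitrarily large \<open>b\<close> are available because
    the model is the whole line.\<close>
  have big: "\<exists>B\<in>sets M. emeasure M B = ennreal b" if "0 < b" for b :: real
  proof
    show "\<phi> -` {0..b} \<inter> space M \<in> sets M" using \<phi>(1) by (rule measurable_sets) simp
    show "emeasure M (\<phi> -` {0..b} \<inter> space M) = ennreal b"
      using emeasure_distr[OF \<phi>(1), of "{0..b}"] \<phi>(2) that by simp
  qed
  note pt = measure_preserving.poisson_transfer_props[OF measure_preserving_funpow]
    and tr = measure_preserving.transfer_props[OF measure_preserving_funpow]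
  have L1_0: "f \<in> L1 M" if "f \<in> L1_0 M" for f using that by (simp add: L1_0_def)
  show ?thesis
  proof (cases "remotely_infinite M T")
    case True
    have "(\<lambda>n. poisson_orlicz_norm M P (poisson_transfer M (T ^^ n) f)) \<longlonglongrightarrow> 0" if "f \<in> L_Phi M" for f
      by (rule remotely_infinite_imp_tendsto[OF True that pt[OF that]])
    moreover have "(\<lambda>n. poisson_orlicz_norm M P (transfer M (T ^^ n) f)) \<longlonglongrightarrow> 0" if "f \<in> L1 M" for f
      by (rule remotely_infinite_imp_tendsto[OF True L1_L_Phi[OF that] tr[OF that]])
    ultimately show ?thesis using True L1_0 by blast
  next
    case False
    \<comment> \<open>This \<open>f\<close> lies in all three function spaces, so it refutes the
      three convergence statements at once.\<close>
    then obtain f where f: "f \<in> L1_0 M" and no: "\<And>u. (\<And>n. u n \<in> L_Phi M) \<Longrightarrow>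
        (\<And>n g. g \<in> L2 M \<inter> L_infty M \<Longrightarrow> (\<integral>x. u n x * g x \<partial>M) = (\<integral>x. f x * g ((T ^^ n) x) \<partial>M)) \<Longrightarrow>
        \<not> (\<lambda>n. poisson_orlicz_norm M P (u n)) \<longlonglongrightarrow> 0"
      using tendsto_imp_remotely_infinite[OF big False] by blast
    note f1 = L1_0[OF f]
    have "\<not> (\<lambda>n. poisson_orlicz_norm M P (poisson_transfer M (T ^^ n) f)) \<longlonglongrightarrow> 0"
      by (rule no[OF pt[OF L1_L_Phi[OF f1]]])
    moreover have "\<not> (\<lambda>n. poisson_orlicz_norm M P (transfer M (T ^^ n) f)) \<longlonglongrightarrow> 0"
      by (rule no[OF tr[OF f1]])
    ultimately show ?thesis using False f f1 L1_L_Phi[OF f1] by blast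
  qed
qed

end
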